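(* Let $(M^{2m},J,g)$ be a standard Kähler manifold and let $(T^{*}_{1}M,{}^{BS}\hat g)$ be its unit cotangent bundle equipped with the metric induced by the Berger-type deformed Sasaki metric with constant $\delta$. Let $\nabla$ and $R$ be the Levi-Civita connection and curvature tensor of $(M,g)$, and let ${}^{BS}\widehat\nabla$ be the Levi-Civita connection of $(T^{*}_{1}M,{}^{BS}\hat g)$. Then for all vector fields $X,Y$ and all $1$-forms $\omega,\theta$ on $M$, at every point $(x,p)\in T_1^{*}M$: ${}^{BS}\widehat{\nabla}_{{}^{H}X}{}^{H}Y={}^{H}(\nabla_{X}Y)+\frac{1}{2}\,{}^{T}(pR(X,Y))$; ${}^{BS}\widehat{\nabla}_{{}^{H}X}{}^{T}\theta={}^{T}(\nabla_{X}\theta)+\frac12\Big({}^{H}(R(\widetilde p,\widetilde\theta)X)-\delta^{2}g^{-1}(\theta,pJ)\,{}^{H}(R(\widetilde p,J\widetilde p)X)\Big)$; ${}^{BS}\widehat{\nabla}_{{}^{T}\omega}{}^{H}Y=\frac12\Big({}^{H}(R(\widetilde p,\widetilde\omega)Y)-\delta^{2}g^{-1}(\omega,pJ)\,{}^{H}(R(\widetilde p,J\widetilde p)Y)\Big)$; ${}^{BS}\widehat{\nabla}_{{}^{T}\omega}{}^{T}\theta=-g^{-1}(\theta,p)\,{}^{T}\omega+\delta^{2}\big(g^{-1}(\omega,pJ)\,{}^{T}(\theta J)+g^{-1}(\theta,pJ)\,{}^{T}(\omega J)\big)-\delta^{2}\big(g^{-1}(\omega,pJ)g^{-1}(\thet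a,p)+g^{-1}(\omega,p)g^{-1}(\theta,pJ)\big)\,{}^{T}(pJ)$.
   Context: All objects are smooth. A standard Kähler manifold $(M^{2m},J,g)$ is a $2m$-dimensional manifold with an almost complex structure $J$ ($J^2=-I$) and a Riemannian metric $g$ with $g(JX,JY)=g(X,Y)$ such that $\nabla J=0$, where $\nabla$ is the Levi-Civita connection of $g$. The curvature convention is $R(X,Y)Z=\nabla_X\nabla_YZ-\nabla_Y\nabla_XZ-\nabla_{[X,Y]}Z$. For a covector (or $1$-form) $\omega$, $\widetilde\omega$ is the vector (field) with $g(\widetilde\omega,X)=\omega(X)$ for all $X$; $g^{-1}(\omega,\theta)=g(\widetilde\omega,\widetilde\theta)$; $\omega J$ is the covector $(\omega J)(X)=\omega(JX)$; and $pR(X,Y)$ is the covector $Z\mapsto p(R(X,Y)Z)$. In the coordinates $(x^i,p_i)$ on $T^{*}M$ induced by coordinates $(x^i)$ on $M$, with Christoffel symbols $\Gamma^k_{ij}$ of $g$, the horizontal lift of $X=X^i\partial_{x^i}$ is ${}^{H}X=X^{i}\partial_{x^i}+p_{h}\Gamma^{h}_{ij}X^{j}\partial_{p_i}$ and the vertical lift of $\omega=\omega_idx^i$ is ${}^{V}\omega=\omega_i\partial_{p_i}$. In the formulas, $p$ is the fibre component of the point $(x,p)$, and lifts of expressions involving $p$ are lifts to $(x,p)$ of the indicated vector/covector at $x$. The Berger-type deformed Sasaki metric ${}^{BS}g$ on $T^{*}M$, with real constant $\delta$, is the Riemannian metric defined at $(x,p)$ by ${}^{BS}g({}^{H}X,{}^{H}Y)=g(X,Y)$,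 ${}^{BS}g({}^{H}X,{}^{V}\theta)=0$, ${}^{BS}g({}^{V}\omega,{}^{V}\theta)=g^{-1}(\omega,\theta)+\delta^{2}g^{-1}(\omega,pJ)\,g^{-1}(\theta,pJ)$. The unit cotangent bundle is the hypersurface $T^{*}_1M=\{(x,p)\in T^{*}M: g^{-1}(p,p)=1\}$, and ${}^{BS}\hat g$ is the metric induced on it by ${}^{BS}g$; its unit normal at $(x,p)$ is ${}^{V}p$. Horizontal lifts are tangent to $T_1^*M$. The tangential lift of a covector $\omega$ at $(x,p)\in T_1^{*}M$ is ${}^{T}\omega={}^{V}\omega-g^{-1}(\omega,p)\,{}^{V}p$, which is tangent to $T_1^*M$. *)

theory Defs
  imports "HOL-Analysis.Analysis"
begin

section \<open>Smooth maps between Euclidean spaces\<close>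

text \<open>For open \<open>S\<close>, \<open>Ck_on k f S\<close> says that \<open>f\<close> is \<open>k\<close> times continuously differentiable on \<open>S\<close>.\<close>

primrec Ck_on :: "nat \<Rightarrow> ('e::euclidean_space \<Rightarrow> 'b::real_normed_vector) \<Rightarrow> 'e set \<Rightarrow> bool" where
  "Ck_on 0 f S \<longleftrightarrow> continuous_on S f"
| "Ck_on (Suc k) f S \<longleftrightarrow>
     f differentiable_on S \<and> (\<forall>v. Ck_on k (\<lambda>x. frechet_derivative f (at x) v) S)"

definition smooth_on :: "'e::euclidean_space set \<Rightarrow> ('e \<Rightarrow> 'b::real_normed_vector) \<Rightarrow> bool" where
  "smooth_on S f \<longleftrightarrow> (\<forall>k. Ck_on k f S)"

section \<open>Smooth manifolds and their tangent spaces\<close>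

text \<open>
  A manifold structure consists of an atlas and of the choice of one preferred chart around every
  point; the choice carries no geometric information.  It serves to represent tangent vectors (and
  covectors): a tangent vector at \<open>x\<close> is an element of the model space, namely the tuple of its
  components in the chart \<open>pref M x\<close>.  Components in other charts are obtained from the
  derivative of the chart transition.  No topology on the point type is used; the topology of the
  manifold is the one induced by the atlas.
\<close>

type_synonym ('a, 'e) chart = "'a set \<times> ('a \<Rightarrow> 'e)"

record ('a, 'e) mfd =
  charts :: "('a, 'e) chart set"
  pref :: "'a \<Rightarrow> ('a, 'e) chart"

definition points :: "('a, 'e) mfd \<Rightarrow> 'a set" where
  "points M = (\<Union>c\<in>charts M. fst c)"

definition inv_chart :: "('a, 'e) chart \<Rightarrow> 'e \<Rightarrow> 'a" where
  "inv_chart c = inv_into (fst c) (snd c)"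

definition transition :: "('a, 'e) chart \<Rightarrow> ('a, 'e) chart \<Rightarrow> 'e \<Rightarrow> 'e" where
  "transition c d = snd d \<circ> inv_chart c"

definition mfd_topology :: "('a, 'e::euclidean_space) mfd \<Rightarrow> 'a topology" where
  "mfd_topology M =
     topology (\<lambda>V. V \<subseteq> points M \<and> (\<forall>c\<in>charts M. open (snd c ` (V \<inter> fst c))))"

definition smooth_manifold :: "('a, 'e::euclidean_space) mfd \<Rightarrow> bool" where
  "smooth_manifold M \<longleftrightarrow>
     (\<forall>c\<in>charts M. inj_on (snd c) (fst c)) \<and>
     (\<forall>c\<in>charts M. \<forall>d\<in>charts M. open (snd c ` (fst c \<inter> fst d)) \<and>
        smooth_on (snd c ` (fst c \<inter> fst d)) (transition c d)) \<and>
     (\<forall>x\<in>points M. pref M x \<in> charts M \<and> x \<in> fst (pref M x)) \<and>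
     Hausdorff_space (mfd_topology M) \<and> second_countable (mfd_topology M)"

definition change :: "('a, 'e::euclidean_space) chart \<Rightarrow> ('a, 'e) chart \<Rightarrow> 'a \<Rightarrow> 'e \<Rightarrow> 'e" where
  "change c d x = frechet_derivative (transition c d) (at (snd c x))"

text \<open>Components in the chart \<open>c\<close> of a tangent vector at \<open>x\<close>, and conversely.\<close>

definition to_chart :: "('a, 'e::euclidean_space) mfd \<Rightarrow> ('a, 'e) chart \<Rightarrow> 'a \<Rightarrow> 'e \<Rightarrow> 'e" where
  "to_chart M c x = change (pref M x) c x"

definition from_chart :: "('a, 'e::euclidean_space) mfd \<Rightarrow> ('a, 'e) chart \<Rightarrow> 'a \<Rightarrow> 'e \<Rightarrow> 'e" where
  "from_chart M c x = change c (pref M x) x"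

section \<open>Calculus on an embedded submanifold\<close>

text \<open>
  In this section \<open>S\<close> is an embedded submanifold of \<open>M\<close>; the case \<open>S = points M\<close> is the calculus
  on \<open>M\<close> itself.  Smooth functions on \<open>S\<close> are those that extend smoothly to the ambient manifold
  near every point of \<open>S\<close>; tangent vectors of \<open>S\<close> are the velocities of smooth curves in \<open>S\<close>.
\<close>

definition extends_at ::
  "'a set \<Rightarrow> ('a, 'e::euclidean_space) chart \<Rightarrow> 'a \<Rightarrow> ('a \<Rightarrow> 'b::real_normed_vector) \<Rightarrow> ('e \<Rightarrow> 'b) \<Rightarrow> bool" where
  "extends_at S c q f F \<longleftrightarrow>
     (\<exists>W. open W \<and> snd c q \<in> W \<and> smooth_on W F \<and>
          (\<forall>y\<in>S \<inter> fst c. snd c y \<in> W \<longrightarrow> f y = F (snd c y)))"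

definition smooth_fun ::
  "('a, 'e::euclidean_space) mfd \<Rightarrow> 'a set \<Rightarrow> ('a \<Rightarrow> 'b::real_normed_vector) \<Rightarrow> bool" where
  "smooth_fun M S f \<longleftrightarrow> (\<forall>q\<in>S. \<forall>c\<in>charts M. q \<in> fst c \<longrightarrow> (\<exists>F. extends_at S c q f F))"

definition tangent_space :: "('a, 'e::euclidean_space) mfd \<Rightarrow> 'a set \<Rightarrow> 'a \<Rightarrow> 'e set" where
  "tangent_space M S q =
     {v. \<exists>\<epsilon>>0. \<exists>\<gamma>::real \<Rightarrow> 'a.
        \<gamma> ` {-\<epsilon><..<\<epsilon>} \<subseteq> S \<inter> fst (pref M q) \<and> \<gamma> 0 = q \<and>
        smooth_on {-\<epsilon><..<\<epsilon>} (snd (pref M q) \<circ> \<gamma>) \<and>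
        ((snd (pref M q) \<circ> \<gamma>) has_vector_derivative v) (at 0)}"

text \<open>
  Derivative at \<open>q\<close> of a smooth function \<open>f\<close> on \<open>S\<close> in the direction of the tangent vector \<open>v\<close> of
  \<open>S\<close>; it does not depend on the extension.
\<close>

definition dir_deriv ::
  "('a, 'e::euclidean_space) mfd \<Rightarrow> 'a set \<Rightarrow> 'a \<Rightarrow> 'e \<Rightarrow> ('a \<Rightarrow> 'b::real_normed_vector) \<Rightarrow> 'b" where
  "dir_deriv M S q v f =
     (THE d. \<exists>F. extends_at S (pref M q) q f F \<and>
                 d = frechet_derivative F (at (snd (pref M q) q)) v)"

definition vector_fields :: "('a, 'e::euclidean_space) mfd \<Rightarrow> 'a set \<Rightarrow> ('a \<Rightarrow> 'e) set" where
  "vector_fields M S =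
     {X. (\<forall>q\<in>S. X q \<in> tangent_space M S q) \<and>
         (\<forall>c\<in>charts M. smooth_fun M (S \<inter> fst c) (\<lambda>y. to_chart M c y (X y)))}"

text \<open>Lie bracket, by the coordinate formula \<open>[X,Y]\<^sup>i = X(Y\<^sup>i) - Y(X\<^sup>i)\<close> in the preferred chart of
  the point at which it is evaluated.\<close>

definition lie_bracket ::
  "('a, 'e::euclidean_space) mfd \<Rightarrow> 'a set \<Rightarrow> ('a \<Rightarrow> 'e) \<Rightarrow> ('a \<Rightarrow> 'e) \<Rightarrow> 'a \<Rightarrow> 'e" where
  "lie_bracket M S X Y q =
     dir_deriv M S q (X q) (\<lambda>y. to_chart M (pref M q) y (Y y)) -
     dir_deriv M S q (Y q) (\<lambda>y. to_chart M (pref M q) y (X y))"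

section \<open>Riemannian geometry\<close>

text \<open>A metric assigns to every point a bilinear form on tangent vectors.\<close>

definition riemannian_metric ::
  "('a, 'e::euclidean_space) mfd \<Rightarrow> ('a \<Rightarrow> 'e \<Rightarrow> 'e \<Rightarrow> real) \<Rightarrow> bool" where
  "riemannian_metric M g \<longleftrightarrow>
     (\<forall>x\<in>points M. bilinear (g x) \<and> (\<forall>u v. g x u v = g x v u) \<and> (\<forall>u. u \<noteq> 0 \<longrightarrow> g x u u > 0)) \<and>
     (\<forall>c\<in>charts M. \<forall>u v.
        smooth_fun M (fst c) (\<lambda>y. g y (from_chart M c y u) (from_chart M c y v)))"

text \<open>\<open>D\<close> is the Levi-Civita connection on the submanifold \<open>S\<close> of \<open>M\<close>, for the metric that \<open>g\<close>
  induces on \<open>S\<close>.\<close>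

definition levi_civita ::
  "('a, 'e::euclidean_space) mfd \<Rightarrow> 'a set \<Rightarrow> ('a \<Rightarrow> 'e \<Rightarrow> 'e \<Rightarrow> real) \<Rightarrow>
   (('a \<Rightarrow> 'e) \<Rightarrow> ('a \<Rightarrow> 'e) \<Rightarrow> 'a \<Rightarrow> 'e) \<Rightarrow> bool" where
  "levi_civita M S g D \<longleftrightarrow>
     (\<forall>X\<in>vector_fields M S. \<forall>Y\<in>vector_fields M S. D X Y \<in> vector_fields M S) \<and>
     (\<forall>X\<in>vector_fields M S. \<forall>Y\<in>vector_fields M S. \<forall>Z\<in>vector_fields M S. \<forall>q\<in>S.
        D (\<lambda>y. X y + Y y) Z q = D X Z q + D Y Z q \<and>
        D X (\<lambda>y. Y y + Z y) q = D X Y q + D X Z q) \<and>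
     (\<forall>f. smooth_fun M S f \<longrightarrow> (\<forall>X\<in>vector_fields M S. \<forall>Y\<in>vector_fields M S. \<forall>q\<in>S.
        D (\<lambda>y. f y *\<^sub>R X y) Y q = f q *\<^sub>R D X Y q \<and>
        D X (\<lambda>y. f y *\<^sub>R Y y) q = dir_deriv M S q (X q) f *\<^sub>R Y q + f q *\<^sub>R D X Y q)) \<and>
     (\<forall>X\<in>vector_fields M S. \<forall>Y\<in>vector_fields M S. \<forall>q\<in>S.
        D X Y q - D Y X q = lie_bracket M S X Y q) \<and>
     (\<forall>X\<in>vector_fields M S. \<forall>Y\<in>vector_fields M S. \<forall>Z\<in>vector_fields M S. \<forall>q\<in>S.
        dir_deriv M S q (X q) (\<lambda>y. g y (Y y) (Z y)) = g q (D X Y q) (Z q) + g q (Y q) (D X Z q))"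

text \<open>Curvature tensor at \<open>x\<close>; the value does not depend on the fields extending \<open>u\<close>, \<open>v\<close>, \<open>w\<close>.\<close>

definition curvature ::
  "('a, 'e::euclidean_space) mfd \<Rightarrow> (('a \<Rightarrow> 'e) \<Rightarrow> ('a \<Rightarrow> 'e) \<Rightarrow> 'a \<Rightarrow> 'e) \<Rightarrow>
   'a \<Rightarrow> 'e \<Rightarrow> 'e \<Rightarrow> 'e \<Rightarrow> 'e" where
  "curvature M D x u v w =
     (THE r. \<forall>X\<in>vector_fields M (points M). \<forall>Y\<in>vector_fields M (points M).
             \<forall>Z\<in>vector_fields M (points M). X x = u \<and> Y x = v \<and> Z x = w \<longrightarrow>
        r = D X (D Y Z) x - D Y (D X Z) x - D (lie_bracket M (points M) X Y) Z x)"

text \<open>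
  Christoffel symbols of \<open>g\<close> at \<open>x\<close> in the chart \<open>pref M x\<close>:
  \<open>christoffel M g x k i j = 1/2 \<Sum>\<^sub>l g\<^sup>k\<^sup>l (\<partial>\<^sub>i g\<^sub>j\<^sub>l + \<partial>\<^sub>j g\<^sub>i\<^sub>l - \<partial>\<^sub>l g\<^sub>i\<^sub>j)\<close>, where \<open>k\<close> is the upper index.
\<close>

definition metric_coeff ::
  "('a, real^'n) mfd \<Rightarrow> ('a \<Rightarrow> real^'n \<Rightarrow> real^'n \<Rightarrow> real) \<Rightarrow> ('a, real^'n) chart \<Rightarrow> real^'n \<Rightarrow> real^'n^'n" where
  "metric_coeff M g c z =
     (\<chi> i j. g (inv_chart c z) (from_chart M c (inv_chart c z) (axis i 1))
                               (from_chart M c (inv_chart c z) (axis j 1)))"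

definition metric_partial ::
  "('a, real^'n) mfd \<Rightarrow> ('a \<Rightarrow> real^'n \<Rightarrow> real^'n \<Rightarrow> real) \<Rightarrow> 'a \<Rightarrow> 'n \<Rightarrow> 'n \<Rightarrow> 'n \<Rightarrow> real" where
  "metric_partial M g x l i j =
     frechet_derivative (\<lambda>z. metric_coeff M g (pref M x) z $ i $ j) (at (snd (pref M x) x)) (axis l 1)"

definition christoffel ::
  "('a, real^'n) mfd \<Rightarrow> ('a \<Rightarrow> real^'n \<Rightarrow> real^'n \<Rightarrow> real) \<Rightarrow> 'a \<Rightarrow> 'n \<Rightarrow> 'n \<Rightarrow> 'n \<Rightarrow> real" where
  "christoffel M g x k i j =
     1/2 * (\<Sum>l\<in>UNIV. matrix_inv (metric_coeff M g (pref M x) (snd (pref M x) x)) $ k $ l *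
        (metric_partial M g x i j l + metric_partial M g x j i l - metric_partial M g x l i j))"

section \<open>Covectors\<close>

text \<open>A covector at \<open>x\<close> is also represented by its components in the chart \<open>pref M x\<close>, so that its
  value on a tangent vector \<open>u\<close> is \<open>\<omega> \<bullet> u\<close>.\<close>

definition covec_to_chart :: "('a, real^'n) mfd \<Rightarrow> ('a, real^'n) chart \<Rightarrow> 'a \<Rightarrow> real^'n \<Rightarrow> real^'n" where
  "covec_to_chart M c x \<omega> = (\<chi> i. \<omega> \<bullet> from_chart M c x (axis i 1))"

definition one_forms :: "('a, real^'n) mfd \<Rightarrow> ('a \<Rightarrow> real^'n) set" where
  "one_forms M = {\<omega>. \<forall>c\<in>charts M. smooth_fun M (fst c) (\<lambda>y. covec_to_chart M c y (\<omega> y))}"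

text \<open>The covector \<open>\<omega> \<circ> A\<close> for an endomorphism \<open>A\<close> of the tangent space; \<open>\<omega>J\<close> is
  \<open>covec_comp \<omega> (J x)\<close> and \<open>pR(u,v)\<close> is \<open>covec_comp p (curvature M D x u v)\<close>.\<close>

definition covec_comp :: "real^'n \<Rightarrow> (real^'n \<Rightarrow> real^'n) \<Rightarrow> real^'n" where
  "covec_comp \<omega> A = (\<chi> i. \<omega> \<bullet> A (axis i 1))"

definition sharp :: "('a \<Rightarrow> real^'n \<Rightarrow> real^'n \<Rightarrow> real) \<Rightarrow> 'a \<Rightarrow> real^'n \<Rightarrow> real^'n" where
  "sharp g x \<omega> = (THE v. \<forall>u. g x v u = \<omega> \<bullet> u)"

definition ginv :: "('a \<Rightarrow> real^'n \<Rightarrow> real^'n \<Rightarrow> real) \<Rightarrow> 'a \<Rightarrow> real^'n \<Rightarrow> real^'n \<Rightarrow> real" where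
  "ginv g x \<omega> \<theta> = g x (sharp g x \<omega>) (sharp g x \<theta>)"

text \<open>Covariant derivative of a one-form: \<open>(D\<^sub>X\<theta>)(Y) = X(\<theta>(Y)) - \<theta>(D\<^sub>XY)\<close> for all \<open>Y\<close>.\<close>

definition covd_form ::
  "('a, real^'n) mfd \<Rightarrow> (('a \<Rightarrow> real^'n) \<Rightarrow> ('a \<Rightarrow> real^'n) \<Rightarrow> 'a \<Rightarrow> real^'n) \<Rightarrow>
   ('a \<Rightarrow> real^'n) \<Rightarrow> ('a \<Rightarrow> real^'n) \<Rightarrow> 'a \<Rightarrow> real^'n" where
  "covd_form M D X \<theta> x =
     (THE \<eta>. \<forall>Y\<in>vector_fields M (points M).
        \<eta> \<bullet> Y x = dir_deriv M (points M) x (X x) (\<lambda>y. \<theta> y \<bullet> Y y) - \<theta> x \<bullet> D X Y x)"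

section \<open>Kaehler manifolds\<close>

definition almost_complex_structure ::
  "('a, 'e::euclidean_space) mfd \<Rightarrow> ('a \<Rightarrow> 'e \<Rightarrow> 'e) \<Rightarrow> bool" where
  "almost_complex_structure M J \<longleftrightarrow>
     (\<forall>x\<in>points M. linear (J x) \<and> (\<forall>u. J x (J x u) = - u)) \<and>
     (\<forall>c\<in>charts M. \<forall>u. smooth_fun M (fst c) (\<lambda>y. to_chart M c y (J y (from_chart M c y u))))"

text \<open>\<open>D\<close> is the Levi-Civita connection of \<open>(M, g)\<close>; the last condition is \<open>DJ = 0\<close>.\<close>

definition kaehler_manifold ::
  "('a, 'e::euclidean_space) mfd \<Rightarrow> ('a \<Rightarrow> 'e \<Rightarrow> 'e) \<Rightarrow> ('a \<Rightarrow> 'e \<Rightarrow> 'e \<Rightarrow> real) \<Rightarrow>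
   (('a \<Rightarrow> 'e) \<Rightarrow> ('a \<Rightarrow> 'e) \<Rightarrow> 'a \<Rightarrow> 'e) \<Rightarrow> bool" where
  "kaehler_manifold M J g D \<longleftrightarrow>
     smooth_manifold M \<and> almost_complex_structure M J \<and> riemannian_metric M g \<and>
     (\<forall>x\<in>points M. \<forall>u v. g x (J x u) (J x v) = g x u v) \<and>
     levi_civita M (points M) g D \<and>
     (\<forall>X\<in>vector_fields M (points M). \<forall>Y\<in>vector_fields M (points M). \<forall>x\<in>points M.
        D X (\<lambda>y. J y (Y y)) x - J x (D X Y x) = 0)"

section \<open>The cotangent bundle\<close>

text \<open>
  The points of the cotangent bundle are the pairs \<open>(x, p)\<close> with \<open>p\<close> a covector at \<open>x\<close>; a chart of
  \<open>M\<close> with coordinates \<open>x\<^sup>i\<close> induces the chart with coordinates \<open>(x\<^sup>i, p\<^sub>i)\<close>.  The preferred chart at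
  \<open>(x, p)\<close> is the one induced by \<open>pref M x\<close>, so that a tangent vector at \<open>(x, p)\<close> is a pair \<open>(a, b)\<close>
  standing for \<open>a\<^sup>i \<partial>/\<partial>x\<^sup>i + b\<^sub>i \<partial>/\<partial>p\<^sub>i\<close> in these coordinates.
\<close>

definition cotangent_chart ::
  "('a, real^'n) mfd \<Rightarrow> ('a, real^'n) chart \<Rightarrow> ('a \<times> (real^'n), (real^'n) \<times> (real^'n)) chart" where
  "cotangent_chart M c = (fst c \<times> UNIV, \<lambda>(x, p). (snd c x, covec_to_chart M c x p))"

definition cotangent_bundle ::
  "('a, real^'n) mfd \<Rightarrow> ('a \<times> (real^'n), (real^'n) \<times> (real^'n)) mfd" where
  "cotangent_bundle M =
     \<lparr>charts = cotangent_chart M ` charts M, pref = (\<lambda>(x, p). cotangent_chart M (pref M x))\<rparr>"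

definition hor_lift ::
  "('a, real^'n) mfd \<Rightarrow> ('a \<Rightarrow> real^'n \<Rightarrow> real^'n \<Rightarrow> real) \<Rightarrow> 'a \<times> (real^'n) \<Rightarrow>
   real^'n \<Rightarrow> (real^'n) \<times> (real^'n)" where
  "hor_lift M g = (\<lambda>(x, p) u.
     (u, \<chi> i. \<Sum>h\<in>UNIV. \<Sum>j\<in>UNIV. p $ h * christoffel M g x h i j * u $ j))"

definition ver_lift :: "real^'n \<Rightarrow> (real^'n) \<times> (real^'n)" where
  "ver_lift \<omega> = (0, \<omega>)"

text \<open>Every tangent vector at \<open>(x, p)\<close> is uniquely the sum of the horizontal lift of a vector \<open>u\<close>
  and the vertical lift of a covector; \<open>ver_part\<close> is this covector, and \<open>u\<close> is the first component.\<close>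

definition ver_part ::
  "('a, real^'n) mfd \<Rightarrow> ('a \<Rightarrow> real^'n \<Rightarrow> real^'n \<Rightarrow> real) \<Rightarrow> 'a \<times> (real^'n) \<Rightarrow>
   (real^'n) \<times> (real^'n) \<Rightarrow> real^'n" where
  "ver_part M g q w = snd w - snd (hor_lift M g q (fst w))"

definition berger_sasaki ::
  "('a, real^'n) mfd \<Rightarrow> ('a \<Rightarrow> real^'n \<Rightarrow> real^'n) \<Rightarrow> ('a \<Rightarrow> real^'n \<Rightarrow> real^'n \<Rightarrow> real) \<Rightarrow> real \<Rightarrow>
   'a \<times> (real^'n) \<Rightarrow> (real^'n) \<times> (real^'n) \<Rightarrow> (real^'n) \<times> (real^'n) \<Rightarrow> real" where
  "berger_sasaki M J g \<delta> = (\<lambda>(x, p) w w'.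
     let \<omega> = ver_part M g (x, p) w; \<theta> = ver_part M g (x, p) w'; pJ = covec_comp p (J x) in
     g x (fst w) (fst w') + ginv g x \<omega> \<theta> + \<delta>\<^sup>2 * ginv g x \<omega> pJ * ginv g x \<theta> pJ)"

definition unit_cotangent_bundle ::
  "('a, real^'n) mfd \<Rightarrow> ('a \<Rightarrow> real^'n \<Rightarrow> real^'n \<Rightarrow> real) \<Rightarrow> ('a \<times> (real^'n)) set" where
  "unit_cotangent_bundle M g = {(x, p). x \<in> points M \<and> ginv g x p p = 1}"

definition tan_lift ::
  "('a \<Rightarrow> real^'n \<Rightarrow> real^'n \<Rightarrow> real) \<Rightarrow> 'a \<times> (real^'n) \<Rightarrow> real^'n \<Rightarrow> (real^'n) \<times> (real^'n)" where
  "tan_lift g = (\<lambda>(x, p) \<omega>. ver_lift \<omega> - ginv g x \<omega> p *\<^sub>R ver_lift p)"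

definition hor_field ::
  "('a, real^'n) mfd \<Rightarrow> ('a \<Rightarrow> real^'n \<Rightarrow> real^'n \<Rightarrow> real) \<Rightarrow> ('a \<Rightarrow> real^'n) \<Rightarrow>
   'a \<times> (real^'n) \<Rightarrow> (real^'n) \<times> (real^'n)" where
  "hor_field M g X = (\<lambda>q. hor_lift M g q (X (fst q)))"

definition tan_field ::
  "('a \<Rightarrow> real^'n \<Rightarrow> real^'n \<Rightarrow> real) \<Rightarrow> ('a \<Rightarrow> real^'n) \<Rightarrow>
   'a \<times> (real^'n) \<Rightarrow> (real^'n) \<times> (real^'n)" where
  "tan_field g \<omega> = (\<lambda>q. tan_lift g q (\<omega> (fst q)))"

text \<open>The defining equations of the Berger-type deformed Sasaki metric on lifts.\<close>

lemma berger_sasaki_lifts: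
  fixes M :: "('a, real^'n) mfd"
  assumes g: "riemannian_metric M g" and x: "x \<in> points M"
  shows "berger_sasaki M J g \<delta> (x, p) (hor_lift M g (x, p) u) (hor_lift M g (x, p) v) = g x u v"
    and "berger_sasaki M J g \<delta> (x, p) (hor_lift M g (x, p) u) (ver_lift \<theta>) = 0"
    and "berger_sasaki M J g \<delta> (x, p) (ver_lift \<omega>) (ver_lift \<theta>) =
           ginv g x \<omega> \<theta> + \<delta>\<^sup>2 * ginv g x \<omega> (covec_comp p (J x)) * ginv g x \<theta> (covec_comp p (J x))"
proof -
  have bil: "bilinear (g x)" and pos: "\<And>u. u \<noteq> 0 \<Longrightarrow> g x u u > 0"
    using g x unfolding riemannian_metric_def by auto
  have "sharp g x 0 = 0"
    unfolding sharp_def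
  proof (rule the_equality)
    show "\<forall>u. g x 0 u = 0 \<bullet> u"
      using bil by (simp add: bilinear_lzero)
    show "v = 0" if "\<forall>u. g x v u = 0 \<bullet> u" for v
      using that pos[of v] by force
  qed
  then have z: "ginv g x 0 \<omega> = 0" for \<omega>
    using bil by (simp add: ginv_def bilinear_lzero)
  have h: "ver_part M g (x, p) (hor_lift M g (x, p) u) = 0" "fst (hor_lift M g (x, p) u) = u" for u
    by (simp_all add: ver_part_def hor_lift_def)
  have v: "ver_part M g (x, p) (ver_lift \<omega>) = \<omega>" "fst (ver_lift \<omega>) = 0" for \<omega> :: "real^'n"
    by (simp_all add: ver_part_def hor_lift_def ver_lift_def vec_eq_iff)
  show "berger_sasaki M J g \<delta> (x, p) (hor_lift M g (x, p) u) (hor_lift M g (x, p) v) = g x u v"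
    and "berger_sasaki M J g \<delta> (x, p) (hor_lift M g (x, p) u) (ver_lift \<theta>) = 0"
    and "berger_sasaki M J g \<delta> (x, p) (ver_lift \<omega>) (ver_lift \<theta>) =
           ginv g x \<omega> \<theta> + \<delta>\<^sup>2 * ginv g x \<omega> (covec_comp p (J x)) * ginv g x \<theta> (covec_comp p (J x))"
    by (simp_all add: berger_sasaki_def Let_def h v z bilinear_rzero[OF bil])
qed

end

theory Submission
  imports Defs
begin

text \<open>
  Everything is computed in the chart that represents tangent vectors at the point in question.  There
  the connection is \<open>D\<^sub>XY = dY(X) + \<Gamma>(X,Y)\<close>, and the transformation law of \<open>\<Gamma>\<close> says exactly that horizontal
  lifts do not depend on the chart.  Hence lifted fields are smooth along the unit cotangent bundle, with
  brackets \<open>[\<^sup>HX,\<^sup>HY] = \<^sup>H[X,Y] + \<^sup>V(pR(X,Y))\<close>, \<open>[\<^sup>HX,\<^sup>T\<theta>] = \<^sup>T(D\<^sub>X\<theta>)\<close> and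
  \<open>[\<^sup>T\<omega>,\<^sup>T\<theta>] = g\<^sup>-\<^sup>1(\<omega>,p) \<^sup>T\<theta> - g\<^sup>-\<^sup>1(\<theta>,p) \<^sup>T\<omega>\<close>.

  On tangential lifts the metric is \<open>g(\<omega>\<^sup>\<sharp>,\<theta>\<^sup>\<sharp>) - p(\<omega>\<^sup>\<sharp>) p(\<theta>\<^sup>\<sharp>) + \<delta>\<^sup>2 p(J\<omega>\<^sup>\<sharp>) p(J\<theta>\<^sup>\<sharp>)\<close>: apart from the
  pulled back first term it is a polynomial in functions \<open>(x,p) \<mapsto> p(W\<^sub>x)\<close> with \<open>W\<close> a vector field, whose
  derivative is \<open>p(D\<^sub>XW)\<close> along \<open>\<^sup>HX\<close> and \<open>\<beta>(W)\<close> along \<open>\<^sup>V\<beta>\<close>.  The Koszul formula then gives the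
  connection on pairs of horizontal and on pairs of tangential lifts; the mixed cases follow from these by
  metricity and torsion-freeness.  Values of the connection at a point are compared by pairing them with lifts
  of fields that have prescribed values there, which exist because of smooth bump functions.
\<close>

section \<open>Calculus of smooth maps\<close>

text \<open>Two obstacles shape the development. A tangent vector at \<open>y\<close> is stored by
  its components in \<open>pref M y\<close>, an arbitrary function of \<open>y\<close>. A field can
  therefore be differentiated only after conversion to one fixed chart, and a formula that is to be
  differentiated again must hold in a fixed chart around the point, not just at the point in its
  preferred chart. Moreover, functions on the unit bundle are differentiated through extensions to
  the cotangent bundle, so lifts are given by formulas that make sense for every \<open>p\<close>.

  The shape of the result comes from three facts. Parallelism of \<open>J\<close> makes the deformed
  fibre metric invariant along horizontal lifts, so the fibres are totally geodesic and a horizontal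
  lift has no tangential component in its derivative along a tangential one. Pair symmetry of the
  curvature converts the vertical part of the bracket of horizontal lifts into the term in
  R(p,\<theta>) and, through the \<delta>-part of the metric, the term in R(p,Jp). Skewness of
  \<open>J\<close> makes p and pJ orthogonal, so the deformation does not affect the unit
  normal.\<close>

lemma has_frechet_derivative:
  assumes "f differentiable_on S" "open S" "x \<in> S"
  shows "(f has_derivative frechet_derivative f (at x)) (at x)"
  using assms by (metis differentiable_on_eq_differentiable_at frechet_derivative_works)

lemma frechet_derivativeI: "(f has_derivative f') (at x) \<Longrightarrow> frechet_derivative f (at x) = f'"
  by (metis frechet_derivative_at)

section \<open>Closure of the classes C^k under algebraic operations and composition\<close>

lemma Ck_on_SucI:
  assumes "open S" and d: "\<And>x. x \<in> S \<Longrightarrow> (f has_derivative f' x) (at x)"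
    and k: "\<And>v. Ck_on k (\<lambda>x. frechet_derivative f (at x) v) S"
  shows "Ck_on (Suc k) f S"
  using assms by (auto simp: differentiable_on_eq_differentiable_at differentiable_def)

text \<open>Openness matters: the derivative at a point of \<open>S\<close> is determined by the
  values on a neighbourhood inside \<open>S\<close>.\<close>

lemma Ck_on_cong:
  assumes "open S" "\<And>x. x \<in> S \<Longrightarrow> f x = g x" "Ck_on k f S"
  shows "Ck_on k g S"
  using assms(2,3)
proof (induction k arbitrary: f g)
  case 0
  then show ?case using continuous_on_cong by (metis Ck_on.simps(1))
next
  case (Suc k)
  have f: "f differentiable at x" if "x \<in> S" for x
    using Suc.prems that assms(1) differentiable_on_eq_differentiable_at by auto
  have e: "frechet_derivative f (at x) = frechet_derivative g (at x)" if "x \<in> S" for x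
    using frechet_derivative_transform_within_open[OF f[OF that] assms(1) that] Suc.prems(1) by blast
  have "(g has_derivative frechet_derivative f (at x)) (at x)" if "x \<in> S" for x
    using has_derivative_transform_within_open[OF _ assms(1) that] f[OF that] Suc.prems(1)
    by (metis frechet_derivative_works)
  moreover have "Ck_on k (\<lambda>x. frechet_derivative g (at x) v) S" for v
    using Suc.IH[of "\<lambda>x. frechet_derivative f (at x) v"] e Suc.prems(2) by auto
  ultimately show ?case by (rule Ck_on_SucI[OF assms(1)])
qed

text \<open>By uniqueness of derivatives any explicit formula \<open>f'\<close> may stand for
  \<open>frechet_derivative f\<close> on an open set. The inductions below use this rule to work
  with the Leibniz and chain rules directly.\<close>

lemma Ck_on_SucI':
  assumes "open S" and d: "\<And>x. x \<in> S \<Longrightarrow> (f has_derivative f' x) (at x)"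
    and k: "\<And>v. Ck_on k (\<lambda>x. f' x v) S"
  shows "Ck_on (Suc k) f S"
proof (rule Ck_on_SucI[OF assms(1) d])
  show "Ck_on k (\<lambda>x. frechet_derivative f (at x) v) S" for v
    by (rule Ck_on_cong[OF assms(1) _ k[of v]]) (simp add: frechet_derivativeI[OF d])
qed

lemma Ck_on_subset:
  assumes "open S" "open T" "T \<subseteq> S" "Ck_on k f S"
  shows "Ck_on k f T"
  using assms(4)
proof (induction k arbitrary: f)
  case 0
  then show ?case using assms(3) by (simp add: continuous_on_subset)
next
  case (Suc k)
  then show ?case using assms(3) differentiable_on_subset by auto
qed

lemma Ck_on_local:
  assumes "open S" "\<And>x. x \<in> S \<Longrightarrow> \<exists>T. open T \<and> x \<in> T \<and> Ck_on k f T"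
  shows "Ck_on k f S"
  using assms(2)
proof (induction k arbitrary: f)
  case 0
  have "isCont f x" if "x \<in> S" for x
    using 0[OF that] by (auto simp: continuous_on_eq_continuous_at)
  then show ?case by (simp add: continuous_at_imp_continuous_on)
next
  case (Suc k)
  have "f differentiable_on S"
    using Suc.prems differentiable_on_eq_differentiable_at assms(1)
    by (metis Ck_on.simps(2))
  moreover have "Ck_on k (\<lambda>x. frechet_derivative f (at x) v) S" for v
    by (rule Suc.IH) (use Suc.prems in \<open>auto\<close>)
  ultimately show ?case by simp
qed

lemma Ck_on_Suc_imp:
  assumes "open S" "Ck_on (Suc k) f S"
  shows "Ck_on k f S"
  using assms(2)
proof (induction k arbitrary: f)
  case 0
  then show ?case by (simp add: differentiable_imp_continuous_on)
next
  case (Suc k)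
  then show ?case by (metis Ck_on.simps(2))
qed

lemma Ck_on_const: "Ck_on k (\<lambda>x. c) S"
  by (induction k arbitrary: c) auto

lemma Ck_on_bounded_linear:
  assumes "open S" "bounded_linear L" "Ck_on k f S"
  shows "Ck_on k (\<lambda>x. L (f x)) S"
  using assms(3)
proof (induction k arbitrary: f)
  case 0
  then show ?case using assms(2) by (simp add: bounded_linear.continuous_on)
next
  case (Suc k)
  show ?case
  proof (rule Ck_on_SucI'[OF assms(1)])
    show "((\<lambda>x. L (f x)) has_derivative (\<lambda>v. L (frechet_derivative f (at x) v))) (at x)"
      if "x \<in> S" for x
      using Suc.prems
      by (intro bounded_linear.has_derivative[OF assms(2)] has_frechet_derivative[OF _ assms(1) that]) auto
    show "Ck_on k (\<lambda>x. L (frechet_derivative f (at x) v)) S" for v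
      using Suc by auto
  qed
qed

lemma Ck_on_add:
  assumes "open S" "Ck_on k f S" "Ck_on k g S"
  shows "Ck_on k (\<lambda>x. f x + g x) S"
  using assms(2,3)
proof (induction k arbitrary: f g)
  case 0
  then show ?case by (simp add: continuous_on_add)
next
  case (Suc k)
  show ?case
  proof (rule Ck_on_SucI'[OF assms(1)])
    show "((\<lambda>x. f x + g x) has_derivative
        (\<lambda>v. frechet_derivative f (at x) v + frechet_derivative g (at x) v)) (at x)"
      if "x \<in> S" for x
      using Suc.prems by (intro has_derivative_add has_frechet_derivative[OF _ assms(1) that]) auto
    show "Ck_on k (\<lambda>x. frechet_derivative f (at x) v + frechet_derivative g (at x) v) S" for v
      using Suc by auto
  qed
qed

text \<open>The Leibniz rule yields bilinear terms again, each with one undifferentiated factor of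
  class \<open>Suc k\<close>; \<open>Ck_on_Suc_imp\<close> lowers that factor to class
  \<open>k\<close> before the induction hypothesis applies.\<close>

lemma Ck_on_bilinear:
  assumes "open S" "bounded_bilinear B" "Ck_on k f S" "Ck_on k g S"
  shows "Ck_on k (\<lambda>x. B (f x) (g x)) S"
  using assms(3,4)
proof (induction k arbitrary: f g)
  case 0
  then show ?case using assms(2) by (simp add: bounded_bilinear.continuous_on)
next
  case (Suc k)
  show ?case
  proof (rule Ck_on_SucI'[OF assms(1)])
    show "((\<lambda>x. B (f x) (g x)) has_derivative
        (\<lambda>v. B (f x) (frechet_derivative g (at x) v) + B (frechet_derivative f (at x) v) (g x))) (at x)"
      if "x \<in> S" for x
      using Suc.prems by (intro bounded_bilinear.FDERIV[OF assms(2)] has_frechet_derivative[OF _ assms(1) that]) auto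
    have "Ck_on k f S" "Ck_on k g S" using Suc.prems Ck_on_Suc_imp assms(1) by blast+
    then show "Ck_on k (\<lambda>x. B (f x) (frechet_derivative g (at x) v) +
        B (frechet_derivative f (at x) v) (g x)) S" for v
      using Suc by (intro Ck_on_add assms(1)) auto
  qed
qed

lemma Ck_on_sum:
  assumes "open S" "\<And>i. i \<in> I \<Longrightarrow> Ck_on k (f i) S"
  shows "Ck_on k (\<lambda>x. \<Sum>i\<in>I. f i x) S"
proof (cases "finite I")
  case True
  then show ?thesis using assms(2)
  proof (induction I)
    case (insert i I)
    have "Ck_on k (\<lambda>x. f i x + (\<Sum>i\<in>I. f i x)) S"
      using insert by (intro Ck_on_add assms(1)) auto
    then show ?case using insert by simp
  qed (simp add: Ck_on_const)
qed (simp add: Ck_on_const)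

lemma linear_eq_Basis_sum:
  fixes L :: "'e::euclidean_space \<Rightarrow> 'b::real_vector"
  assumes "linear L"
  shows "L v = (\<Sum>b\<in>Basis. (v \<bullet> b) *\<^sub>R L b)"
proof -
  have "L v = L (\<Sum>b\<in>Basis. (v \<bullet> b) *\<^sub>R b)" by (simp add: euclidean_representation)
  then show ?thesis by (simp add: linear_sum[OF assms] linear_scale[OF assms])
qed

text \<open>\<open>Ck_on\<close> speaks of derivatives in a fixed direction, whereas the chain rule
  applies the derivative of \<open>g\<close> to a moving one. Expanding that direction in
  \<open>Basis\<close> leaves fixed directions with scalar coefficients, to which the induction
  hypothesis and the product rule apply.\<close>

lemma Ck_on_compose:
  fixes f :: "'e::euclidean_space \<Rightarrow> 'd::euclidean_space"
  assumes "open S" "open T" "f ` S \<subseteq> T" "Ck_on k f S" "Ck_on k g T"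
  shows "Ck_on k (\<lambda>x. g (f x)) S"
  using assms(4,5)
proof (induction k arbitrary: g)
  case 0
  then show ?case using assms(3) by (simp add: continuous_on_compose2)
next
  case (Suc k)
  show ?case
  proof (rule Ck_on_SucI'[OF assms(1)])
    fix x assume x: "x \<in> S"
    have "f x \<in> T" using x assms(3) by blast
    then have g: "(g has_derivative frechet_derivative g (at (f x))) (at (f x))"
      using has_frechet_derivative[of g T] Suc.prems(2) assms(2) by auto
    have "((\<lambda>x. g (f x)) has_derivative
        (\<lambda>v. frechet_derivative g (at (f x)) (frechet_derivative f (at x) v))) (at x)"
      by (rule has_derivative_compose[where f=f and g=g, OF _ g], rule has_frechet_derivative[OF _ assms(1) x])
        (use Suc.prems in \<open>auto\<close>)
    then show "((\<lambda>x. g (f x)) has_derivative (\<lambda>v. \<Sum>b\<in>Basis.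
        (frechet_derivative f (at x) v \<bullet> b) *\<^sub>R frechet_derivative g (at (f x)) b)) (at x)"
      by (rule has_derivative_eq_rhs) (rule ext, rule linear_eq_Basis_sum[OF has_derivative_linear[OF g]])
  next
    fix v :: 'e
    have "Ck_on k f S" using Suc.prems Ck_on_Suc_imp assms(1) by blast
    then have "Ck_on k (\<lambda>x. frechet_derivative g (at (f x)) b) S" for b
      using Suc.IH[of "\<lambda>y. frechet_derivative g (at y) b"] Suc.prems by auto
    moreover have "Ck_on k (\<lambda>x. frechet_derivative f (at x) v \<bullet> b) S" for b
      using Ck_on_bounded_linear[OF assms(1) bounded_linear_inner_left] Suc.prems by auto
    ultimately show "Ck_on k (\<lambda>x. \<Sum>b\<in>Basis.
        (frechet_derivative f (at x) v \<bullet> b) *\<^sub>R frechet_derivative g (at (f x)) b) S"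
      by (intro Ck_on_sum assms(1) Ck_on_bilinear[OF assms(1) bounded_bilinear_scaleR]) auto
  qed
qed

text \<open>The derivative is quadratic in the function itself, so the induction closes without
  derivatives of other functions.\<close>

lemma Ck_on_inverse: "Ck_on k (inverse :: real \<Rightarrow> real) (- {0})"
proof (induction k)
  case 0
  then show ?case by (simp add: continuous_on_inverse[of _ "\<lambda>x. x"])
next
  case (Suc k)
  show ?case
  proof (rule Ck_on_SucI')
    show "(inverse has_derivative (\<lambda>v. - (inverse x * v * inverse x))) (at x)" if "x \<in> - {0}" for x :: real
      using that has_derivative_inverse' by auto
    have "Ck_on k (\<lambda>x::real. (- v) *\<^sub>R (inverse x * inverse x)) (- {0})" for v
      by (intro Ck_on_bounded_linear[OF _ bounded_linear_scaleR_right]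
          Ck_on_bilinear[OF _ bounded_bilinear_mult] Suc.IH) auto
    then show "Ck_on k (\<lambda>x::real. - (inverse x * v * inverse x)) (- {0})" for v
      by (simp add: mult_ac)
  qed auto
qed

text \<open>The derivative is a multiple of the reciprocal of the function itself, hence of class
  \<open>k\<close> by composition with \<open>inverse\<close>.\<close>

lemma Ck_on_sqrt: "Ck_on k sqrt {0<..}"
proof (induction k)
  case 0
  then show ?case by (simp add: continuous_on_real_sqrt[of _ "\<lambda>x. x"])
next
  case (Suc k)
  show ?case
  proof (rule Ck_on_SucI')
    show "(sqrt has_derivative (\<lambda>v. (v / 2) *\<^sub>R inverse (sqrt x))) (at x)" if "x \<in> {0<..}" for x :: real
      using that DERIV_real_sqrt[of x] by (auto simp: has_field_derivative_def field_simps elim!: has_derivative_eq_rhs)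
    show "Ck_on k (\<lambda>x::real. (v / 2) *\<^sub>R inverse (sqrt x)) {0<..}" for v
      by (intro Ck_on_bounded_linear[OF _ bounded_linear_scaleR_right]
          Ck_on_compose[OF _ _ _ Suc.IH Ck_on_inverse]) auto
  qed auto
qed

section \<open>Closure rules for smooth maps\<close>

lemma smooth_on_cong:
  "\<lbrakk>open S; \<And>x. x \<in> S \<Longrightarrow> f x = g x; smooth_on S f\<rbrakk> \<Longrightarrow> smooth_on S g"
  unfolding smooth_on_def using Ck_on_cong by blast

lemma smooth_on_subset: "\<lbrakk>open S; open T; T \<subseteq> S; smooth_on S f\<rbrakk> \<Longrightarrow> smooth_on T f"
  unfolding smooth_on_def using Ck_on_subset by blast

lemma smooth_on_local:
  "\<lbrakk>open S; \<And>x. x \<in> S \<Longrightarrow> \<exists>T. open T \<and> x \<in> T \<and> smooth_on T f\<rbrakk> \<Longrightarrow> smooth_on S f"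
  unfolding smooth_on_def by (intro allI, rule Ck_on_local) metis+

lemma smooth_on_const [simp]: "smooth_on S (\<lambda>x. c)"
  unfolding smooth_on_def using Ck_on_const by blast

lemma smooth_on_bounded_linear:
  "\<lbrakk>open S; bounded_linear L; smooth_on S f\<rbrakk> \<Longrightarrow> smooth_on S (\<lambda>x. L (f x))"
  unfolding smooth_on_def using Ck_on_bounded_linear by blast

lemma smooth_on_ident: "open S \<Longrightarrow> smooth_on S (\<lambda>x. x)"
  unfolding smooth_on_def
proof
  fix k :: nat
  assume S: "open S"
  show "Ck_on k (\<lambda>x. x) S"
    by (cases k) (auto intro!: Ck_on_const continuous_on_id)
qed

lemma smooth_on_add:
  "\<lbrakk>open S; smooth_on S f; smooth_on S g\<rbrakk> \<Longrightarrow> smooth_on S (\<lambda>x. f x + g x)"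
  unfolding smooth_on_def using Ck_on_add by blast

lemma smooth_on_bilinear:
  "\<lbrakk>open S; bounded_bilinear B; smooth_on S f; smooth_on S g\<rbrakk> \<Longrightarrow> smooth_on S (\<lambda>x. B (f x) (g x))"
  unfolding smooth_on_def using Ck_on_bilinear by blast

lemmas smooth_on_mult = smooth_on_bilinear[OF _ bounded_bilinear_mult]
lemmas smooth_on_scaleR = smooth_on_bilinear[OF _ bounded_bilinear_scaleR]
lemmas smooth_on_inner = smooth_on_bilinear[OF _ bounded_bilinear_inner]
lemmas smooth_on_minus = smooth_on_bounded_linear[OF _ bounded_linear_minus[OF bounded_linear_ident]]
lemmas smooth_on_fst = smooth_on_bounded_linear[OF _ bounded_linear_fst]
lemmas smooth_on_snd = smooth_on_bounded_linear[OF _ bounded_linear_snd]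

lemma smooth_on_diff:
  "\<lbrakk>open S; smooth_on S f; smooth_on S g\<rbrakk> \<Longrightarrow> smooth_on S (\<lambda>x. f x - g x)"
  using smooth_on_add[of S f "\<lambda>x. - g x"] smooth_on_minus[of S g] by simp

lemma smooth_on_sum:
  "\<lbrakk>open S; \<And>i. i \<in> I \<Longrightarrow> smooth_on S (f i)\<rbrakk> \<Longrightarrow> smooth_on S (\<lambda>x. \<Sum>i\<in>I. f i x)"
  by (simp add: smooth_on_def Ck_on_sum)

lemma smooth_on_prod:
  fixes f :: "'i \<Rightarrow> 'e::euclidean_space \<Rightarrow> real"
  assumes "open S" "finite I" "\<And>i. i \<in> I \<Longrightarrow> smooth_on S (f i)"
  shows "smooth_on S (\<lambda>x. \<Prod>i\<in>I. f i x)"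
  using assms(2,3) by (induction I) (auto intro!: smooth_on_mult assms(1))

lemma smooth_on_Pair:
  assumes "open S" "smooth_on S f" "smooth_on S g"
  shows "smooth_on S (\<lambda>x. (f x, g x))"
proof -
  have 1: "bounded_linear (\<lambda>a::'b. (a, 0::'c))" "bounded_linear (\<lambda>a::'c. (0::'b, a))"
    by (auto intro!: bounded_linear_Pair bounded_linear_ident bounded_linear_zero)
  have "smooth_on S (\<lambda>x. (f x, 0) + (0, g x))"
    using smooth_on_bounded_linear[OF assms(1) 1(1) assms(2)]
      smooth_on_bounded_linear[OF assms(1) 1(2) assms(3)]
    by (intro smooth_on_add assms(1))
  then show ?thesis by simp
qed

lemma smooth_on_vec:
  fixes f :: "'n::finite \<Rightarrow> 'e::euclidean_space \<Rightarrow> real"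
  assumes "open S" "\<And>i. smooth_on S (f i)"
  shows "smooth_on S (\<lambda>x. \<chi> i. f i x)"
proof -
  have "smooth_on S (\<lambda>x. \<Sum>i\<in>UNIV. f i x *\<^sub>R axis i (1::real))"
    by (intro smooth_on_sum smooth_on_scaleR assms smooth_on_const)
  moreover have "(\<Sum>i\<in>UNIV. f i x *\<^sub>R axis i (1::real)) = (\<chi> i. f i x)" for x
    by (simp add: vec_eq_iff axis_def if_distrib cong: if_cong)
  ultimately show ?thesis by simp
qed

lemma smooth_on_compose:
  fixes f :: "'e::euclidean_space \<Rightarrow> 'd::euclidean_space"
  shows "\<lbrakk>open S; open T; f ` S \<subseteq> T; smooth_on S f; smooth_on T g\<rbrakk> \<Longrightarrow> smooth_on S (\<lambda>x. g (f x))"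
  by (simp add: smooth_on_def Ck_on_compose[of S T])

lemma smooth_on_inverse:
  fixes f :: "'e::euclidean_space \<Rightarrow> real"
  assumes "open S" "smooth_on S f" "\<And>x. x \<in> S \<Longrightarrow> f x \<noteq> 0"
  shows "smooth_on S (\<lambda>x. inverse (f x))"
proof (rule smooth_on_compose[OF assms(1) _ _ assms(2)])
  show "smooth_on (- {0}) (inverse :: real \<Rightarrow> real)"
    unfolding smooth_on_def using Ck_on_inverse by blast
qed (use assms in auto)

lemma smooth_on_sqrt:
  fixes f :: "'e::euclidean_space \<Rightarrow> real"
  assumes "open S" "smooth_on S f" "\<And>x. x \<in> S \<Longrightarrow> f x > 0"
  shows "smooth_on S (\<lambda>x. sqrt (f x))"
proof (rule smooth_on_compose[OF assms(1) _ _ assms(2)])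
  show "smooth_on {0<..} sqrt"
    unfolding smooth_on_def using Ck_on_sqrt by blast
qed (use assms in auto)

lemma smooth_on_has_derivative:
  assumes "open S" "smooth_on S f" "x \<in> S"
  shows "(f has_derivative frechet_derivative f (at x)) (at x)"
proof -
  have "Ck_on (Suc 0) f S" using assms(2) unfolding smooth_on_def by blast
  then show ?thesis using has_frechet_derivative assms by auto
qed

lemma smooth_on_linear_derivative:
  "\<lbrakk>open S; smooth_on S f; x \<in> S\<rbrakk> \<Longrightarrow> linear (frechet_derivative f (at x))"
  using smooth_on_has_derivative has_derivative_linear by blast

lemma smooth_on_derivative:
  assumes "smooth_on S f"
  shows "smooth_on S (\<lambda>x. frechet_derivative f (at x) v)"
  unfolding smooth_on_def
proof
  fix k
  have "Ck_on (Suc k) f S" using assms unfolding smooth_on_def by blast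
  then show "Ck_on k (\<lambda>x. frechet_derivative f (at x) v) S" by simp
qed

lemma smooth_on_continuous_on: "smooth_on S f \<Longrightarrow> continuous_on S f"
  unfolding smooth_on_def by (metis Ck_on.simps(1))

text \<open>Expansion of the argument in \<open>Basis\<close> reduces a varying linear map at a
  varying vector to finitely many products. Thus smoothness for each fixed vector suffices, and no
  topology on the space of linear maps is involved.\<close>

lemma smooth_on_linear_family:
  fixes f :: "'e::euclidean_space \<Rightarrow> 'b::euclidean_space \<Rightarrow> 'c::real_normed_vector"
  assumes "open S" "\<And>x. x \<in> S \<Longrightarrow> linear (f x)" "\<And>v. smooth_on S (\<lambda>x. f x v)" "smooth_on S Y"
  shows "smooth_on S (\<lambda>x. f x (Y x))"
proof (rule smooth_on_cong[OF assms(1)])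
  show "smooth_on S (\<lambda>x. \<Sum>b\<in>Basis. (Y x \<bullet> b) *\<^sub>R f x b)"
    by (intro smooth_on_sum smooth_on_scaleR smooth_on_inner assms smooth_on_const)
  show "(\<Sum>b\<in>Basis. (Y x \<bullet> b) *\<^sub>R f x b) = f x (Y x)" if "x \<in> S" for x
    by (rule linear_eq_Basis_sum[OF assms(2)[OF that], symmetric])
qed

lemma smooth_on_bilinear_family:
  fixes f :: "'e::euclidean_space \<Rightarrow> 'b::euclidean_space \<Rightarrow> 'd::euclidean_space \<Rightarrow> 'c::real_normed_vector"
  assumes "open S" "\<And>x. x \<in> S \<Longrightarrow> bilinear (f x)" "\<And>u v. smooth_on S (\<lambda>x. f x u v)"
    "smooth_on S X" "smooth_on S Y"
  shows "smooth_on S (\<lambda>x. f x (X x) (Y x))"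
proof -
  have "smooth_on S (\<lambda>x. f x (X x) v)" for v
    using smooth_on_linear_family[of S "\<lambda>x u. f x u v" X] assms by (auto simp: bilinear_def)
  then show ?thesis
    using smooth_on_linear_family[of S "\<lambda>x. f x (X x)" Y] assms by (auto simp: bilinear_def)
qed

lemma has_derivative_linear_family:
  fixes f :: "'e::euclidean_space \<Rightarrow> 'b::euclidean_space \<Rightarrow> 'c::real_normed_vector"
  assumes S: "open S" "x \<in> S" and l: "\<And>x. x \<in> S \<Longrightarrow> linear (f x)"
    and d: "\<And>v. ((\<lambda>x. f x v) has_derivative f' v) (at x)" and Y: "(Y has_derivative Y') (at x)"
  shows "((\<lambda>x. f x (Y x)) has_derivative (\<lambda>h. f' (Y x) h + f x (Y' h))) (at x)"
proof -
  have "((\<lambda>x. f x (Y x)) has_derivative (\<lambda>h. \<Sum>b\<in>Basis. (Y x \<bullet> b) *\<^sub>R f' b h + (Y' h \<bullet> b) *\<^sub>R f x b)) (at x)"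
  proof (rule has_derivative_transform_within_open[OF _ S])
    show "((\<lambda>x. \<Sum>b\<in>Basis. (Y x \<bullet> b) *\<^sub>R f x b) has_derivative
        (\<lambda>h. \<Sum>b\<in>Basis. (Y x \<bullet> b) *\<^sub>R f' b h + (Y' h \<bullet> b) *\<^sub>R f x b)) (at x)"
      by (auto intro!: derivative_eq_intros d Y)
    show "(\<Sum>b\<in>Basis. (Y z \<bullet> b) *\<^sub>R f z b) = f z (Y z)" if "z \<in> S" for z
      by (rule linear_eq_Basis_sum[OF l[OF that], symmetric])
  qed
  moreover have 1: "(\<Sum>b\<in>Basis. (Y' h \<bullet> b) *\<^sub>R f x b) = f x (Y' h)" for h
    by (rule linear_eq_Basis_sum[OF l[OF S(2)], symmetric])
  \<comment> \<open>The derivatives \<open>f' v\<close> are given separately for each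
    \<open>v\<close>. Uniqueness of derivatives makes them linear in \<open>v\<close>, which
    collapses the basis expansion of the derivative into \<open>f' (Y x)\<close>.\<close>
  moreover have "f' v = (\<lambda>h. \<Sum>b\<in>Basis. (v \<bullet> b) *\<^sub>R f' b h)" for v
  proof (rule has_derivative_unique[OF d])
    have "((\<lambda>x. \<Sum>b\<in>Basis. (v \<bullet> b) *\<^sub>R f x b) has_derivative (\<lambda>h. \<Sum>b\<in>Basis. (v \<bullet> b) *\<^sub>R f' b h)) (at x)"
      by (auto intro!: derivative_eq_intros d)
    then show "((\<lambda>x. f x v) has_derivative (\<lambda>h. \<Sum>b\<in>Basis. (v \<bullet> b) *\<^sub>R f' b h)) (at x)"
      by (rule has_derivative_transform_within_open[OF _ S])
        (rule linear_eq_Basis_sum[OF l, symmetric])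
  qed
  then have 2: "(\<Sum>b\<in>Basis. (v \<bullet> b) *\<^sub>R f' b h) = f' v h" for v h
    by (rule fun_cong[OF sym])
  ultimately show ?thesis by (simp only: sum.distrib 1 2)
qed

lemma has_derivative_bilinear_family:
  fixes f :: "'e::euclidean_space \<Rightarrow> 'b::euclidean_space \<Rightarrow> 'd::euclidean_space \<Rightarrow> 'c::real_normed_vector"
  assumes S: "open S" "x \<in> S" and b: "\<And>x. x \<in> S \<Longrightarrow> bilinear (f x)"
    and d: "\<And>u v. ((\<lambda>x. f x u v) has_derivative f' u v) (at x)"
    and X: "(X has_derivative X') (at x)" and Y: "(Y has_derivative Y') (at x)"
  shows "((\<lambda>x. f x (X x) (Y x)) has_derivative
    (\<lambda>h. f' (X x) (Y x) h + f x (X' h) (Y x) + f x (X x) (Y' h))) (at x)"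
proof -
  have "((\<lambda>x. f x (X x) v) has_derivative (\<lambda>h. f' (X x) v h + f x (X' h) v)) (at x)" for v
    by (rule has_derivative_linear_family[OF S, of "\<lambda>x u. f x u v"])
      (use b d X in \<open>auto simp: bilinear_def\<close>)
  from has_derivative_linear_family[OF S, of "\<lambda>x. f x (X x)", OF _ this Y] show ?thesis
    using b by (simp add: bilinear_def)
qed

text \<open>Each identity of bilinearity holds on a neighbourhood, so both of its sides have the
  same derivative.\<close>

lemma bilinear_derivative_of_bilinear_family:
  assumes S: "open S" "x \<in> S" and b: "\<And>x. x \<in> S \<Longrightarrow> bilinear (f x)"
    and d: "\<And>u v. ((\<lambda>x. f x u v) has_derivative f' u v) (at x)"
  shows "bilinear (\<lambda>u v. f' u v h)"
proof -
  have eq: "f' u v h = H h" if "(H' has_derivative H) (at x)" "\<And>z. z \<in> S \<Longrightarrow> H' z = f z u v" for H' H u v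
    using has_derivative_unique[OF d has_derivative_transform_within_open[OF that(1) S that(2)]]
    by simp
  show ?thesis
    unfolding bilinear_def
  proof (intro conjI allI linearI)
    fix u u' v v' and r :: real
    show "f' u (v + v') h = f' u v h + f' u v' h"
      by (rule eq[OF has_derivative_add[OF d d]]) (simp add: bilinear_radd[OF b])
    show "f' (u + u') v h = f' u v h + f' u' v h"
      by (rule eq[OF has_derivative_add[OF d d]]) (simp add: bilinear_ladd[OF b])
    show "f' u (r *\<^sub>R v) h = r *\<^sub>R f' u v h"
      by (rule eq[OF has_derivative_scaleR_right[OF d]]) (simp add: bilinear_rmul[OF b])
    show "f' (r *\<^sub>R u) v h = r *\<^sub>R f' u v h"
      by (rule eq[OF has_derivative_scaleR_right[OF d]]) (simp add: bilinear_lmul[OF b])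
  qed
qed

lemma has_derivative_vec:
  fixes f :: "'n::finite \<Rightarrow> 'e::real_normed_vector \<Rightarrow> real"
  assumes "\<And>i. (f i has_derivative f' i) F"
  shows "((\<lambda>x. \<chi> i. f i x) has_derivative (\<lambda>h. \<chi> i. f' i h)) F"
proof -
  have *: "(\<Sum>i\<in>UNIV. a i *\<^sub>R axis i (1::real)) = (\<chi> i. a i)" for a :: "'n \<Rightarrow> real"
    by (simp add: vec_eq_iff axis_def if_distrib cong: if_cong)
  have "((\<lambda>x. \<Sum>i\<in>UNIV. f i x *\<^sub>R axis i (1::real)) has_derivative
      (\<lambda>h. \<Sum>i\<in>UNIV. f' i h *\<^sub>R axis i 1)) F"
    by (intro has_derivative_sum has_derivative_scaleR_left assms)
  then show ?thesis unfolding * .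
qed

text \<open>The second difference of \<open>f\<close> over a small parallelogram spanned by
  multiples of \<open>u\<close> and \<open>v\<close> does not depend on the order of
  \<open>u\<close> and \<open>v\<close>, while the mean value theorem writes it as a mixed
  derivative in either order at some nearby point. Different mixed derivatives at \<open>x\<close>
  would contradict their continuity.\<close>

lemma symmetric_second_derivative_real:
  fixes f :: "'e::euclidean_space \<Rightarrow> real"
  assumes S: "open S" "x \<in> S" and f: "smooth_on S f"
  shows "frechet_derivative (\<lambda>z. frechet_derivative f (at z) u) (at x) v =
         frechet_derivative (\<lambda>z. frechet_derivative f (at z) v) (at x) u"
proof (rule ccontr)
  define A where "A u v z = frechet_derivative (\<lambda>z. frechet_derivative f (at z) u) (at z) v" for u v z
  assume "\<not> ?thesis"
  then have pos: "\<bar>A u v x - A v u x\<bar> > 0" (is "?e > 0") by (simp add: A_def)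
  have cont: "continuous_on S (A u v)" for u v
    unfolding A_def by (intro smooth_on_continuous_on smooth_on_derivative f)
  have lin: "linear (frechet_derivative f (at z))" if "z \<in> S" for z
    using smooth_on_linear_derivative[OF S(1) f that] .
  have "\<exists>d>0. ball x d \<subseteq> S" using S openE by blast
  then obtain d0 where d0: "d0 > 0" "ball x d0 \<subseteq> S" by blast
  have "\<exists>d>0. \<forall>z\<in>S. dist z x < d \<longrightarrow> dist (A u v z) (A u v x) < ?e / 2" for u v
    using cont[of u v] pos S(2) unfolding continuous_on_iff by (metis half_gt_zero)
  then obtain d1 d2 where d: "d1 > 0" "d2 > 0"
    "\<And>z. z \<in> S \<Longrightarrow> dist z x < d1 \<Longrightarrow> dist (A u v z) (A u v x) < ?e / 2"
    "\<And>z. z \<in> S \<Longrightarrow> dist z x < d2 \<Longrightarrow> dist (A v u z) (A v u x) < ?e / 2"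
    by meson
  define r where "r = min d0 (min d1 d2)"
  define N where "N = norm u + norm v + 1"
  define h where "h = r / (2 * N)"
  have N: "N > 0" by (simp add: N_def add_nonneg_pos)
  have r: "r > 0" using d d0 by (simp add: r_def)
  have h: "h > 0" using r N by (simp add: h_def)
  have in_ball: "x + s *\<^sub>R u + t *\<^sub>R v \<in> ball x r" if "0 \<le> s" "s \<le> h" "0 \<le> t" "t \<le> h" for s t
  proof -
    have "norm (s *\<^sub>R u + t *\<^sub>R v) \<le> s * norm u + t * norm v"
      using norm_triangle_ineq[of "s *\<^sub>R u" "t *\<^sub>R v"] that by simp
    also have "\<dots> \<le> h * norm u + h * norm v"
      using that by (intro add_mono mult_right_mono) auto
    also have "\<dots> \<le> h * N" using h by (simp add: N_def algebra_simps)
    also have "\<dots> < r" using r N by (simp add: h_def)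
    finally have "norm (- (s *\<^sub>R u + t *\<^sub>R v)) < r" by (simp only: norm_minus_cancel)
    then show ?thesis by (simp add: dist_norm algebra_simps)
  qed
  \<comment> \<open>Two applications of the mean value theorem: to the difference of
    \<open>f\<close> across the \<open>v\<close>-side as a function of the
    \<open>u\<close>-parameter, and to the resulting derivative along \<open>u\<close> as a function
    of the \<open>v\<close>-parameter.\<close>
  have key: "\<exists>s t. 0 \<le> s \<and> s \<le> h \<and> 0 \<le> t \<and> t \<le> h \<and>
      f (x + h *\<^sub>R u + h *\<^sub>R v) - f (x + h *\<^sub>R u) - f (x + h *\<^sub>R v) + f x = h * h * A u v (x + s *\<^sub>R u + t *\<^sub>R v)"
    if in_ball: "\<And>s t. 0 \<le> s \<Longrightarrow> s \<le> h \<Longrightarrow> 0 \<le> t \<Longrightarrow> t \<le> h \<Longrightarrow> x + s *\<^sub>R u + t *\<^sub>R v \<in> S"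
    for u v
  proof -
    define k where "k s = f (x + s *\<^sub>R u + h *\<^sub>R v) - f (x + s *\<^sub>R u)" for s
    have dk: "(k has_derivative (\<lambda>y. frechet_derivative f (at (x + s *\<^sub>R u + h *\<^sub>R v)) (y *\<^sub>R u) -
        frechet_derivative f (at (x + s *\<^sub>R u)) (y *\<^sub>R u))) (at s within {0..h})" if "0 \<le> s" "s \<le> h" for s
    proof -
      have *: "((\<lambda>s. x + s *\<^sub>R u + c) has_derivative (\<lambda>y. y *\<^sub>R u)) (at s within {0..h})" for c
        by (auto intro!: derivative_eq_intros)
      have **: "((\<lambda>s. x + s *\<^sub>R u) has_derivative (\<lambda>y. y *\<^sub>R u)) (at s within {0..h})"
        by (auto intro!: derivative_eq_intros)
      have "x + s *\<^sub>R u + h *\<^sub>R v \<in> S" "x + s *\<^sub>R u \<in> S"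
        using in_ball[of s h] in_ball[of s 0] that h by auto
      then show ?thesis unfolding k_def
        by (intro has_derivative_diff has_derivative_compose[OF *] has_derivative_compose[OF **]
            smooth_on_has_derivative[OF S(1) f])
    qed
    obtain s where s: "0 < s" "s < h" "k h - k 0 =
        frechet_derivative f (at (x + s *\<^sub>R u + h *\<^sub>R v)) (h *\<^sub>R u) - frechet_derivative f (at (x + s *\<^sub>R u)) (h *\<^sub>R u)"
      using mvt_simple[OF h dk] by auto
    have inS: "x + s *\<^sub>R u + t *\<^sub>R v \<in> S" if "0 \<le> t" "t \<le> h" for t using in_ball s that by auto
    define l where "l t = frechet_derivative f (at (x + s *\<^sub>R u + t *\<^sub>R v)) u" for t
    have eq: "k h - k 0 = h * (l h - l 0)"
      using s inS[of h] inS[of 0] h by (simp add: l_def linear_scale[OF lin] algebra_simps)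
    have dl: "(l has_derivative (\<lambda>y. y * A u v (x + s *\<^sub>R u + t *\<^sub>R v))) (at t within {0..h})"
      if "0 \<le> t" "t \<le> h" for t
    proof -
      have *: "((\<lambda>t. x + s *\<^sub>R u + t *\<^sub>R v) has_derivative (\<lambda>y. y *\<^sub>R v)) (at t within {0..h})"
        by (auto intro!: derivative_eq_intros)
      note D = smooth_on_has_derivative[OF S(1) smooth_on_derivative[OF f] inS[OF that], of u]
      have "(l has_derivative (\<lambda>y. frechet_derivative (\<lambda>z. frechet_derivative f (at z) u)
          (at (x + s *\<^sub>R u + t *\<^sub>R v)) (y *\<^sub>R v))) (at t within {0..h})"
        unfolding l_def by (rule has_derivative_compose[OF * D])
      then show ?thesis by (simp add: A_def linear_scale[OF has_derivative_linear[OF D]])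
    qed
    obtain t where t: "0 < t" "t < h" "l h - l 0 = h * A u v (x + s *\<^sub>R u + t *\<^sub>R v)"
      using mvt_simple[OF h dl] by auto
    have "k h - k 0 = h * h * A u v (x + s *\<^sub>R u + t *\<^sub>R v)" using eq t by simp
    then show ?thesis using s t unfolding k_def by (intro exI[of _ s] exI[of _ t]) auto
  qed
  have sub: "ball x r \<subseteq> S" using d0 unfolding r_def by auto
  obtain s t where st: "0 \<le> s" "s \<le> h" "0 \<le> t" "t \<le> h"
      "f (x + h *\<^sub>R u + h *\<^sub>R v) - f (x + h *\<^sub>R u) - f (x + h *\<^sub>R v) + f x = h * h * A u v (x + s *\<^sub>R u + t *\<^sub>R v)"
    using key[of u v] in_ball sub by blast
  have in_ball': "x + s *\<^sub>R v + t *\<^sub>R u \<in> ball x r" if "0 \<le> s" "s \<le> h" "0 \<le> t" "t \<le> h" for s t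
    using in_ball[of t s] that by (metis add.assoc add.commute)
  obtain s' t' where st': "0 \<le> s'" "s' \<le> h" "0 \<le> t'" "t' \<le> h"
      "f (x + h *\<^sub>R v + h *\<^sub>R u) - f (x + h *\<^sub>R v) - f (x + h *\<^sub>R u) + f x = h * h * A v u (x + s' *\<^sub>R v + t' *\<^sub>R u)"
    using key[of v u] in_ball' sub by blast
  have "h * h * A u v (x + s *\<^sub>R u + t *\<^sub>R v) = h * h * A v u (x + s' *\<^sub>R v + t' *\<^sub>R u)"
    using st(5) st'(5) by (simp add: algebra_simps)
  then have eq: "A u v (x + s *\<^sub>R u + t *\<^sub>R v) = A v u (x + s' *\<^sub>R v + t' *\<^sub>R u)" using h by simp
  have "dist (A u v (x + s *\<^sub>R u + t *\<^sub>R v)) (A u v x) < ?e / 2"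
    using in_ball[OF st(1-4)] sub by (intro d(3)) (auto simp: r_def dist_commute)
  moreover have "dist (A v u (x + s' *\<^sub>R v + t' *\<^sub>R u)) (A v u x) < ?e / 2"
    using in_ball'[OF st'(1-4)] sub by (intro d(4)) (auto simp: r_def dist_commute)
  \<comment> \<open>One number cannot lie within half the distance of two distinct numbers from both
    of them.\<close>
  moreover have "\<not> (\<bar>w - a\<bar> < \<bar>a - b\<bar> / 2 \<and> \<bar>w - b\<bar> < \<bar>a - b\<bar> / 2)" for a b w :: real
    by (auto simp: abs_if split: if_splits)
  ultimately show False using eq unfolding dist_real_def by metis
qed

lemma symmetric_second_derivative:
  fixes f :: "'e::euclidean_space \<Rightarrow> 'b::euclidean_space"
  assumes S: "open S" "x \<in> S" and f: "smooth_on S f"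
  shows "frechet_derivative (\<lambda>z. frechet_derivative f (at z) u) (at x) v =
         frechet_derivative (\<lambda>z. frechet_derivative f (at z) v) (at x) u"
proof (rule euclidean_eqI)
  fix b :: 'b assume "b \<in> Basis"
  have fb: "smooth_on S (\<lambda>z. f z \<bullet> b)" by (intro smooth_on_inner S f smooth_on_const)
  have 1: "frechet_derivative (\<lambda>z. f z \<bullet> b) (at z) u = frechet_derivative f (at z) u \<bullet> b" if "z \<in> S" for z u
    using frechet_derivativeI[OF bounded_linear.has_derivative[OF bounded_linear_inner_left
          smooth_on_has_derivative[OF S(1) f that]]] by metis
  have 2: "frechet_derivative (\<lambda>z. frechet_derivative (\<lambda>z. f z \<bullet> b) (at z) u) (at x) v =
      frechet_derivative (\<lambda>z. frechet_derivative f (at z) u) (at x) v \<bullet> b" for u v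
  proof -
    note D = bounded_linear.has_derivative[OF bounded_linear_inner_left
          smooth_on_has_derivative[OF S(1) smooth_on_derivative[OF f] S(2), of u], of b]
    have "((\<lambda>z. frechet_derivative (\<lambda>z. f z \<bullet> b) (at z) u) has_derivative
      (\<lambda>v. frechet_derivative (\<lambda>z. frechet_derivative f (at z) u) (at x) v \<bullet> b)) (at x)"
      by (rule has_derivative_transform_within_open[OF D S]) (simp add: 1)
    then show ?thesis by (metis frechet_derivativeI)
  qed
  show "frechet_derivative (\<lambda>z. frechet_derivative f (at z) u) (at x) v \<bullet> b =
        frechet_derivative (\<lambda>z. frechet_derivative f (at z) v) (at x) u \<bullet> b"
    using symmetric_second_derivative_real[OF S fb, of u v] unfolding 2 .
qed

text \<open>The functions \<open>t\<^sup>-\<^sup>n e\<^sup>-\<^sup>1\<^sup>/\<^sup>t\<close>, extended by \<open>0\<close> to \<open>t \<le> 0\<close>; this family is closed, up to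
  linear combinations, under differentiation.\<close>

definition flat_fun :: "nat \<Rightarrow> real \<Rightarrow> real" where
  "flat_fun n t = (if t > 0 then inverse t ^ n * exp (- inverse t) else 0)"

text \<open>From the right this is the dominance of the exponential over powers at infinity, in the
  variable 1/t.\<close>

lemma flat_fun_tendsto_0: "(flat_fun n \<longlongrightarrow> 0) (at 0)"
proof -
  have "((\<lambda>t::real. inverse t ^ n / exp (inverse t)) \<longlongrightarrow> 0) (at_right 0)"
    using filterlim_compose[OF tendsto_power_div_exp_0 filterlim_inverse_at_top_right] .
  then have "(flat_fun n \<longlongrightarrow> 0) (at_right 0)"
    by (rule Lim_transform_eventually)
      (auto simp: eventually_at_right_field flat_fun_def exp_minus field_simps intro!: exI[of _ 1])
  moreover have "(flat_fun n \<longlongrightarrow> 0) (at_left 0)"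
    by (rule Lim_transform_eventually[OF tendsto_const])
      (auto simp: eventually_at_left_field flat_fun_def intro!: exI[of _ "-1"])
  ultimately show ?thesis by (simp add: filterlim_split_at)
qed

text \<open>Away from 0 this is the product rule. At 0 the difference quotient of
  \<open>flat_fun n\<close> is \<open>flat_fun (n + 1)\<close>, which tends to 0.\<close>

lemma flat_fun_has_derivative:
  "(flat_fun n has_derivative (\<lambda>v. v *\<^sub>R (flat_fun (n + 2) t - real n * flat_fun (n + 1) t))) (at t)"
proof -
  consider "t > 0" | "t < 0" | "t = 0" by linarith
  then show ?thesis
  proof cases
    case 1
    have i: "(inverse has_real_derivative - (inverse t * inverse t)) (at t)"
      using 1 DERIV_inverse[of t] by (simp add: power2_eq_square)
    have "((\<lambda>t. inverse t ^ n * exp (- inverse t)) has_real_derivative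
        real n * inverse t ^ (n - 1) * (- (inverse t * inverse t)) * exp (- inverse t)
        + inverse t ^ n * (exp (- inverse t) * (inverse t * inverse t))) (at t)"
      using 1 by (auto intro!: derivative_eq_intros i)
    moreover have "real n * inverse t ^ (n - 1) * (- (inverse t * inverse t)) * exp (- inverse t)
        + inverse t ^ n * (exp (- inverse t) * (inverse t * inverse t)) =
        inverse t ^ (n + 2) * exp (- inverse t) - real n * (inverse t ^ (n + 1) * exp (- inverse t))"
      by (cases n) (simp_all add: algebra_simps)
    ultimately have "((\<lambda>t. inverse t ^ n * exp (- inverse t)) has_real_derivative
        inverse t ^ (n + 2) * exp (- inverse t) - real n * (inverse t ^ (n + 1) * exp (- inverse t))) (at t)"
      by (rule DERIV_cong)
    then have "(flat_fun n has_real_derivative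
        inverse t ^ (n + 2) * exp (- inverse t) - real n * (inverse t ^ (n + 1) * exp (- inverse t))) (at t)"
      by (rule has_field_derivative_transform_within_open[of _ _ _ "{0<..}"])
        (use 1 in \<open>auto simp: flat_fun_def\<close>)
    then show ?thesis using 1 by (simp add: has_field_derivative_def flat_fun_def mult_commute_abs)
  next
    case 2
    have "((\<lambda>t. 0) has_derivative (\<lambda>v. v *\<^sub>R (flat_fun (n + 2) t - real n * flat_fun (n + 1) t))) (at t)"
      using 2 by (simp add: flat_fun_def)
    then show ?thesis
      by (rule has_derivative_transform_within_open[of _ _ _ _ "{..<0}"]) (use 2 in \<open>auto simp: flat_fun_def\<close>)
  next
    case 3
    have "((\<lambda>h. (flat_fun n (0 + h) - flat_fun n 0) / h) \<longlongrightarrow> 0) (at 0)"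
      by (rule Lim_transform_eventually[OF flat_fun_tendsto_0[of "n + 1"]])
        (auto simp: eventually_at_filter flat_fun_def field_simps)
    then have "(flat_fun n has_real_derivative 0) (at 0)" by (simp add: DERIV_def)
    then show ?thesis using 3 by (simp add: has_field_derivative_def flat_fun_def lambda_zero)
  qed
qed

lemma smooth_on_flat_fun: "smooth_on UNIV (flat_fun n)"
proof -
  have "Ck_on k (flat_fun n) UNIV" for k
  proof (induction k arbitrary: n)
    case 0
    show ?case unfolding Ck_on.simps
      by (rule continuous_at_imp_continuous_on) (metis flat_fun_has_derivative has_derivative_continuous)
  next
    case (Suc k)
    have "Ck_on k (\<lambda>t. v *\<^sub>R (flat_fun (n + 2) t + (- real n) *\<^sub>R flat_fun (n + 1) t)) UNIV" for v
      by (intro Ck_on_bounded_linear[OF _ bounded_linear_scaleR_right] Ck_on_add Suc) auto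
    then show ?case
      by (intro Ck_on_SucI'[OF _ flat_fun_has_derivative]) auto
  qed
  then show ?thesis by (simp add: smooth_on_def)
qed

lemma smooth_bump:
  fixes z0 :: "'e::euclidean_space"
  assumes "r > 0"
  obtains b :: "'e \<Rightarrow> real" where "smooth_on UNIV b" "b z0 = 1" "\<And>z. z \<notin> ball z0 r \<Longrightarrow> b z = 0"
proof
  \<comment> \<open>The squared distance is used because, unlike the distance, it is smooth at the
    centre; the last factor normalises the value there to 1.\<close>
  define b where "b z = flat_fun 0 (r\<^sup>2 - (z - z0) \<bullet> (z - z0)) * inverse (flat_fun 0 (r\<^sup>2))" for z
  show "smooth_on UNIV b" unfolding b_def
    by (intro smooth_on_mult smooth_on_compose[OF _ _ _ _ smooth_on_flat_fun] smooth_on_inner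
        smooth_on_diff smooth_on_const smooth_on_ident) auto
  show "b z0 = 1" using assms by (simp add: b_def flat_fun_def)
  show "b z = 0" if "z \<notin> ball z0 r" for z
  proof -
    have "r \<le> norm (z - z0)" using that by (simp add: dist_norm norm_minus_commute)
    then have "r\<^sup>2 \<le> (z - z0) \<bullet> (z - z0)" using assms by (simp add: dot_square_norm power_mono)
    then show ?thesis by (simp add: b_def flat_fun_def)
  qed
qed

section \<open>Charts, smooth functions and vector fields\<close>

lemma extends_atE:
  assumes "extends_at S c q f F"
  obtains W where "open W" "snd c q \<in> W" "smooth_on W F"
    "\<forall>y. y \<in> S \<inter> fst c \<longrightarrow> snd c y \<in> W \<longrightarrow> f y = F (snd c y)"
  using assms unfolding extends_at_def Ball_def by (elim exE conjE) (rule that)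

text \<open>The part of \<^const>\<open>smooth_manifold\<close> that does not mention the topology.\<close>

locale atlas =
  fixes M :: "('a, 'e::euclidean_space) mfd"
  assumes inj_chart: "c \<in> charts M \<Longrightarrow> inj_on (snd c) (fst c)"
    and open_overlap: "c \<in> charts M \<Longrightarrow> d \<in> charts M \<Longrightarrow> open (snd c ` (fst c \<inter> fst d))"
    and smooth_transition: "c \<in> charts M \<Longrightarrow> d \<in> charts M \<Longrightarrow>
      smooth_on (snd c ` (fst c \<inter> fst d)) (transition c d)"
    and pref: "x \<in> points M \<Longrightarrow> pref M x \<in> charts M \<and> x \<in> fst (pref M x)"
begin

lemma open_chart: "c \<in> charts M \<Longrightarrow> open (snd c ` fst c)"
  using open_overlap[of c c] by simp

lemma chart_subset: "c \<in> charts M \<Longrightarrow> fst c \<subseteq> points M"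
  by (auto simp: points_def)

lemma inv_chart_chart [simp]: "c \<in> charts M \<Longrightarrow> x \<in> fst c \<Longrightarrow> inv_chart c (snd c x) = x"
  unfolding inv_chart_def using inj_chart by (metis inv_into_f_f)

lemma transition_chart [simp]:
  "c \<in> charts M \<Longrightarrow> x \<in> fst c \<Longrightarrow> transition c d (snd c x) = snd d x"
  by (simp add: transition_def)

lemma transition_has_derivative:
  assumes "c \<in> charts M" "d \<in> charts M" "x \<in> fst c" "x \<in> fst d"
  shows "(transition c d has_derivative change c d x) (at (snd c x))"
  unfolding change_def
  by (rule smooth_on_has_derivative[OF open_overlap smooth_transition]) (use assms in auto)

lemma linear_change:
  "c \<in> charts M \<Longrightarrow> d \<in> charts M \<Longrightarrow> x \<in> fst c \<Longrightarrow> x \<in> fst d \<Longrightarrow> linear (change c d x)"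
  using transition_has_derivative has_derivative_linear by blast

lemma chart_image_Int:
  "c \<in> charts M \<Longrightarrow> snd c ` (fst c \<inter> A) \<inter> snd c ` (fst c \<inter> B) = snd c ` (fst c \<inter> A \<inter> B)"
  using inj_chart[of c] by (auto simp: inj_on_def)

text \<open>The chain rule for the composite transition, which agrees with the direct one on the
  open triple overlap. All conversions between components in different charts rest on this cocycle
  identity.\<close>

lemma change_change:
  assumes c: "c \<in> charts M" "d \<in> charts M" "e \<in> charts M"
    and x: "x \<in> fst c" "x \<in> fst d" "x \<in> fst e"
  shows "change d e x (change c d x v) = change c e x v"
proof -
  have "((\<lambda>z. transition d e (transition c d z)) has_derivative (\<lambda>v. change d e x (change c d x v))) (at (snd c x))"
  proof (rule has_derivative_compose[OF transition_has_derivative[OF c(1,2) x(1,2)]])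
    show "(transition d e has_derivative change d e x) (at (transition c d (snd c x)))"
      using transition_has_derivative[OF c(2,3) x(2,3)] c x by simp
  qed
  then have "(transition c e has_derivative (\<lambda>v. change d e x (change c d x v))) (at (snd c x))"
  proof (rule has_derivative_transform_within_open)
    show "open (snd c ` (fst c \<inter> fst d \<inter> fst e))"
      using open_overlap[OF c(1,2)] open_overlap[OF c(1,3)] chart_image_Int[OF c(1), of "fst d" "fst e"]
      by (metis open_Int)
  qed (use c x in auto)
  then show ?thesis unfolding change_def[of c e] using frechet_derivativeI by metis
qed

lemma change_self:
  assumes c: "c \<in> charts M" and x: "x \<in> fst c"
  shows "change c c x v = v"
proof -
  have "((\<lambda>z. z) has_derivative (\<lambda>v. v)) (at (snd c x))" by (rule has_derivative_ident)
  then have "(transition c c has_derivative (\<lambda>v. v)) (at (snd c x))"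
    by (rule has_derivative_transform_within_open[OF _ open_chart[OF c]]) (use c x in auto)
  then show ?thesis unfolding change_def using frechet_derivativeI by metis
qed

lemma change_inverse:
  "c \<in> charts M \<Longrightarrow> d \<in> charts M \<Longrightarrow> x \<in> fst c \<Longrightarrow> x \<in> fst d \<Longrightarrow> change d c x (change c d x v) = v"
  using change_change[of c d c] change_self by simp

lemma change_to_chart:
  "c \<in> charts M \<Longrightarrow> d \<in> charts M \<Longrightarrow> x \<in> fst c \<Longrightarrow> x \<in> fst d \<Longrightarrow>
    change c d x (to_chart M c x v) = to_chart M d x v"
  unfolding to_chart_def using change_change pref chart_subset by blast

lemma from_chart_change:
  "c \<in> charts M \<Longrightarrow> d \<in> charts M \<Longrightarrow> x \<in> fst c \<Longrightarrow> x \<in> fst d \<Longrightarrow>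
    from_chart M d x (change c d x v) = from_chart M c x v"
  unfolding from_chart_def using change_change pref chart_subset by blast

lemma from_to_chart [simp]: "c \<in> charts M \<Longrightarrow> x \<in> fst c \<Longrightarrow> from_chart M c x (to_chart M c x v) = v"
  unfolding from_chart_def to_chart_def using change_inverse pref chart_subset by blast

lemma to_from_chart [simp]: "c \<in> charts M \<Longrightarrow> x \<in> fst c \<Longrightarrow> to_chart M c x (from_chart M c x v) = v"
  unfolding from_chart_def to_chart_def using change_inverse pref chart_subset by blast

lemma to_chart_from_chart:
  "c \<in> charts M \<Longrightarrow> d \<in> charts M \<Longrightarrow> x \<in> fst c \<Longrightarrow> x \<in> fst d \<Longrightarrow>
    to_chart M d x (from_chart M c x v) = change c d x v"
  unfolding from_chart_def to_chart_def using change_change pref chart_subset by blast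

lemma linear_to_chart: "c \<in> charts M \<Longrightarrow> x \<in> fst c \<Longrightarrow> linear (to_chart M c x)"
  unfolding to_chart_def using linear_change pref chart_subset by blast

lemma linear_from_chart: "c \<in> charts M \<Longrightarrow> x \<in> fst c \<Longrightarrow> linear (from_chart M c x)"
  unfolding from_chart_def using linear_change pref chart_subset by blast

lemma to_chart_pref [simp]: "x \<in> points M \<Longrightarrow> to_chart M (pref M x) x v = v"
  unfolding to_chart_def using change_self pref by blast

lemma from_chart_pref [simp]: "x \<in> points M \<Longrightarrow> from_chart M (pref M x) x v = v"
  unfolding from_chart_def using change_self pref by blast

section \<open>Smooth functions and tangent vectors in coordinates\<close>

lemma extends_at_transition:
  assumes c: "c \<in> charts M" "d \<in> charts M" and q: "q \<in> fst c" "q \<in> fst d"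
    and F: "extends_at S c q f F"
  shows "extends_at S d q f (\<lambda>z. F (transition d c z))"
proof -
  obtain W where W: "open W" "snd c q \<in> W" "smooth_on W F"
      "\<forall>y. y \<in> S \<inter> fst c \<longrightarrow> snd c y \<in> W \<longrightarrow> f y = F (snd c y)"
    by (rule extends_atE[OF F]) (rule that)
  define O' where "O' = snd d ` (fst d \<inter> fst c)"
  have O': "open O'" "smooth_on O' (transition d c)"
    unfolding O'_def using open_overlap smooth_transition c by blast+
  define V where "V = O' \<inter> transition d c -` W"
  have "open V" unfolding V_def
    by (rule continuous_open_preimage[OF smooth_on_continuous_on[OF O'(2)] O'(1) W(1)])
  moreover have "snd d q \<in> V" using W(2) q c by (auto simp: V_def O'_def)
  moreover have "smooth_on V (\<lambda>z. F (transition d c z))"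
    by (rule smooth_on_compose[OF \<open>open V\<close> W(1) _ smooth_on_subset[OF O'(1) \<open>open V\<close> _ O'(2)] W(3)])
      (auto simp: V_def)
  moreover have "f y = F (transition d c (snd d y))" if "y \<in> S \<inter> fst d" "snd d y \<in> V" for y
  proof -
    have "y \<in> fst c" using that inj_onD[OF inj_chart[OF c(2)], of y] by (auto simp: V_def O'_def)
    then show ?thesis using that W(4)[rule_format] c by (auto simp: V_def)
  qed
  ultimately show ?thesis unfolding extends_at_def by blast
qed

text \<open>Extensions pull back along transitions, so one chart around each point is enough where
  the definition asks for all of them.\<close>

lemma smooth_funI:
  assumes "\<And>q. q \<in> S \<Longrightarrow> \<exists>c\<in>charts M. q \<in> fst c \<and> (\<exists>F. extends_at S c q f F)"
  shows "smooth_fun M S f"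
  unfolding smooth_fun_def using assms extends_at_transition by meson

text \<open>When \<open>S\<close> contains the whole chart domain, every local extension coincides
  with the coordinate expression near the point, so the local pieces glue.\<close>

lemma smooth_on_chart:
  assumes f: "smooth_fun M S f" and c: "c \<in> charts M" "fst c \<subseteq> S"
  shows "smooth_on (snd c ` fst c) (\<lambda>z. f (inv_chart c z))"
proof (rule smooth_on_local[OF open_chart[OF c(1)]])
  fix z assume "z \<in> snd c ` fst c"
  then obtain q where q: "q \<in> fst c" "z = snd c q" by blast
  then obtain F where F: "extends_at S c q f F"
    using f c unfolding smooth_fun_def by blast
  obtain W where W: "open W" "snd c q \<in> W" "smooth_on W F"
      "\<forall>y. y \<in> S \<inter> fst c \<longrightarrow> snd c y \<in> W \<longrightarrow> f y = F (snd c y)"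
    by (rule extends_atE[OF F]) (rule that)
  have o: "open (W \<inter> snd c ` fst c)" using W open_chart c by blast
  have "smooth_on (W \<inter> snd c ` fst c) (\<lambda>z. f (inv_chart c z))"
    by (rule smooth_on_cong[OF o _ smooth_on_subset[OF W(1) o _ W(3)]]) (use c W(4)[rule_format] in auto)
  then show "\<exists>T. open T \<and> z \<in> T \<and> smooth_on T (\<lambda>z. f (inv_chart c z))"
    using o W(2) q by blast
qed

lemma extends_at_chart:
  assumes c: "c \<in> charts M" "q \<in> fst c" and f: "smooth_on (snd c ` fst c) (\<lambda>z. f (inv_chart c z))"
  shows "extends_at S c q f (\<lambda>z. f (inv_chart c z))"
  unfolding extends_at_def using open_chart[OF c(1)] c f
  by (intro exI[of _ "snd c ` fst c"]) auto

lemma tangent_spaceI: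
  assumes q: "q \<in> points M" and T: "open T" "0 \<in> T" "smooth_on T \<kappa>" "(\<kappa> has_vector_derivative v) (at 0)"
    and \<kappa>: "\<kappa> 0 = snd (pref M q) q" "\<kappa> ` T \<subseteq> snd (pref M q) ` (S \<inter> fst (pref M q))"
  shows "v \<in> tangent_space M S q"
proof -
  define c where "c = pref M q"
  have c: "c \<in> charts M" "q \<in> fst c" using pref q c_def by auto
  obtain \<epsilon> where \<epsilon>: "\<epsilon> > 0" "ball 0 \<epsilon> \<subseteq> T" using T(1,2) openE by blast
  have I: "{-\<epsilon><..<\<epsilon>} \<subseteq> T" using \<epsilon>(2) by (auto simp: ball_def dist_real_def subset_iff)
  have mem: "inv_chart c (\<kappa> t) \<in> S \<inter> fst c \<and> snd c (inv_chart c (\<kappa> t)) = \<kappa> t" if "t \<in> T" for t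
  proof -
    have "\<kappa> t \<in> snd c ` (S \<inter> fst c)" using that \<kappa>(2) unfolding c_def by (simp add: image_subset_iff)
    then obtain y where "y \<in> S \<inter> fst c" "\<kappa> t = snd c y" by (elim imageE)
    then show ?thesis using c by simp
  qed
  have "smooth_on {-\<epsilon><..<\<epsilon>} (snd c \<circ> (\<lambda>t. inv_chart c (\<kappa> t)))"
    by (rule smooth_on_cong[OF _ _ smooth_on_subset[OF T(1) _ I T(3)]]) (use mem I in auto)
  moreover have "((snd c \<circ> (\<lambda>t. inv_chart c (\<kappa> t))) has_vector_derivative v) (at 0)"
    by (rule has_vector_derivative_transform_within_open[OF T(4,1,2)]) (use mem in auto)
  ultimately show ?thesis
    unfolding tangent_space_def c_def[symmetric] using \<epsilon>(1) mem I \<kappa>(1) c c_def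
    by (intro CollectI exI[of _ \<epsilon>] conjI exI[of _ "\<lambda>t. inv_chart c (\<kappa> t)"]) auto
qed

lemma tangent_space_points:
  assumes q: "q \<in> points M"
  shows "tangent_space M (points M) q = UNIV"
proof -
  define c where "c = pref M q"
  have c: "c \<in> charts M" "q \<in> fst c" using pref q c_def by auto
  have "v \<in> tangent_space M (points M) q" for v
  proof -
    define T where "T = (\<lambda>t. snd c q + t *\<^sub>R v) -` (snd c ` fst c)"
    have "open T" unfolding T_def
      by (intro open_vimage open_chart c continuous_intros)
    show ?thesis
    proof (rule tangent_spaceI[OF q \<open>open T\<close>])
      show "smooth_on T (\<lambda>t. snd c q + t *\<^sub>R v)"
        by (intro smooth_on_add smooth_on_scaleR smooth_on_ident smooth_on_const \<open>open T\<close>)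
      show "((\<lambda>t. snd c q + t *\<^sub>R v) has_vector_derivative v) (at 0)"
        by (auto intro!: derivative_eq_intros)
    qed (use c chart_subset[OF c(1)] in \<open>auto simp: T_def c_def[symmetric] Int_absorb1\<close>)
  qed
  then show ?thesis by blast
qed

end

text \<open>Two extensions of \<open>f\<close> agree along a curve in \<open>S\<close> with velocity
  \<open>v\<close>, hence have the same derivative along it. This is where tangency of
  \<open>v\<close> enters: transversally to \<open>S\<close> extensions are unrelated.\<close>

lemma dir_deriv_eq:
  fixes M :: "('a, 'e::euclidean_space) mfd" and f :: "'a \<Rightarrow> 'b::real_normed_vector"
  assumes v: "v \<in> tangent_space M S q" and F: "extends_at S (pref M q) q f F"
  shows "dir_deriv M S q v f = frechet_derivative F (at (snd (pref M q) q)) v"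
proof -
  define c where "c = pref M q"
  obtain \<epsilon> \<gamma> where \<gamma>: "\<epsilon> > 0" "\<gamma> ` {-\<epsilon><..<\<epsilon>} \<subseteq> S \<inter> fst c" "\<gamma> 0 = q"
      "smooth_on {-\<epsilon><..<\<epsilon>} (snd c \<circ> \<gamma>)" "((snd c \<circ> \<gamma>) has_vector_derivative v) (at 0)"
    using v unfolding tangent_space_def c_def by blast
  have "frechet_derivative G (at (snd c q)) v = frechet_derivative F (at (snd c q)) v"
    if G: "extends_at S c q f G" for G
  proof -
    obtain W where W: "open W" "snd c q \<in> W" "smooth_on W F"
        "\<forall>y. y \<in> S \<inter> fst c \<longrightarrow> snd c y \<in> W \<longrightarrow> f y = F (snd c y)"
      by (rule extends_atE[OF F[folded c_def]]) (rule that)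
    obtain V where V: "open V" "snd c q \<in> V" "smooth_on V G"
        "\<forall>y. y \<in> S \<inter> fst c \<longrightarrow> snd c y \<in> V \<longrightarrow> f y = G (snd c y)"
      by (rule extends_atE[OF G]) (rule that)
    define T where "T = {-\<epsilon><..<\<epsilon>} \<inter> (snd c \<circ> \<gamma>) -` (W \<inter> V)"
    have "open T" unfolding T_def
      by (rule continuous_open_preimage[OF smooth_on_continuous_on[OF \<gamma>(4)] _ open_Int[OF W(1) V(1)]]) simp
    moreover have "0 \<in> T" unfolding T_def using W(2) V(2) \<gamma>(1,3) by simp
    ultimately have T: "open T" "0 \<in> T" by auto
    have q: "snd c q = (snd c \<circ> \<gamma>) 0" using \<gamma>(3) by simp
    have *: "((\<lambda>t. H ((snd c \<circ> \<gamma>) t)) has_vector_derivative frechet_derivative H (at (snd c q)) v) (at 0)"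
      if H: "open U" "snd c q \<in> U" "smooth_on U H" for H :: "'e \<Rightarrow> 'b" and U
    proof -
      note D = smooth_on_has_derivative[OF H(1,3,2)]
      have "((\<lambda>t. H ((snd c \<circ> \<gamma>) t)) has_derivative
          (\<lambda>t. frechet_derivative H (at (snd c q)) (t *\<^sub>R v))) (at 0)"
        by (rule has_derivative_compose[OF \<gamma>(5)[unfolded has_vector_derivative_def]])
          (use D q in simp)
      then show ?thesis
        by (simp add: has_vector_derivative_def linear_scale[OF has_derivative_linear[OF D]])
    qed
    have "((\<lambda>t. F ((snd c \<circ> \<gamma>) t)) has_vector_derivative frechet_derivative G (at (snd c q)) v) (at 0)"
    proof (rule has_vector_derivative_transform_within_open[OF *[OF V(1,2,3)] T])
      fix t assume t: "t \<in> T"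
      then have "\<gamma> t \<in> S \<inter> fst c" using \<gamma>(2) by (auto simp: T_def)
      then show "G ((snd c \<circ> \<gamma>) t) = F ((snd c \<circ> \<gamma>) t)"
        using W(4)[rule_format, of "\<gamma> t"] V(4)[rule_format, of "\<gamma> t"] t by (auto simp: T_def)
    qed
    then show ?thesis using *[OF W(1,2,3)] vector_derivative_unique_at by blast
  qed
  then show ?thesis
    unfolding dir_deriv_def c_def[symmetric] using F c_def by (intro the_equality) blast+
qed

text \<open>Unlike \<^const>\<open>dir_deriv\<close>, this relation determines its last argument only if \<open>v\<close> is tangent
  to \<open>S\<close>; it makes the rules of calculus available before tangency is used.\<close>

definition has_dir_deriv ::
  "('a, 'e::euclidean_space) mfd \<Rightarrow> 'a set \<Rightarrow> 'a \<Rightarrow> 'e \<Rightarrow> ('a \<Rightarrow> 'b::real_normed_vector) \<Rightarrow> 'b \<Rightarrow> bool" where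
  "has_dir_deriv M S q v f d \<longleftrightarrow>
     (\<exists>F. extends_at S (pref M q) q f F \<and> frechet_derivative F (at (snd (pref M q) q)) v = d)"

lemma has_dir_deriv_imp_dir_deriv:
  "has_dir_deriv M S q v f d \<Longrightarrow> v \<in> tangent_space M S q \<Longrightarrow> dir_deriv M S q v f = d"
  unfolding has_dir_deriv_def using dir_deriv_eq by metis

lemma has_dir_deriv_const: "has_dir_deriv M S q v (\<lambda>y. k) 0"
  unfolding has_dir_deriv_def extends_at_def
  by (intro exI[of _ "\<lambda>z. k"] conjI exI[of _ UNIV]) auto

lemma has_dir_deriv_cong:
  assumes "\<And>y. y \<in> S \<Longrightarrow> f y = f' y"
  shows "has_dir_deriv M S q v f d \<longleftrightarrow> has_dir_deriv M S q v f' d"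
  using assms by (simp add: has_dir_deriv_def extends_at_def)

lemma has_dir_deriv_combine:
  assumes f: "has_dir_deriv M S q v f d" and f': "has_dir_deriv M S q v f' d'"
  obtains F F' W where "open W" "snd (pref M q) q \<in> W" "smooth_on W F" "smooth_on W F'"
    "\<And>y. y \<in> S \<Longrightarrow> y \<in> fst (pref M q) \<Longrightarrow> snd (pref M q) y \<in> W \<Longrightarrow>
      f y = F (snd (pref M q) y) \<and> f' y = F' (snd (pref M q) y)"
    "frechet_derivative F (at (snd (pref M q) q)) v = d"
    "frechet_derivative F' (at (snd (pref M q) q)) v = d'"
proof -
  define c where "c = pref M q"
  obtain F F' where F: "extends_at S c q f F" "frechet_derivative F (at (snd c q)) v = d"
    "extends_at S c q f' F'" "frechet_derivative F' (at (snd c q)) v = d'"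
    using f f' unfolding has_dir_deriv_def c_def by (elim exE conjE)
  obtain W where W: "open W" "snd c q \<in> W" "smooth_on W F"
    "\<forall>y. y \<in> S \<inter> fst c \<longrightarrow> snd c y \<in> W \<longrightarrow> f y = F (snd c y)"
    by (rule extends_atE[OF F(1)]) (rule that)
  obtain W' where W': "open W'" "snd c q \<in> W'" "smooth_on W' F'"
    "\<forall>y. y \<in> S \<inter> fst c \<longrightarrow> snd c y \<in> W' \<longrightarrow> f' y = F' (snd c y)"
    by (rule extends_atE[OF F(3)]) (rule that)
  have o: "open (W \<inter> W')" using W(1) W'(1) by blast
  show thesis
  proof (rule that[of "W \<inter> W'" F F', folded c_def])
    show "smooth_on (W \<inter> W') F" by (rule smooth_on_subset[OF W(1) o _ W(3)]) simp
    show "smooth_on (W \<inter> W') F'" by (rule smooth_on_subset[OF W'(1) o _ W'(3)]) simp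
  qed (use W W' F o in auto)
qed

lemma has_dir_deriv_add:
  assumes "has_dir_deriv M S q v f d" "has_dir_deriv M S q v f' d'"
  shows "has_dir_deriv M S q v (\<lambda>y. f y + f' y) (d + d')"
proof (rule has_dir_deriv_combine[OF assms])
  fix F F' W
  assume W: "open W" "snd (pref M q) q \<in> W" "smooth_on W F" "smooth_on W F'"
    and e: "\<And>y. y \<in> S \<Longrightarrow> y \<in> fst (pref M q) \<Longrightarrow> snd (pref M q) y \<in> W \<Longrightarrow>
      f y = F (snd (pref M q) y) \<and> f' y = F' (snd (pref M q) y)"
    and d: "frechet_derivative F (at (snd (pref M q) q)) v = d" "frechet_derivative F' (at (snd (pref M q) q)) v = d'"
  have "extends_at S (pref M q) q (\<lambda>y. f y + f' y) (\<lambda>z. F z + F' z)"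
    unfolding extends_at_def using W(1,2) e smooth_on_add[OF W(1,3,4)] by (intro exI[of _ W]) auto
  moreover have "frechet_derivative (\<lambda>z. F z + F' z) (at (snd (pref M q) q)) v = d + d'"
    using frechet_derivativeI[OF has_derivative_add[OF smooth_on_has_derivative[OF W(1,3,2)]
          smooth_on_has_derivative[OF W(1,4,2)]]] d by simp
  ultimately show ?thesis unfolding has_dir_deriv_def by (intro exI conjI)
qed

lemma has_dir_deriv_mult:
  fixes f f' :: "'a \<Rightarrow> real"
  assumes "has_dir_deriv M S q v f d" "has_dir_deriv M S q v f' d'" and q: "q \<in> S" "q \<in> fst (pref M q)"
  shows "has_dir_deriv M S q v (\<lambda>y. f y * f' y) (f q * d' + d * f' q)"
proof (rule has_dir_deriv_combine[OF assms(1,2)])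
  fix F F' W
  assume W: "open W" "snd (pref M q) q \<in> W" "smooth_on W F" "smooth_on W F'"
    and e: "\<And>y. y \<in> S \<Longrightarrow> y \<in> fst (pref M q) \<Longrightarrow> snd (pref M q) y \<in> W \<Longrightarrow>
      f y = F (snd (pref M q) y) \<and> f' y = F' (snd (pref M q) y)"
    and d: "frechet_derivative F (at (snd (pref M q) q)) v = d" "frechet_derivative F' (at (snd (pref M q) q)) v = d'"
  have "extends_at S (pref M q) q (\<lambda>y. f y * f' y) (\<lambda>z. F z * F' z)"
    unfolding extends_at_def using W(1,2) e smooth_on_mult[OF W(1,3,4)] by (intro exI[of _ W]) auto
  moreover have "frechet_derivative (\<lambda>z. F z * F' z) (at (snd (pref M q) q)) v = f q * d' + d * f' q"
    using frechet_derivativeI[OF has_derivative_mult[OF smooth_on_has_derivative[OF W(1,3,2)]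
          smooth_on_has_derivative[OF W(1,4,2)]]] d e[OF q W(2)] by simp
  ultimately show ?thesis unfolding has_dir_deriv_def by (intro exI conjI)
qed

lemma dir_deriv_cong:
  assumes "\<And>y. y \<in> S \<Longrightarrow> f y = f' y"
  shows "dir_deriv M S q v f = dir_deriv M S q v f'"
  using assms by (simp add: dir_deriv_def extends_at_def)

lemma vector_fields_tangent: "X \<in> vector_fields M S \<Longrightarrow> q \<in> S \<Longrightarrow> X q \<in> tangent_space M S q"
  by (simp add: vector_fields_def)

text \<open>A field stores its values in the varying charts \<open>pref M y\<close>, and no
  regularity of \<open>pref\<close> is assumed; the components in one chart \<open>c\<close> are the
  functions that can be differentiated.\<close>

definition rep :: "('a, 'e::euclidean_space) mfd \<Rightarrow> ('a, 'e) chart \<Rightarrow> ('a \<Rightarrow> 'e) \<Rightarrow> 'e \<Rightarrow> 'e" where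
  "rep M c X z = to_chart M c (inv_chart c z) (X (inv_chart c z))"

context atlas
begin

text \<open>Passing from the chart \<open>d\<close> to \<open>c\<close> applies the derivative of
  the transition to the components, a smooth linear family at a smooth argument; therefore one chart
  around each point suffices.\<close>

lemma vector_fieldsI:
  assumes t: "\<And>q. q \<in> S \<Longrightarrow> X q \<in> tangent_space M S q"
    and s: "\<And>q. q \<in> S \<Longrightarrow> \<exists>c\<in>charts M. q \<in> fst c \<and> (\<exists>F. extends_at S c q (\<lambda>y. to_chart M c y (X y)) F)"
  shows "X \<in> vector_fields M S"
proof -
  have "smooth_fun M (S \<inter> fst c) (\<lambda>y. to_chart M c y (X y))" if c: "c \<in> charts M" for c
  proof (rule smooth_funI)
    fix q assume q: "q \<in> S \<inter> fst c"
    then obtain d F where d: "d \<in> charts M" "q \<in> fst d" and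
      F: "extends_at S d q (\<lambda>y. to_chart M d y (X y)) F"
      using s[of q] by blast
    obtain W where
      W: "open W" "snd d q \<in> W" "smooth_on W F"
        "\<forall>y. y \<in> S \<inter> fst d \<longrightarrow> snd d y \<in> W \<longrightarrow> to_chart M d y (X y) = F (snd d y)"
      by (rule extends_atE[OF F]) (rule that)
    define V where "V = W \<inter> snd d ` (fst d \<inter> fst c)"
    have V: "open V" unfolding V_def using W(1) open_overlap d c by blast
    define H where "H z = frechet_derivative (transition d c) (at z) (F z)" for z
    have *: "smooth_on V (transition d c)"
      by (rule smooth_on_subset[OF open_overlap V _ smooth_transition]) (use d c in \<open>auto simp: V_def\<close>)
    have "smooth_on V H" unfolding H_def
      by (rule smooth_on_linear_family[OF V smooth_on_linear_derivative[OF V *] smooth_on_derivative[OF *]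
            smooth_on_subset[OF W(1) V _ W(3)]]) (auto simp: V_def)
    moreover have "to_chart M c y (X y) = H (snd d y)"
      if y: "y \<in> S \<inter> fst c \<inter> fst d" "snd d y \<in> V" for y
    proof -
      have "H (snd d y) = change d c y (to_chart M d y (X y))"
        using y W(4)[rule_format, of y] by (simp add: H_def change_def V_def)
      then show ?thesis using change_to_chart[OF d(1) c] y by simp
    qed
    moreover have "snd d q \<in> V" using q d W(2) by (auto simp: V_def)
    ultimately have "extends_at (S \<inter> fst c) d q (\<lambda>y. to_chart M c y (X y)) H"
      unfolding extends_at_def using V by blast
    then show "\<exists>d\<in>charts M. q \<in> fst d \<and> (\<exists>F. extends_at (S \<inter> fst c) d q (\<lambda>y. to_chart M c y (X y)) F)"
      using d by blast
  qed
  then show ?thesis using t by (simp add: vector_fields_def)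
qed

lemma field_smooth_on_rep:
  assumes "X \<in> vector_fields M (points M)" "c \<in> charts M"
  shows "smooth_on (snd c ` fst c) (rep M c X)"
proof -
  have "smooth_fun M (points M \<inter> fst c) (\<lambda>y. to_chart M c y (X y))"
    using assms by (simp add: vector_fields_def)
  from smooth_on_chart[OF this assms(2)] show ?thesis
    using chart_subset[OF assms(2)] by (simp add: rep_def[abs_def])
qed

lemma vector_fields_pointsI:
  assumes "\<And>q. q \<in> points M \<Longrightarrow> \<exists>c\<in>charts M. q \<in> fst c \<and> smooth_on (snd c ` fst c) (rep M c X)"
  shows "X \<in> vector_fields M (points M)"
proof (rule vector_fieldsI)
  fix q assume q: "q \<in> points M"
  then show "X q \<in> tangent_space M (points M) q" by (simp add: tangent_space_points)
  obtain c where c: "c \<in> charts M" "q \<in> fst c" "smooth_on (snd c ` fst c) (rep M c X)"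
    using assms q by blast
  then have "extends_at (points M) c q (\<lambda>y. to_chart M c y (X y)) (rep M c X)"
    using extends_at_chart[of c q "\<lambda>y. to_chart M c y (X y)"] by (simp add: rep_def[abs_def])
  then show "\<exists>c\<in>charts M. q \<in> fst c \<and> (\<exists>F. extends_at (points M) c q (\<lambda>y. to_chart M c y (X y)) F)"
    using c by blast
qed

lemma rep_chart [simp]: "c \<in> charts M \<Longrightarrow> x \<in> fst c \<Longrightarrow> rep M c X (snd c x) = to_chart M c x (X x)"
  by (simp add: rep_def)

lemma rep_has_derivative:
  "X \<in> vector_fields M (points M) \<Longrightarrow> c \<in> charts M \<Longrightarrow> z \<in> snd c ` fst c \<Longrightarrow>
    (rep M c X has_derivative frechet_derivative (rep M c X) (at z)) (at z)"
  using smooth_on_has_derivative[OF open_chart field_smooth_on_rep] .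

lemma dir_deriv_points:
  assumes q: "q \<in> points M"
    and f: "smooth_on (snd (pref M q) ` fst (pref M q)) (\<lambda>z. f (inv_chart (pref M q) z))"
  shows "dir_deriv M (points M) q v f =
    frechet_derivative (\<lambda>z. f (inv_chart (pref M q) z)) (at (snd (pref M q) q)) v"
  by (rule dir_deriv_eq) (use extends_at_chart[OF _ _ f] pref[OF q] tangent_space_points[OF q] in auto)

lemma lie_bracket_points:
  assumes q: "q \<in> points M" and X: "X \<in> vector_fields M (points M)" and Y: "Y \<in> vector_fields M (points M)"
  shows "lie_bracket M (points M) X Y q =
    frechet_derivative (rep M (pref M q) Y) (at (snd (pref M q) q)) (X q) -
    frechet_derivative (rep M (pref M q) X) (at (snd (pref M q) q)) (Y q)"
proof -
  have "dir_deriv M (points M) q v (\<lambda>y. to_chart M (pref M q) y (Z y)) =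
      frechet_derivative (rep M (pref M q) Z) (at (snd (pref M q) q)) v"
    if "Z \<in> vector_fields M (points M)" for Z v
    using dir_deriv_points[OF q, of "\<lambda>y. to_chart M (pref M q) y (Z y)"] pref[OF q]
      field_smooth_on_rep[OF that, of "pref M q"]
    by (simp add: rep_def[abs_def])
  then show ?thesis using X Y by (simp add: lie_bracket_def)
qed

section \<open>The topology of the manifold and fields with prescribed values\<close>

lemma openin_mfd_topology:
  "openin (mfd_topology M) V \<longleftrightarrow> V \<subseteq> points M \<and> (\<forall>c\<in>charts M. open (snd c ` (V \<inter> fst c)))"
proof -
  have "istopology (\<lambda>V. V \<subseteq> points M \<and> (\<forall>c\<in>charts M. open (snd c ` (V \<inter> fst c))))"
    unfolding istopology_def
  proof (intro conjI allI impI ballI)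
    fix A B c assume "A \<subseteq> points M \<and> (\<forall>c\<in>charts M. open (snd c ` (A \<inter> fst c)))"
      "B \<subseteq> points M \<and> (\<forall>c\<in>charts M. open (snd c ` (B \<inter> fst c)))" and c: "c \<in> charts M"
    moreover have "snd c ` (A \<inter> B \<inter> fst c) = snd c ` (A \<inter> fst c) \<inter> snd c ` (B \<inter> fst c)"
      using chart_image_Int[OF c, of A B] by (simp add: Int_ac)
    ultimately show "open (snd c ` (A \<inter> B \<inter> fst c))" by auto
  next
    fix K c assume "\<forall>A\<in>K. A \<subseteq> points M \<and> (\<forall>c\<in>charts M. open (snd c ` (A \<inter> fst c)))" "c \<in> charts M"
    moreover have "snd c ` (\<Union> K \<inter> fst c) = (\<Union>A\<in>K. snd c ` (A \<inter> fst c))" by blast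
    ultimately show "open (snd c ` (\<Union> K \<inter> fst c))" by auto
  qed auto
  then show ?thesis unfolding mfd_topology_def by (simp add: topology_inverse')
qed

lemma topspace_mfd_topology: "topspace (mfd_topology M) = points M"
proof -
  have "openin (mfd_topology M) (points M)"
    using openin_mfd_topology chart_subset open_chart by (simp add: Int_absorb1)
  then show ?thesis unfolding topspace_def using openin_mfd_topology by blast
qed

text \<open>By the last property, a field or function multiplied by the bump can be extended by zero beyond the
  domain of \<open>c\<close>; its proof needs the preimage of a closed ball to be closed in \<open>M\<close>.\<close>

lemma bump_function:
  assumes H: "Hausdorff_space (mfd_topology M)" and c: "c \<in> charts M" "q \<in> fst c"
  obtains b :: "'e \<Rightarrow> real" where "smooth_on UNIV b" "b (snd c q) = 1"
    "\<And>p d. p \<in> fst d \<Longrightarrow> p \<notin> fst c \<Longrightarrow> d \<in> charts M \<Longrightarrow>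
      \<exists>W. open W \<and> snd d p \<in> W \<and> (\<forall>y\<in>fst d \<inter> fst c. snd d y \<in> W \<longrightarrow> b (snd c y) = 0)"
proof -
  define U where "U = snd c ` fst c"
  have "snd c q \<in> U" "open U" using c open_chart by (auto simp: U_def)
  then obtain r where r: "r > 0" "cball (snd c q) r \<subseteq> U" using open_contains_cball by blast
  obtain b :: "'e \<Rightarrow> real" where b: "smooth_on UNIV b" "b (snd c q) = 1"
      "\<And>z. z \<notin> ball (snd c q) r \<Longrightarrow> b z = 0"
    using smooth_bump[OF r(1)] by blast
  define K where "K = inv_chart c ` cball (snd c q) r"
  \<comment> \<open>Continuity of the inverse chart makes \<open>K\<close> compact, and the
    Hausdorff property then makes it closed. Without this, points outside \<open>fst c\<close> could
    be limits of points where the bump does not vanish.\<close>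
  have "continuous_map (top_of_set U) (mfd_topology M) (inv_chart c)"
    unfolding continuous_map_def
  proof (intro conjI allI impI)
    show "inv_chart c \<in> topspace (top_of_set U) \<rightarrow> topspace (mfd_topology M)"
      using c chart_subset[OF c(1)] by (auto simp: topspace_mfd_topology U_def)
    fix V assume "openin (mfd_topology M) V"
    then have "open (snd c ` (V \<inter> fst c))" using openin_mfd_topology c by blast
    moreover have "{x \<in> topspace (top_of_set U). inv_chart c x \<in> V} = snd c ` (V \<inter> fst c)"
      using c by (auto simp: U_def)
    ultimately show "openin (top_of_set U) {x \<in> topspace (top_of_set U). inv_chart c x \<in> V}"
      by (metis (no_types, lifting) \<open>open U\<close> mem_Collect_eq openin_open_eq subsetI topspace_euclidean_subtopology)
  qed
  moreover have "compactin (top_of_set U) (cball (snd c q) r)"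
    using r by (simp add: compactin_subtopology)
  ultimately have "compactin (mfd_topology M) K" unfolding K_def by (rule image_compactin[rotated])
  then have "closedin (mfd_topology M) K" using H compactin_imp_closedin by blast
  then have O': "openin (mfd_topology M) (points M - K)"
    by (metis openin_closedin_eq closedin_def topspace_mfd_topology)
  show thesis
  proof (rule that[OF b(1,2)])
    fix p d assume p: "p \<in> fst d" "p \<notin> fst c" "d \<in> charts M"
    have "open (snd d ` ((points M - K) \<inter> fst d))" using O' openin_mfd_topology p by blast
    moreover have "p \<notin> K" using p(2) r c by (auto simp: K_def U_def)
    then have "snd d p \<in> snd d ` ((points M - K) \<inter> fst d)" using p chart_subset by blast
    moreover have "b (snd c y) = 0"
      if y: "y \<in> fst d \<inter> fst c" "snd d y \<in> snd d ` ((points M - K) \<inter> fst d)" for y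
    proof -
      have "y \<notin> K" using y inj_onD[OF inj_chart[OF p(3)], of y] by blast
      then have "snd c y \<notin> cball (snd c q) r" unfolding K_def using y c
        by (metis IntD2 imageI inv_chart_chart)
      then show ?thesis using b(3) by auto
    qed
    ultimately show "\<exists>W. open W \<and> snd d p \<in> W \<and> (\<forall>y\<in>fst d \<inter> fst c. snd d y \<in> W \<longrightarrow> b (snd c y) = 0)"
      by blast
  qed
qed

text \<open>The field has constant components in the preferred chart of \<open>q\<close>, is cut off
  by a bump and is continued by zero.\<close>

lemma vector_field_through:
  assumes H: "Hausdorff_space (mfd_topology M)" and q: "q \<in> points M"
  obtains X where "X \<in> vector_fields M (points M)" "X q = v"
proof -
  define c where "c = pref M q"
  have c: "c \<in> charts M" "q \<in> fst c" using pref q c_def by auto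
  obtain b :: "'e \<Rightarrow> real" where b: "smooth_on UNIV b" "b (snd c q) = 1"
    "\<And>p d. p \<in> fst d \<Longrightarrow> p \<notin> fst c \<Longrightarrow> d \<in> charts M \<Longrightarrow>
      \<exists>W. open W \<and> snd d p \<in> W \<and> (\<forall>y\<in>fst d \<inter> fst c. snd d y \<in> W \<longrightarrow> b (snd c y) = 0)"
    using bump_function[OF H c] by blast
  define X where "X y = (if y \<in> fst c then b (snd c y) *\<^sub>R from_chart M c y v else 0)" for y
  have "X \<in> vector_fields M (points M)"
  proof (rule vector_fieldsI)
    fix p assume p: "p \<in> points M"
    show "X p \<in> tangent_space M (points M) p" using tangent_space_points[OF p] by simp
    show "\<exists>c\<in>charts M. p \<in> fst c \<and> (\<exists>F. extends_at (points M) c p (\<lambda>y. to_chart M c y (X y)) F)"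
    proof (cases "p \<in> fst c")
      case True
      have "smooth_on (snd c ` fst c) (\<lambda>z. b z *\<^sub>R v)"
        by (intro smooth_on_scaleR smooth_on_const open_chart[OF c(1)]
            smooth_on_subset[OF _ open_chart[OF c(1)] _ b(1)]) auto
      then have "extends_at (points M) c p (\<lambda>y. to_chart M c y (X y)) (\<lambda>z. b z *\<^sub>R v)"
        unfolding extends_at_def using open_chart[OF c(1)] c True
        by (intro exI[of _ "snd c ` fst c"]) (auto simp: X_def linear_scale[OF linear_to_chart])
      then show ?thesis using c True by blast
    next
      case False
      obtain d where d: "d \<in> charts M" "p \<in> fst d" using p unfolding points_def by blast
      obtain W where W: "open W" "snd d p \<in> W" "\<forall>y\<in>fst d \<inter> fst c. snd d y \<in> W \<longrightarrow> b (snd c y) = 0"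
        using b(3)[OF d(2) False d(1)] by blast
      have "to_chart M d y (X y) = 0" if "y \<in> fst d" "snd d y \<in> W" for y
        using that W(3) linear_0[OF linear_to_chart[OF d(1)]] by (auto simp: X_def)
      then have "extends_at (points M) d p (\<lambda>y. to_chart M d y (X y)) (\<lambda>z. 0)"
        unfolding extends_at_def using W(1,2) by (intro exI[of _ W]) auto
      then show ?thesis using d by blast
    qed
  qed
  moreover have "X q = v" using c b(2) q by (simp add: X_def c_def)
  ultimately show thesis using that by blast
qed

end

section \<open>Inner products and index raising\<close>

definition inner_form :: "(real^'n \<Rightarrow> real^'n \<Rightarrow> real) \<Rightarrow> bool" where
  "inner_form B \<longleftrightarrow> bilinear B \<and> (\<forall>u v. B u v = B v u) \<and> (\<forall>u. u \<noteq> 0 \<longrightarrow> B u u > 0)"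

text \<open>Index raising for a bare bilinear form: besides \<open>g x\<close> it is applied to the
  coordinate metric at a point of the model space, where \<open>sharp\<close> has no
  meaning.\<close>

definition raise :: "(real^'n \<Rightarrow> real^'n \<Rightarrow> real) \<Rightarrow> real^'n \<Rightarrow> real^'n" where
  "raise B \<omega> = (THE v. \<forall>u. B v u = \<omega> \<bullet> u)"

lemma sharp_eq_raise: "sharp g x = raise (g x)"
  by (simp add: sharp_def[abs_def] raise_def[abs_def])

lemma inner_form_bilinear: "inner_form B \<Longrightarrow> bilinear B"
  and inner_form_sym: "inner_form B \<Longrightarrow> B u v = B v u"
  by (auto simp: inner_form_def)

lemma inner_form_eqI:
  assumes B: "inner_form B" and e: "\<And>u. B v u = B w u"
  shows "v = w"
proof (rule ccontr)
  assume "v \<noteq> w"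
  then have "B (v - w) (v - w) > 0" using B by (simp add: inner_form_def)
  then show False using e[of "v - w"] by (simp add: bilinear_lsub[OF inner_form_bilinear[OF B]])
qed

text \<open>Covectors are defined by their values on the coordinate vectors; this recovers their
  values on all vectors.\<close>

lemma covector_of_linear:
  fixes f :: "real^'n \<Rightarrow> real"
  assumes "linear f"
  shows "(\<chi> i. f (axis i 1)) \<bullet> u = f u"
proof -
  have "f u = f (\<Sum>i\<in>UNIV. u $ i *\<^sub>R axis i 1)"
    using basis_expansion[of u] by (simp add: scalar_mult_eq_scaleR)
  then show ?thesis
    by (simp add: inner_vec_def linear_sum[OF assms] linear_scale[OF assms] mult.commute)
qed

lemma covector_eqI:
  fixes v w :: "real^'n"
  shows "(\<And>u. v \<bullet> u = w \<bullet> u) \<Longrightarrow> v = w"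
  using vector_eq_rdot by blast

lemma covec_comp_inner: "linear A \<Longrightarrow> covec_comp \<omega> A \<bullet> u = \<omega> \<bullet> A u"
  unfolding covec_comp_def
  by (rule covector_of_linear) (auto simp: linear_iff inner_add_right)

lemma inner_form_matrix:
  fixes B :: "real^'n \<Rightarrow> real^'n \<Rightarrow> real"
  assumes B: "inner_form B"
  defines "A \<equiv> \<chi> i j. B (axis i 1) (axis j 1)"
  shows "B u v = u \<bullet> (A *v v)" "invertible A"
proof -
  note b = inner_form_bilinear[OF B]
  have r: "(A *v v) $ i = B (axis i 1) v" for i v
  proof -
    have "(A *v v) $ i = (\<chi> j. B (axis i 1) (axis j 1)) \<bullet> v"
      by (simp add: matrix_vector_mult_def A_def inner_vec_def)
    also have "\<dots> = B (axis i 1) v"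
      by (rule covector_of_linear) (use b in \<open>simp add: bilinear_def\<close>)
    finally show ?thesis .
  qed
  have "A *v v = (\<chi> i. B (axis i 1) v)" for v by (simp add: vec_eq_iff r)
  moreover have "(\<chi> i. B (axis i 1) v) \<bullet> u = B u v" for u v
    by (rule covector_of_linear) (use b in \<open>simp add: bilinear_def\<close>)
  ultimately show *: "B u v = u \<bullet> (A *v v)" for u v by (simp add: inner_commute)
  have "v = 0" if "A *v v = 0" for v
    using B *[of v v] that by (metis inner_form_def inner_zero_right less_irrefl)
  then show "invertible A" unfolding invertible_left_inverse matrix_left_invertible_ker by blast
qed

lemma invertible_matrix_inv_right:
  assumes "invertible A"
  shows "A ** matrix_inv A = mat 1"
  using assms unfolding invertible_def matrix_inv_def by (rule someI2_ex) simp

text \<open>The inverse Gram matrix supplies existence. The matrix formula is kept because the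
  Christoffel symbols are defined through \<open>matrix_inv\<close>.\<close>

lemma raise_matrix_works:
  fixes B :: "real^'n \<Rightarrow> real^'n \<Rightarrow> real"
  assumes B: "inner_form B"
  shows "raise B \<omega> = matrix_inv (\<chi> i j. B (axis i 1) (axis j 1)) *v \<omega> \<and> (\<forall>u. B (raise B \<omega>) u = \<omega> \<bullet> u)"
proof -
  define A :: "real^'n^'n" where "A = (\<chi> i j. B (axis i 1) (axis j 1))"
  have A: "B u v = u \<bullet> (A *v v)" "invertible A" for u v
    unfolding A_def by (rule inner_form_matrix[OF B])+
  have "A *v (matrix_inv A *v \<omega>) = \<omega>"
    by (simp add: matrix_vector_mul_assoc invertible_matrix_inv_right[OF A(2)])
  then have "B u (matrix_inv A *v \<omega>) = u \<bullet> \<omega>" for u by (simp only: A(1)[of u "matrix_inv A *v \<omega>"])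
  then have *: "\<forall>u. B (matrix_inv A *v \<omega>) u = \<omega> \<bullet> u"
    by (simp add: inner_form_sym[OF B, of "matrix_inv A *v \<omega>"] inner_commute)
  have "raise B \<omega> = matrix_inv A *v \<omega>"
    unfolding raise_def by (rule the_equality[where P="\<lambda>v. \<forall>u. B v u = \<omega> \<bullet> u", OF *])
      (rule inner_form_eqI[OF B], use * in simp)
  then show ?thesis using * by (simp add: A_def)
qed

lemmas raise_matrix = raise_matrix_works[THEN conjunct1]

lemma raise_works: "inner_form B \<Longrightarrow> B (raise B \<omega>) u = \<omega> \<bullet> u"
  using raise_matrix_works by blast

lemma raise_works': "inner_form B \<Longrightarrow> B u (raise B \<omega>) = \<omega> \<bullet> u"
  using raise_works inner_form_sym by metis

lemma raise_eqI:
  assumes B: "inner_form B" and e: "\<And>u. B v u = \<omega> \<bullet> u"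
  shows "raise B \<omega> = v"
  by (rule inner_form_eqI[OF B]) (simp add: raise_works[OF B] e)

lemma linear_raise: "inner_form B \<Longrightarrow> linear (raise B)"
  by (rule linearI; rule raise_eqI)
    (auto simp: raise_works inner_add_left bilinear_ladd bilinear_lmul inner_form_bilinear)

lemma smooth_on_det:
  fixes A :: "'e::euclidean_space \<Rightarrow> real^'n^'n"
  assumes S: "open S" and A: "\<And>i j. smooth_on S (\<lambda>z. A z $ i $ j)"
  shows "smooth_on S (\<lambda>z. det (A z))"
  unfolding det_def by (intro smooth_on_sum smooth_on_mult smooth_on_prod smooth_on_const S A) simp

text \<open>By Cramer's rule the components are quotients of determinants, that is, of polynomials
  in smooth functions.\<close>

lemma smooth_on_raise:
  fixes B :: "'e::euclidean_space \<Rightarrow> real^'n \<Rightarrow> real^'n \<Rightarrow> real"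
  assumes S: "open S" and f: "\<And>z. z \<in> S \<Longrightarrow> inner_form (B z)"
    and B: "\<And>u v. smooth_on S (\<lambda>z. B z u v)" and \<omega>: "smooth_on S \<omega>"
  shows "smooth_on S (\<lambda>z. raise (B z) (\<omega> z))"
proof -
  define A :: "'e \<Rightarrow> real^'n^'n" where "A z = (\<chi> i j. B z (axis i 1) (axis j 1))" for z
  \<comment> \<open>The matrices of Cramer's rule: column \<open>k\<close> of the Gram matrix is
    replaced by the right-hand side.\<close>
  define C :: "'n \<Rightarrow> 'e \<Rightarrow> real^'n^'n" where "C k z = (\<chi> i j. if j = k then \<omega> z $ i else A z $ i $ j)" for k z
  have A: "smooth_on S (\<lambda>z. A z $ i $ j)" for i j by (simp add: A_def B)
  have "smooth_on S (\<lambda>z. \<omega> z \<bullet> axis i 1)" for i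
    by (intro smooth_on_inner S \<omega> smooth_on_const)
  then have \<omega>i: "smooth_on S (\<lambda>z. \<omega> z $ i)" for i by (simp add: inner_axis)
  have C: "smooth_on S (\<lambda>z. C k z $ i $ j)" for k i j
    by (cases "j = k") (simp_all add: C_def A \<omega>i)
  have inv: "invertible (A z)" if "z \<in> S" for z
    unfolding A_def by (rule inner_form_matrix(2)[OF f[OF that]])
  have d: "det (A z) \<noteq> 0" if "z \<in> S" for z using inv[OF that] invertible_det_nz by blast
  have eq: "(\<chi> k. det (C k z) * inverse (det (A z))) = raise (B z) (\<omega> z)" if "z \<in> S" for z
  proof -
    have "A z *v raise (B z) (\<omega> z) = \<omega> z"
      unfolding raise_matrix[OF f[OF that]] A_def[symmetric]
      by (simp add: matrix_vector_mul_assoc invertible_matrix_inv_right[OF inv[OF that]])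
    then show ?thesis unfolding cramer[OF d[OF that]] by (simp add: C_def divide_inverse)
  qed
  have sm: "smooth_on S (\<lambda>z. \<chi> k. det (C k z) * inverse (det (A z)))"
    by (intro smooth_on_vec smooth_on_mult smooth_on_inverse smooth_on_det S A C d)
  show ?thesis by (rule smooth_on_cong[OF S eq sm])
qed

section \<open>The Levi-Civita connection in a chart\<close>

lemma levi_civita_field:
  "levi_civita M S g D \<Longrightarrow> X \<in> vector_fields M S \<Longrightarrow> Y \<in> vector_fields M S \<Longrightarrow> D X Y \<in> vector_fields M S"
  unfolding levi_civita_def by blast

lemma levi_civita_torsion:
  "levi_civita M S g D \<Longrightarrow> X \<in> vector_fields M S \<Longrightarrow> Y \<in> vector_fields M S \<Longrightarrow> q \<in> S \<Longrightarrow>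
    D X Y q - D Y X q = lie_bracket M S X Y q"
  unfolding levi_civita_def by (elim conjE) blast

lemma levi_civita_metric:
  "levi_civita M S g D \<Longrightarrow> X \<in> vector_fields M S \<Longrightarrow> Y \<in> vector_fields M S \<Longrightarrow> Z \<in> vector_fields M S \<Longrightarrow>
    q \<in> S \<Longrightarrow> dir_deriv M S q (X q) (\<lambda>y. g y (Y y) (Z y)) = g q (D X Y q) (Z q) + g q (Y q) (D X Z q)"
  unfolding levi_civita_def by (elim conjE) blast

text \<open>Metricity for three arrangements of the fields combined with torsion-freeness. It is
  stated for a submanifold because it serves twice: on \<open>M\<close>, to identify
  \<open>D\<close> with the Christoffel symbols, and on the unit cotangent bundle.\<close>

lemma levi_civita_koszul:
  assumes D: "levi_civita M S g D" and q: "q \<in> S" and b: "bilinear (g q)" "\<And>u v. g q u v = g q v u"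
    and X: "X \<in> vector_fields M S" and Y: "Y \<in> vector_fields M S" and Z: "Z \<in> vector_fields M S"
  shows "2 * g q (D X Y q) (Z q) =
    dir_deriv M S q (X q) (\<lambda>y. g y (Y y) (Z y)) + dir_deriv M S q (Y q) (\<lambda>y. g y (X y) (Z y))
    - dir_deriv M S q (Z q) (\<lambda>y. g y (X y) (Y y))
    + g q (lie_bracket M S X Y q) (Z q) - g q (lie_bracket M S X Z q) (Y q) - g q (lie_bracket M S Y Z q) (X q)"
proof -
  have t: "lie_bracket M S U V q = D U V q - D V U q"
    if "U \<in> vector_fields M S" "V \<in> vector_fields M S" for U V
    by (rule levi_civita_torsion[OF D that q, symmetric])
  have c: "dir_deriv M S q (U q) (\<lambda>y. g y (V y) (W y)) = g q (D U V q) (W q) + g q (V q) (D U W q)"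
    if "U \<in> vector_fields M S" "V \<in> vector_fields M S" "W \<in> vector_fields M S" for U V W
    by (rule levi_civita_metric[OF D that q])
  show ?thesis
    unfolding t[OF X Y] t[OF X Z] t[OF Y Z] c[OF X Y Z] c[OF Y X Z] c[OF Z X Y]
      bilinear_lsub[OF b(1)]
    using b(2)[of "Y q"] b(2)[of "X q"] by simp
qed

locale riemannian = atlas M for M :: "('a, real^'n) mfd" +
  fixes g :: "'a \<Rightarrow> real^'n \<Rightarrow> real^'n \<Rightarrow> real"
  assumes metric: "riemannian_metric M g"
    and hausdorff: "Hausdorff_space (mfd_topology M)"
begin

abbreviation "U c \<equiv> snd c ` fst c"

text \<open>The metric in the chart \<open>c\<close>, its derivative in the direction given by the last argument of
  \<open>dgc\<close>, and the Christoffel symbols as a vector-valued bilinear form.\<close>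

definition gc :: "('a, real^'n) chart \<Rightarrow> real^'n \<Rightarrow> real^'n \<Rightarrow> real^'n \<Rightarrow> real" where
  "gc c z a b = g (inv_chart c z) (from_chart M c (inv_chart c z) a) (from_chart M c (inv_chart c z) b)"

definition dgc :: "('a, real^'n) chart \<Rightarrow> real^'n \<Rightarrow> real^'n \<Rightarrow> real^'n \<Rightarrow> real^'n \<Rightarrow> real" where
  "dgc c z a b v = frechet_derivative (\<lambda>z. gc c z a b) (at z) v"

definition gam :: "('a, real^'n) chart \<Rightarrow> real^'n \<Rightarrow> real^'n \<Rightarrow> real^'n \<Rightarrow> real^'n" where
  "gam c z a b = raise (gc c z) (\<chi> l. 1/2 * (dgc c z b (axis l 1) a + dgc c z a (axis l 1) b - dgc c z a b (axis l 1)))"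

section \<open>The metric and its Christoffel symbols in coordinates\<close>

lemma inner_form_g: "x \<in> points M \<Longrightarrow> inner_form (g x)"
  using metric unfolding riemannian_metric_def inner_form_def by blast

lemma gc_chart: "c \<in> charts M \<Longrightarrow> x \<in> fst c \<Longrightarrow> gc c (snd c x) a b = g x (from_chart M c x a) (from_chart M c x b)"
  by (simp add: gc_def)

lemma inner_form_gc:
  assumes c: "c \<in> charts M" and z: "z \<in> U c"
  shows "inner_form (gc c z)"
proof -
  obtain x where x: "x \<in> fst c" "z = snd c x" using z by blast
  then have p: "x \<in> points M" using c chart_subset by blast
  note i = inner_form_g[OF p] and l = linear_from_chart[OF c x(1)]
  have "from_chart M c x u \<noteq> 0" if "u \<noteq> 0" for u
    using that to_from_chart[OF c x(1), of u] linear_0[OF linear_to_chart[OF c x(1)]] by auto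
  then show ?thesis
    using i c x unfolding inner_form_def bilinear_def gc_def
    by (auto simp: linear_iff linear_add[OF l] linear_scale[OF l])
qed

lemma bilinear_gc: "c \<in> charts M \<Longrightarrow> z \<in> U c \<Longrightarrow> bilinear (gc c z)"
  using inner_form_gc inner_form_bilinear by blast

lemma smooth_on_gc: "c \<in> charts M \<Longrightarrow> smooth_on (U c) (\<lambda>z. gc c z a b)"
proof -
  assume c: "c \<in> charts M"
  have "smooth_fun M (fst c) (\<lambda>y. g y (from_chart M c y a) (from_chart M c y b))"
    using metric c unfolding riemannian_metric_def by blast
  from smooth_on_chart[OF this c] show ?thesis by (simp add: gc_def)
qed

lemma gc_has_derivative:
  "c \<in> charts M \<Longrightarrow> z \<in> U c \<Longrightarrow> ((\<lambda>z. gc c z a b) has_derivative dgc c z a b) (at z)"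
  unfolding dgc_def by (rule smooth_on_has_derivative[OF open_chart smooth_on_gc])

lemma linear_dgc: "c \<in> charts M \<Longrightarrow> z \<in> U c \<Longrightarrow> linear (dgc c z a b)"
  using gc_has_derivative has_derivative_linear by blast

lemma dgc_sym:
  assumes c: "c \<in> charts M" "z \<in> U c"
  shows "dgc c z a b v = dgc c z b a v"
proof -
  have "((\<lambda>z. gc c z b a) has_derivative dgc c z a b) (at z)"
    by (rule has_derivative_transform_within_open[OF gc_has_derivative[OF c] open_chart[OF c(1)] c(2)])
      (rule inner_form_sym[OF inner_form_gc[OF c(1)]])
  then show ?thesis unfolding dgc_def[of c z b a] using frechet_derivativeI by metis
qed

lemma bilinear_dgc:
  assumes c: "c \<in> charts M" "z \<in> U c"
  shows "bilinear (\<lambda>a b. dgc c z a b v)"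
  by (rule bilinear_derivative_of_bilinear_family[OF open_chart[OF c(1)] c(2) bilinear_gc[OF c(1)] gc_has_derivative[OF c]])

lemma gc_gam:
  assumes c: "c \<in> charts M" "z \<in> U c"
  shows "gc c z (gam c z a b) e = 1/2 * (dgc c z b e a + dgc c z a e b - dgc c z a b e)"
proof -
  have "linear (\<lambda>e. 1/2 * (dgc c z b e a + dgc c z a e b - dgc c z a b e))"
    by (rule linearI) (simp_all add: bilinear_radd[OF bilinear_dgc[OF c]] bilinear_rmul[OF bilinear_dgc[OF c]]
        linear_add[OF linear_dgc[OF c]] linear_scale[OF linear_dgc[OF c]] algebra_simps)
  from covector_of_linear[OF this] show ?thesis
    unfolding gam_def raise_works[OF inner_form_gc[OF c]] .
qed

lemma gam_eqI:
  assumes c: "c \<in> charts M" "z \<in> U c"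
    and w: "\<And>e. gc c z w e = 1/2 * (dgc c z b e a + dgc c z a e b - dgc c z a b e)"
  shows "gam c z a b = w"
  by (rule inner_form_eqI[OF inner_form_gc[OF c]]) (simp add: gc_gam[OF c] w)

lemma gam_sym: "c \<in> charts M \<Longrightarrow> z \<in> U c \<Longrightarrow> gam c z a b = gam c z b a"
  by (rule gam_eqI) (auto simp: gc_gam dgc_sym[of c z a b])

lemma bilinear_gam:
  assumes c: "c \<in> charts M" "z \<in> U c"
  shows "bilinear (gam c z)"
proof -
  have *: "linear (\<lambda>a. gam c z a b)" for b
  proof (rule linearI; rule gam_eqI[OF c])
    fix a a' e and r :: real
    show "gc c z (gam c z a b + gam c z a' b) e = 1/2 * (dgc c z b e (a + a') + dgc c z (a + a') e b - dgc c z (a + a') b e)"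
      by (simp add: bilinear_ladd[OF bilinear_gc[OF c]] gc_gam[OF c] bilinear_ladd[OF bilinear_dgc[OF c]]
          linear_add[OF linear_dgc[OF c]] algebra_simps)
    show "gc c z (r *\<^sub>R gam c z a b) e = 1/2 * (dgc c z b e (r *\<^sub>R a) + dgc c z (r *\<^sub>R a) e b - dgc c z (r *\<^sub>R a) b e)"
      by (simp add: bilinear_lmul[OF bilinear_gc[OF c]] gc_gam[OF c] bilinear_lmul[OF bilinear_dgc[OF c]]
          linear_scale[OF linear_dgc[OF c]] algebra_simps)
  qed
  have "gam c z a = (\<lambda>b. gam c z b a)" for a using gam_sym[OF c] by blast
  then have "linear (gam c z a)" for a using * by metis
  with * show ?thesis by (simp add: bilinear_def)
qed

lemma smooth_on_gam:
  assumes c: "c \<in> charts M"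
  shows "smooth_on (U c) (\<lambda>z. gam c z a b)"
proof -
  have d: "smooth_on (U c) (\<lambda>z. dgc c z a b v)" for a b v
    unfolding dgc_def by (rule smooth_on_derivative[OF smooth_on_gc[OF c]])
  show ?thesis unfolding gam_def
    by (intro smooth_on_raise open_chart[OF c] inner_form_gc[OF c] smooth_on_gc[OF c] smooth_on_vec
        smooth_on_mult smooth_on_const smooth_on_add smooth_on_diff d)
qed

text \<open>Parallelism of the metric in coordinates: in the two instances of \<open>gc_gam\<close>
  the terms other than the derivative along \<open>v\<close> cancel.\<close>

lemma dgc_eq:
  assumes c: "c \<in> charts M" "z \<in> U c"
  shows "dgc c z a b v = gc c z (gam c z v a) b + gc c z a (gam c z v b)"
proof -
  have "gc c z a (gam c z v b) = gc c z (gam c z v b) a"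
    by (rule inner_form_sym[OF inner_form_gc[OF c]])
  then show ?thesis
    unfolding gc_gam[OF c] dgc_sym[OF c, of b a v] by argo
qed

lemma transition_second_derivative:
  assumes c: "c \<in> charts M" "d \<in> charts M" and y: "y \<in> fst c" "y \<in> fst d"
  defines "T2 \<equiv> \<lambda>a b. frechet_derivative (\<lambda>z. frechet_derivative (transition c d) (at z) b) (at (snd c y)) a"
  shows "((\<lambda>z. frechet_derivative (transition c d) (at z) b) has_derivative (\<lambda>a. T2 a b)) (at (snd c y))"
    and "T2 a b = T2 b a"
proof -
  have y': "snd c y \<in> snd c ` (fst c \<inter> fst d)" using y by blast
  show "((\<lambda>z. frechet_derivative (transition c d) (at z) b) has_derivative (\<lambda>a. T2 a b)) (at (snd c y))"
    unfolding T2_def using smooth_on_has_derivative[OF open_overlap smooth_on_derivative[OF smooth_transition] y', OF c c] .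
  show "T2 a b = T2 b a"
    unfolding T2_def by (rule symmetric_second_derivative[OF open_overlap y' smooth_transition]) (use c in auto)
qed

text \<open>Differentiating the transformation law of the metric produces terms with the Hessian
  \<open>T2\<close> of the transition, two for each of the three derivatives that define the
  Christoffel symbols. By symmetry of \<open>T2\<close> four of the six cancel, and the other two
  add up to the inhomogeneous term.\<close>

lemma gam_change:
  assumes c: "c \<in> charts M" "d \<in> charts M" and y: "y \<in> fst c" "y \<in> fst d"
  defines "T2 \<equiv> \<lambda>a b. frechet_derivative (\<lambda>z. frechet_derivative (transition c d) (at z) b) (at (snd c y)) a"
  shows "change c d y (gam c (snd c y) a b) = gam d (snd d y) (change c d y a) (change c d y b) + T2 a b"
proof -
  define z where "z = snd c y"
  define w where "w = snd d y"
  define T where "T = change c d y"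
  define O' where "O' = snd c ` (fst c \<inter> fst d)"
  define \<sigma> where "\<sigma> z = frechet_derivative (transition c d) (at z)" for z
  have zw: "z \<in> U c" "w \<in> U d" "z \<in> O'" using y by (auto simp: z_def w_def O'_def)
  have O': "open O'" unfolding O'_def using open_overlap c by blast
  have \<sigma>T: "\<sigma> z = T" by (simp add: \<sigma>_def T_def z_def change_def)
  have T2s: "T2 a b = T2 b a" for a b
    unfolding T2_def by (rule transition_second_derivative(2)[OF c y])
  have T2b: "((\<lambda>z. \<sigma> z b) has_derivative (\<lambda>a. T2 a b)) (at z)" for b
    unfolding \<sigma>_def T2_def z_def by (rule transition_second_derivative(1)[OF c y])
  have tw: "transition c d z = w" using c y by (simp add: z_def w_def)
  have gc: "gc c u a b = gc d (transition c d u) (\<sigma> u a) (\<sigma> u b)" if u: "u \<in> O'" for u a b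
  proof -
    obtain x where x: "x \<in> fst c" "x \<in> fst d" "u = snd c x" using u unfolding O'_def by blast
    then show ?thesis using c gc_chart from_chart_change[OF c x(1,2)]
      by (simp add: \<sigma>_def change_def[symmetric])
  qed
  have dgc: "dgc c z a b v = dgc d w (T a) (T b) (T v) + gc d w (T2 v a) (T b) + gc d w (T a) (T2 v b)" for a b v
  proof -
    have t: "(transition c d has_derivative T) (at z)"
      unfolding T_def z_def by (rule transition_has_derivative[OF c y])
    have g: "((\<lambda>u. gc d (transition c d u) a b) has_derivative (\<lambda>v. dgc d w a b (T v))) (at z)" for a b
      by (rule has_derivative_compose[OF t]) (simp add: tw gc_has_derivative[OF c(2) zw(2)])
    have b: "bilinear (gc d (transition c d u))" if "u \<in> O'" for u
      by (rule bilinear_gc[OF c(2)]) (use that c in \<open>auto simp: O'_def\<close>)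
    have "((\<lambda>u. gc d (transition c d u) (\<sigma> u a) (\<sigma> u b)) has_derivative
      (\<lambda>v. dgc d w (\<sigma> z a) (\<sigma> z b) (T v) + gc d (transition c d z) (T2 v a) (\<sigma> z b)
        + gc d (transition c d z) (\<sigma> z a) (T2 v b))) (at z)"
      by (rule has_derivative_bilinear_family[OF O' zw(3) b g T2b T2b])
    then have "((\<lambda>u. gc c u a b) has_derivative
      (\<lambda>v. dgc d w (T a) (T b) (T v) + gc d w (T2 v a) (T b) + gc d w (T a) (T2 v b))) (at z)"
      unfolding \<sigma>T tw by (rule has_derivative_transform_within_open[OF _ O' zw(3)]) (simp add: gc)
    from fun_cong[OF frechet_derivativeI[OF this], of v] show ?thesis by (simp only: dgc_def[of c])
  qed
  note bl = bilinear_gc[OF c(2) zw(2)]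
  have gcz: "gc c z a b = gc d w (T a) (T b)" for a b using gc[OF zw(3)] by (simp add: \<sigma>T tw)
  have "gc d w (T (gam c z a b)) e = gc d w (gam d w (T a) (T b) + T2 a b) e" for e
  proof -
    define f where "f = change d c y e"
    have e: "e = T f" using change_inverse[OF c(2,1) y(2,1)] by (simp add: f_def T_def)
    have s: "gc d w u v = gc d w v u" for u v by (rule inner_form_sym[OF inner_form_gc[OF c(2) zw(2)]])
    have "gc d w (T (gam c z a b)) e = 1/2 * (dgc c z b f a + dgc c z a f b - dgc c z a b f)"
      unfolding e gcz[symmetric] by (rule gc_gam[OF c(1) zw(1)])
    also have "\<dots> = 1/2 * (dgc d w (T b) e (T a) + dgc d w (T a) e (T b) - dgc d w (T a) (T b) e) + gc d w (T2 a b) e"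
      unfolding dgc e
      using s[of "T b" "T2 a f"] s[of "T a" "T2 b f"] T2s[of b a] T2s[of f a] T2s[of f b] by (simp add: algebra_simps)
    also have "\<dots> = gc d w (gam d w (T a) (T b)) e + gc d w (T2 a b) e"
      by (simp add: gc_gam[OF c(2) zw(2)])
    finally show ?thesis by (simp add: bilinear_ladd[OF bl])
  qed
  then show ?thesis unfolding T_def z_def w_def
    by (intro inner_form_eqI[OF inner_form_gc[OF c(2) zw(2)]]) (simp add: w_def)
qed

text \<open>\<open>raise_matrix\<close> identifies the index raising in \<open>gam\<close> with the
  inverse matrix in \<open>christoffel\<close>. After this the coordinate sums in the definition of
  the horizontal lift are replaced by the invariantly behaving bilinear map
  \<open>gam\<close>.\<close>

lemma hor_lift_eq:
  assumes x: "x \<in> points M"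
  shows "hor_lift M g (x, p) u = (u, \<chi> i. p \<bullet> gam (pref M x) (snd (pref M x) x) (axis i 1) u)"
proof -
  define c where "c = pref M x"
  define z where "z = snd c x"
  have c: "c \<in> charts M" "x \<in> fst c" using pref[OF x] c_def by auto
  have z: "z \<in> U c" using c z_def by auto
  have mc: "metric_coeff M g c = (\<lambda>w. \<chi> i j. gc c w (axis i 1) (axis j 1))"
    by (auto simp: metric_coeff_def gc_def)
  have mp: "metric_partial M g x l i j = dgc c z (axis i 1) (axis j 1) (axis l 1)" for l i j
    by (simp add: metric_partial_def c_def[symmetric] z_def[symmetric] mc dgc_def)
  have ch: "christoffel M g x k i j = gam c z (axis i 1) (axis j 1) $ k" for k i j
    unfolding christoffel_def gam_def raise_matrix[OF inner_form_gc[OF c(1) z]] c_def[symmetric] z_def[symmetric] mp mc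
    by (simp add: matrix_vector_mult_def sum_distrib_left)
  have "(\<Sum>h\<in>UNIV. \<Sum>j\<in>UNIV. p $ h * christoffel M g x h i j * u $ j) = p \<bullet> gam c z (axis i 1) u" for i
  proof -
    have l: "linear (\<lambda>u. p \<bullet> gam c z (axis i 1) u)"
      using bilinear_gam[OF c(1) z] by (auto simp: linear_iff bilinear_def inner_add_right)
    have "p \<bullet> gam c z (axis i 1) u = (\<Sum>j\<in>UNIV. (p \<bullet> gam c z (axis i 1) (axis j 1)) * u $ j)"
      using covector_of_linear[OF l, of u] by (simp add: inner_vec_def)
    also have "\<dots> = (\<Sum>j\<in>UNIV. \<Sum>h\<in>UNIV. p $ h * christoffel M g x h i j * u $ j)"
      by (simp add: ch inner_vec_def sum_distrib_right)
    also have "\<dots> = (\<Sum>h\<in>UNIV. \<Sum>j\<in>UNIV. p $ h * christoffel M g x h i j * u $ j)"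
      by (rule sum.swap)
    finally show ?thesis by (rule sym)
  qed
  then show ?thesis by (simp add: hor_lift_def c_def z_def)
qed

end

section \<open>The connection expressed by Christoffel symbols\<close>

locale levi_civita_manifold = riemannian M g for M :: "('a, real^'n) mfd" and g +
  fixes D :: "('a \<Rightarrow> real^'n) \<Rightarrow> ('a \<Rightarrow> real^'n) \<Rightarrow> 'a \<Rightarrow> real^'n"
  assumes D: "levi_civita M (points M) g D"
begin

abbreviation "VF \<equiv> vector_fields M (points M)"

abbreviation "drep c X z \<equiv> frechet_derivative (rep M c X) (at z)"

lemma D_field: "X \<in> VF \<Longrightarrow> Y \<in> VF \<Longrightarrow> D X Y \<in> VF"
  by (rule levi_civita_field[OF D])

lemma D_torsion: "X \<in> VF \<Longrightarrow> Y \<in> VF \<Longrightarrow> x \<in> points M \<Longrightarrow> lie_bracket M (points M) X Y x = D X Y x - D Y X x"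
  by (rule levi_civita_torsion[OF D, symmetric])

lemma D_metric: "X \<in> VF \<Longrightarrow> Y \<in> VF \<Longrightarrow> Z \<in> VF \<Longrightarrow> x \<in> points M \<Longrightarrow>
    dir_deriv M (points M) x (X x) (\<lambda>y. g y (Y y) (Z y)) = g x (D X Y x) (Z x) + g x (Y x) (D X Z x)"
  by (rule levi_civita_metric[OF D])

lemma smooth_on_metric_fields:
  assumes c: "c \<in> charts M" and Y: "Y \<in> VF" and Z: "Z \<in> VF"
  shows "smooth_on (U c) (\<lambda>w. g (inv_chart c w) (Y (inv_chart c w)) (Z (inv_chart c w)))"
proof (rule smooth_on_cong[OF open_chart[OF c]])
  show "smooth_on (U c) (\<lambda>w. gc c w (rep M c Y w) (rep M c Z w))"
    by (rule smooth_on_bilinear_family[OF open_chart bilinear_gc smooth_on_gc]) (use c Y Z field_smooth_on_rep in auto)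
  show "gc c w (rep M c Y w) (rep M c Z w) = g (inv_chart c w) (Y (inv_chart c w)) (Z (inv_chart c w))"
    if "w \<in> U c" for w using that c by (auto simp: gc_chart)
qed

lemma metric_fields_derivative:
  assumes x: "x \<in> points M" and Y: "Y \<in> VF" and Z: "Z \<in> VF"
  defines "c \<equiv> pref M x"
  defines "z \<equiv> snd c x"
  shows "dir_deriv M (points M) x v (\<lambda>y. g y (Y y) (Z y)) =
    dgc c z (Y x) (Z x) v + gc c z (drep c Y z v) (Z x) + gc c z (Y x) (drep c Z z v)"
proof -
  have c: "c \<in> charts M" "x \<in> fst c" using pref[OF x] c_def by auto
  have z: "z \<in> U c" using c z_def by auto
  have e: "gc c w (rep M c Y w) (rep M c Z w) = g (inv_chart c w) (Y (inv_chart c w)) (Z (inv_chart c w))"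
    if "w \<in> U c" for w using that c by (auto simp: gc_chart)
  have "((\<lambda>w. gc c w (rep M c Y w) (rep M c Z w)) has_derivative
      (\<lambda>v. dgc c z (rep M c Y z) (rep M c Z z) v + gc c z (drep c Y z v) (rep M c Z z) + gc c z (rep M c Y z) (drep c Z z v))) (at z)"
    by (rule has_derivative_bilinear_family[OF open_chart[OF c(1)] z bilinear_gc[OF c(1)] gc_has_derivative[OF c(1) z]
          rep_has_derivative[OF Y c(1) z] rep_has_derivative[OF Z c(1) z]])
  then have "((\<lambda>w. g (inv_chart c w) (Y (inv_chart c w)) (Z (inv_chart c w))) has_derivative
      (\<lambda>v. dgc c z (Y x) (Z x) v + gc c z (drep c Y z v) (Z x) + gc c z (Y x) (drep c Z z v))) (at z)"
    using has_derivative_transform_within_open[OF _ open_chart[OF c(1)] z e] c x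
    by (simp add: z_def c_def)
  from fun_cong[OF frechet_derivativeI[OF this], of v]
    dir_deriv_points[OF x, of "\<lambda>y. g y (Y y) (Z y)" v, folded c_def, OF smooth_on_metric_fields[OF c(1) Y Z], folded z_def]
  show ?thesis by simp
qed

text \<open>In the Koszul formula the derivatives of \<open>X\<close> and \<open>Z\<close> cancel
  against those in the brackets. What remains is twice the derivative of \<open>Y\<close> along
  \<open>X\<close> and the combination of derivatives of the metric that defines
  \<open>gam\<close>.\<close>

lemma D_pref:
  assumes x: "x \<in> points M" and X: "X \<in> VF" and Y: "Y \<in> VF"
  defines "c \<equiv> pref M x"
  defines "z \<equiv> snd c x"
  shows "D X Y x = drep c Y z (X x) + gam c z (X x) (Y x)"
proof -
  have c: "c \<in> charts M" "x \<in> fst c" using pref[OF x] c_def by auto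
  have z: "z \<in> U c" using c z_def by auto
  note fd = metric_fields_derivative[OF x, folded c_def, folded z_def]
  note lb = lie_bracket_points[OF x, folded c_def, folded z_def]
  note bg = bilinear_gc[OF c(1) z]
  have g: "g x a b = gc c z a b" for a b using x c by (simp add: gc_chart z_def c_def)
  have s: "gc c z a b = gc c z b a" for a b by (rule inner_form_sym[OF inner_form_gc[OF c(1) z]])
  have "g x (D X Y x) u = g x (drep c Y z (X x) + gam c z (X x) (Y x)) u" for u
  proof -
    obtain Z where Z: "Z \<in> VF" "Z x = u" using vector_field_through[OF hausdorff x] by blast
    have "2 * gc c z (D X Y x) u = 2 * gc c z (drep c Y z (X x)) u + 2 * gc c z (gam c z (X x) (Y x)) u"
      using levi_civita_koszul[OF D x inner_form_bilinear[OF inner_form_g[OF x]] inner_form_sym[OF inner_form_g[OF x]] X Y Z(1)]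
      unfolding fd[OF Y Z(1)] fd[OF X Z(1)] fd[OF X Y] lb[OF X Y] lb[OF X Z(1)] lb[OF Y Z(1)] Z(2) g
      by (simp add: bilinear_lsub[OF bg] gc_gam[OF c(1) z] s[of "X x"] s[of "Y x"])
    then show ?thesis by (simp add: g bilinear_ladd[OF bg])
  qed
  then show ?thesis by (rule inner_form_eqI[OF inner_form_g[OF x]])
qed

text \<open>Iterated covariant derivatives require the components of \<open>D X Y\<close> on a whole
  neighbourhood in one chart, while \<open>D_pref\<close> describes each point in its own chart. The
  Hessian of the transition that arises in differentiating the components of \<open>Y\<close>
  cancels the one in \<open>gam_change\<close>.\<close>

lemma D_chart:
  assumes c: "c \<in> charts M" and y: "y \<in> fst c" and X: "X \<in> VF" and Y: "Y \<in> VF"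
  shows "to_chart M c y (D X Y y) =
    drep c Y (snd c y) (to_chart M c y (X y)) + gam c (snd c y) (to_chart M c y (X y)) (to_chart M c y (Y y))"
proof -
  have yp: "y \<in> points M" using y c chart_subset by blast
  define d where "d = pref M y"
  have d: "d \<in> charts M" "y \<in> fst d" using pref[OF yp] d_def by auto
  define O' where "O' = snd d ` (fst d \<inter> fst c)"
  have O': "open O'" unfolding O'_def using open_overlap c d by blast
  define z where "z = snd d y"
  have z: "z \<in> O'" "z \<in> U d" using d y by (auto simp: z_def O'_def)
  define T where "T = change d c y"
  define \<sigma> where "\<sigma> z = frechet_derivative (transition d c) (at z)" for z
  have \<sigma>T: "\<sigma> z = T" by (simp add: \<sigma>_def T_def z_def change_def)
  define T2 where "T2 a b = frechet_derivative (\<lambda>z. frechet_derivative (transition d c) (at z) b) (at (snd d y)) a" for a b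
  have T2: "((\<lambda>z. \<sigma> z b) has_derivative (\<lambda>a. T2 a b)) (at z)" for b
    unfolding \<sigma>_def T2_def z_def by (rule transition_second_derivative(1)[OF d(1) c d(2) y])
  have T: "to_chart M c y = T" using y d c by (simp add: fun_eq_iff T_def to_chart_def d_def)
  have r: "rep M c Y (transition d c u) = \<sigma> u (rep M d Y u)" if u: "u \<in> O'" for u
  proof -
    obtain x where x: "x \<in> fst d" "x \<in> fst c" "u = snd d x" using u unfolding O'_def by blast
    then show ?thesis using c d change_to_chart[OF d(1) c x(1,2)]
      by (simp add: \<sigma>_def change_def[symmetric])
  qed
  have lin: "linear (\<sigma> u)" if "u \<in> O'" for u
    unfolding \<sigma>_def using smooth_on_linear_derivative[OF O' _ that] smooth_transition[OF d(1) c] by (simp add: O'_def)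
  have "((\<lambda>u. \<sigma> u (rep M d Y u)) has_derivative (\<lambda>h. T2 h (rep M d Y z) + \<sigma> z (drep d Y z h))) (at z)"
    by (rule has_derivative_linear_family[OF O' z(1) lin T2 rep_has_derivative[OF Y d(1) z(2)]])
  then have 1: "((\<lambda>u. rep M c Y (transition d c u)) has_derivative (\<lambda>h. T2 h (rep M d Y z) + \<sigma> z (drep d Y z h))) (at z)"
    by (rule has_derivative_transform_within_open[OF _ O' z(1)]) (simp add: r)
  have "((\<lambda>u. rep M c Y (transition d c u)) has_derivative (\<lambda>h. drep c Y (snd c y) (T h))) (at z)"
  proof (rule has_derivative_compose[where f = "transition d c" and g = "rep M c Y"
        and f' = T and g' = "drep c Y (snd c y)"])
    show "(transition d c has_derivative T) (at z)"
      unfolding T_def z_def by (rule transition_has_derivative[OF d(1) c d(2) y])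
    show "(rep M c Y has_derivative drep c Y (snd c y)) (at (transition d c z))"
      using rep_has_derivative[OF Y c, of "snd c y"] y d by (simp add: z_def)
  qed
  note e = has_derivative_unique[OF 1 this]
  have rY: "rep M d Y z = Y y" using d yp by (simp add: z_def) (simp add: d_def)
  have 2: "drep c Y (snd c y) (T h) = T2 h (Y y) + T (drep d Y z h)" for h
    using fun_cong[OF e, of h] by (simp add: rY \<sigma>T)
  have "T (D X Y y) = T (drep d Y z (X y)) + T (gam d z (X y) (Y y))"
    using D_pref[OF yp X Y, folded d_def, folded z_def] linear_add[OF lin[OF z(1)]] by (simp add: \<sigma>T)
  moreover have "T (gam d z (X y) (Y y)) = gam c (snd c y) (T (X y)) (T (Y y)) + T2 (X y) (Y y)"
    unfolding T_def z_def T2_def by (rule gam_change[OF d(1) c d(2) y])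
  ultimately show ?thesis unfolding T 2 by simp
qed

end

section \<open>Curvature in a chart\<close>

text \<open>The classical octahedron argument: the Bianchi identities for the four cyclic shifts of
  the arguments, combined with the two skew symmetries, leave only the claim.\<close>

lemma curvature_like_pair_symmetry:
  fixes R :: "'v \<Rightarrow> 'v \<Rightarrow> 'v \<Rightarrow> 'v \<Rightarrow> real"
  assumes 1: "\<And>a b e f. R a b e f = - R b a e f" and 2: "\<And>a b e f. R a b e f = - R a b f e"
    and 3: "\<And>a b e f. R a b e f + R b e a f + R e a b f = 0"
  shows "R a b e f = R e f a b"
  using 3[of a b e f] 3[of b e f a] 3[of e f a b] 3[of f a b e]
    1[of e a b f] 1[of f b e a] 2[of b e f a] 2[of e f b a] 1[of b f a e] 2[of b f e a] 2[of f a b e] 1[of a f b e]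
    2[of a b f e] 2[of e a b f] 1[of a e f b] 2[of a e f b] 2[of f b e a] 2[of f e a b] 1[of f e a b] 1[of b f e a] 2[of f a e b]
    2[of a f b e] 1[of f a e b] 1[of f a b e] 1[of e f b a] 2[of e a f b] 2[of b e a f] 1[of a e b f] 1[of e b f a]
  by argo

context levi_civita_manifold
begin

definition dgam :: "('a, real^'n) chart \<Rightarrow> real^'n \<Rightarrow> real^'n \<Rightarrow> real^'n \<Rightarrow> real^'n \<Rightarrow> real^'n" where
  "dgam c z a b v = frechet_derivative (\<lambda>z. gam c z a b) (at z) v"

text \<open>The coordinate expression of the curvature tensor. The last argument of
  \<open>dgam\<close> is the direction of differentiation, so \<open>dgam c z b e a\<close> is the
  derivative along \<open>a\<close> of \<open>gam\<close> at \<open>b\<close> and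
  \<open>e\<close>.\<close>

definition curv :: "('a, real^'n) chart \<Rightarrow> real^'n \<Rightarrow> real^'n \<Rightarrow> real^'n \<Rightarrow> real^'n \<Rightarrow> real^'n" where
  "curv c z a b e = dgam c z b e a - dgam c z a e b + gam c z a (gam c z b e) - gam c z b (gam c z a e)"

lemma gam_has_derivative:
  "c \<in> charts M \<Longrightarrow> z \<in> U c \<Longrightarrow> ((\<lambda>z. gam c z a b) has_derivative dgam c z a b) (at z)"
  unfolding dgam_def by (rule smooth_on_has_derivative[OF open_chart smooth_on_gam])

lemma bilinear_dgam:
  assumes c: "c \<in> charts M" "z \<in> U c"
  shows "bilinear (\<lambda>a b. dgam c z a b v)"
  by (rule bilinear_derivative_of_bilinear_family[OF open_chart[OF c(1)] c(2) bilinear_gam[OF c(1)] gam_has_derivative[OF c]])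

lemma dgam_sym:
  assumes c: "c \<in> charts M" "z \<in> U c"
  shows "dgam c z a b v = dgam c z b a v"
proof -
  have "((\<lambda>z. gam c z b a) has_derivative dgam c z a b) (at z)"
    by (rule has_derivative_transform_within_open[OF gam_has_derivative[OF c] open_chart[OF c(1)] c(2)])
      (rule gam_sym[OF c(1)])
  from fun_cong[OF has_derivative_unique[OF this gam_has_derivative[OF c]]] show ?thesis .
qed

lemma linear_curv:
  assumes c: "c \<in> charts M" "z \<in> U c"
  shows "linear (curv c z a b)"
  by (rule linearI) (simp_all add: curv_def bilinear_radd[OF bilinear_dgam[OF c]] bilinear_rmul[OF bilinear_dgam[OF c]]
      bilinear_radd[OF bilinear_gam[OF c]] bilinear_rmul[OF bilinear_gam[OF c]] algebra_simps)

lemma curv_antisym: "curv c z a b e = - curv c z b a e"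
  by (simp add: curv_def)

lemma curv_bianchi:
  assumes c: "c \<in> charts M" "z \<in> U c"
  shows "curv c z a b e + curv c z b e a + curv c z e a b = 0"
  unfolding curv_def
  by (simp add: dgam_sym[OF c, of e a] dgam_sym[OF c, of b a] dgam_sym[OF c, of e b]
      gam_sym[OF c, of e a] gam_sym[OF c, of b a] gam_sym[OF c, of e b])

text \<open>The metric coefficients have symmetric second derivatives. Computing these by using
  \<open>dgc_eq\<close> twice and comparing the two orders leaves exactly the curvature
  terms.\<close>

lemma curv_metric:
  assumes c: "c \<in> charts M" "z \<in> U c"
  shows "gc c z (curv c z a b e) f + gc c z e (curv c z a b f) = 0"
proof -
  have S: "frechet_derivative (\<lambda>w. frechet_derivative (\<lambda>w. gc c w e f) (at w) a) (at z) b =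
      gc c z (gam c z b (gam c z a e)) f + gc c z (gam c z a e) (gam c z b f) + gc c z (dgam c z a e b) f
      + gc c z (gam c z b e) (gam c z a f) + gc c z e (gam c z b (gam c z a f)) + gc c z e (dgam c z a f b)" for a b
  proof -
    note bf = has_derivative_bilinear_family[OF open_chart[OF c(1)] c(2) bilinear_gc[OF c(1)] gc_has_derivative[OF c]]
    have "((\<lambda>w. gc c w (gam c w a e) f + gc c w e (gam c w a f)) has_derivative
      (\<lambda>h. (dgc c z (gam c z a e) f h + gc c z (dgam c z a e h) f + gc c z (gam c z a e) 0)
         + (dgc c z e (gam c z a f) h + gc c z 0 (gam c z a f) + gc c z e (dgam c z a f h)))) (at z)"
      by (rule has_derivative_add[OF bf[OF _ gam_has_derivative[OF c] has_derivative_const]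
            bf[OF _ has_derivative_const gam_has_derivative[OF c]]])
    then have "((\<lambda>w. frechet_derivative (\<lambda>w. gc c w e f) (at w) a) has_derivative
      (\<lambda>h. (dgc c z (gam c z a e) f h + gc c z (dgam c z a e h) f + gc c z (gam c z a e) 0)
         + (dgc c z e (gam c z a f) h + gc c z 0 (gam c z a f) + gc c z e (dgam c z a f h)))) (at z)"
      by (rule has_derivative_transform_within_open[OF _ open_chart[OF c(1)] c(2)])
        (use dgc_eq[OF c(1)] in \<open>simp add: dgc_def\<close>)
    from fun_cong[OF frechet_derivativeI[OF this], of b] show ?thesis
      by (simp add: dgc_eq[OF c] bilinear_lzero[OF bilinear_gc[OF c]] bilinear_rzero[OF bilinear_gc[OF c]])
  qed
  have "frechet_derivative (\<lambda>w. frechet_derivative (\<lambda>w. gc c w e f) (at w) a) (at z) b =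
      frechet_derivative (\<lambda>w. frechet_derivative (\<lambda>w. gc c w e f) (at w) b) (at z) a"
    by (rule symmetric_second_derivative[OF open_chart[OF c(1)] c(2) smooth_on_gc[OF c(1)]])
  then show ?thesis unfolding S
    by (simp add: curv_def bilinear_ladd[OF bilinear_gc[OF c]] bilinear_radd[OF bilinear_gc[OF c]]
        bilinear_lsub[OF bilinear_gc[OF c]] bilinear_rsub[OF bilinear_gc[OF c]])
qed

lemma curv_pair_symmetry:
  assumes c: "c \<in> charts M" "z \<in> U c"
  shows "gc c z (curv c z a b e) f = gc c z (curv c z e f a) b"
proof (rule curvature_like_pair_symmetry[of "\<lambda>a b e f. gc c z (curv c z a b e) f"])
  fix a b e f
  note bl = bilinear_gc[OF c]
  show "gc c z (curv c z a b e) f = - gc c z (curv c z b a e) f"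
    by (subst curv_antisym) (rule bilinear_lneg[OF bl])
  show "gc c z (curv c z a b e) f = - gc c z (curv c z a b f) e"
    using curv_metric[OF c, of a b e f] inner_form_sym[OF inner_form_gc[OF c], of e] by simp
  show "gc c z (curv c z a b e) f + gc c z (curv c z b e a) f + gc c z (curv c z e a b) f = 0"
    using curv_bianchi[OF c, of a b e] by (metis bilinear_ladd[OF bl] bilinear_lzero[OF bl])
qed

text \<open>Torsion-freeness writes the bracket as a difference of two covariant derivatives, which
  are smooth fields by assumption. This avoids transforming the coordinate formula of the bracket
  between charts.\<close>

lemma lie_bracket_field:
  assumes X: "X \<in> VF" and Y: "Y \<in> VF"
  shows "lie_bracket M (points M) X Y \<in> VF"
proof (rule vector_fields_pointsI)
  fix q assume q: "q \<in> points M"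
  obtain c where c: "c \<in> charts M" "q \<in> fst c" using pref[OF q] by blast
  have "smooth_on (U c) (rep M c (lie_bracket M (points M) X Y))"
  proof (rule smooth_on_cong[OF open_chart[OF c(1)]])
    show "smooth_on (U c) (\<lambda>z. rep M c (D X Y) z - rep M c (D Y X) z)"
      by (intro smooth_on_diff open_chart field_smooth_on_rep D_field c X Y)
    show "rep M c (D X Y) z - rep M c (D Y X) z = rep M c (lie_bracket M (points M) X Y) z" if z: "z \<in> U c" for z
    proof -
      obtain y where y: "y \<in> fst c" "z = snd c y" using z by blast
      then have "y \<in> points M" using c chart_subset by blast
      then show ?thesis
        using y c D_torsion[OF X Y] linear_diff[OF linear_to_chart[OF c(1) y(1)]] by simp
    qed
  qed
  then show "\<exists>c\<in>charts M. q \<in> fst c \<and> smooth_on (U c) (rep M c (lie_bracket M (points M) X Y))"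
    using c by blast
qed

text \<open>Differentiating the formula of \<open>D_chart\<close> produces second derivatives of
  \<open>Z\<close>, which cancel by symmetry, and first derivatives of the fields, which cancel in
  pairs or against the bracket term. Only the values of the three fields at \<open>x\<close>
  survive.\<close>

lemma curvature_fields:
  assumes x: "x \<in> points M" and X: "X \<in> VF" and Y: "Y \<in> VF" and Z: "Z \<in> VF"
  defines "c \<equiv> pref M x"
  defines "z \<equiv> snd c x"
  shows "D X (D Y Z) x - D Y (D X Z) x - D (lie_bracket M (points M) X Y) Z x = curv c z (X x) (Y x) (Z x)"
proof -
  have c: "c \<in> charts M" "x \<in> fst c" using pref[OF x] c_def by auto
  have z: "z \<in> U c" using c z_def by auto
  have r: "rep M c V z = V x" for V using c x by (simp add: z_def) (simp add: c_def)
  note Dp = D_pref[OF x, folded c_def, folded z_def]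
  define S where "S v a = frechet_derivative (\<lambda>w. drep c Z w a) (at z) v" for v a
  have S: "((\<lambda>w. drep c Z w a) has_derivative (\<lambda>v. S v a)) (at z)" for a
    unfolding S_def by (rule smooth_on_has_derivative[OF open_chart[OF c(1)]
          smooth_on_derivative[OF field_smooth_on_rep[OF Z c(1)]] z])
  have S_sym: "S v a = S a v" for a v
    unfolding S_def by (rule symmetric_second_derivative[OF open_chart[OF c(1)] z field_smooth_on_rep[OF Z c(1)]])
  have lin: "linear (drep c V w)" if "V \<in> VF" "w \<in> U c" for V w
    using has_derivative_linear[OF rep_has_derivative[OF that(1) c(1) that(2)]] .
  note bg = bilinear_gam[OF c(1) z]
  have d: "drep c (D V Z) z v = S v (V x) + drep c Z z (drep c V z v) + dgam c z (V x) (Z x) v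
      + gam c z (drep c V z v) (Z x) + gam c z (V x) (drep c Z z v)" if V: "V \<in> VF" for V v
  proof -
    have e: "drep c Z w (rep M c V w) + gam c w (rep M c V w) (rep M c Z w) = rep M c (D V Z) w" if w: "w \<in> U c" for w
    proof -
      obtain y where y: "y \<in> fst c" "w = snd c y" using w by blast
      then show ?thesis using D_chart[OF c(1) y(1) V Z] c by simp
    qed
    have "((\<lambda>w. drep c Z w (rep M c V w) + gam c w (rep M c V w) (rep M c Z w)) has_derivative
      (\<lambda>v. (S v (rep M c V z) + drep c Z z (drep c V z v)) + (dgam c z (rep M c V z) (rep M c Z z) v
      + gam c z (drep c V z v) (rep M c Z z) + gam c z (rep M c V z) (drep c Z z v)))) (at z)"
      by (intro has_derivative_add has_derivative_linear_family[OF open_chart[OF c(1)] z lin[OF Z] S]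
          has_derivative_bilinear_family[OF open_chart[OF c(1)] z bilinear_gam[OF c(1)] gam_has_derivative[OF c(1) z]]
          rep_has_derivative V Z c z)
    from has_derivative_transform_within_open[OF this open_chart[OF c(1)] z e]
    have "(rep M c (D V Z) has_derivative
      (\<lambda>v. (S v (rep M c V z) + drep c Z z (drep c V z v)) + (dgam c z (rep M c V z) (rep M c Z z) v
      + gam c z (drep c V z v) (rep M c Z z) + gam c z (rep M c V z) (drep c Z z v)))) (at z)" by simp
    from fun_cong[OF frechet_derivativeI[OF this], of v] show ?thesis by (simp add: r)
  qed
  have L: "lie_bracket M (points M) X Y x = drep c Y z (X x) - drep c X z (Y x)"
    using lie_bracket_points[OF x X Y] by (simp add: c_def z_def)
  show ?thesis
    unfolding Dp[OF X D_field[OF Y Z]] Dp[OF Y D_field[OF X Z]] Dp[OF lie_bracket_field[OF X Y] Z] Dp[OF Y Z] Dp[OF X Z]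
      d[OF X] d[OF Y] L S_sym[of "Y x"] linear_diff[OF lin[OF Z z]] curv_def bilinear_lsub[OF bg] bilinear_radd[OF bg]
    by (simp add: algebra_simps)
qed

text \<open>The definite description ranges over all fields with the given values.
  \<open>curvature_fields\<close> shows that they all give the same result, and fields through
  prescribed values exclude any other candidate.\<close>

lemma curvature_eq:
  assumes x: "x \<in> points M"
  shows "curvature M D x u v w = curv (pref M x) (snd (pref M x) x) u v w"
proof -
  obtain X Y Z where F: "X \<in> VF" "X x = u" "Y \<in> VF" "Y x = v" "Z \<in> VF" "Z x = w"
    using vector_field_through[OF hausdorff x] by metis
  show ?thesis
    unfolding curvature_def
  proof (rule the_equality)
    show "\<forall>X\<in>VF. \<forall>Y\<in>VF. \<forall>Z\<in>VF. X x = u \<and> Y x = v \<and> Z x = w \<longrightarrow>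
        curv (pref M x) (snd (pref M x) x) u v w =
        D X (D Y Z) x - D Y (D X Z) x - D (lie_bracket M (points M) X Y) Z x"
      using curvature_fields[OF x] by metis
    show "r = curv (pref M x) (snd (pref M x) x) u v w"
      if r: "\<forall>X\<in>VF. \<forall>Y\<in>VF. \<forall>Z\<in>VF. X x = u \<and> Y x = v \<and> Z x = w \<longrightarrow>
        r = D X (D Y Z) x - D Y (D X Z) x - D (lie_bracket M (points M) X Y) Z x" for r
      using r[rule_format, OF F(1,3,5)] F(2,4,6) curvature_fields[OF x F(1,3,5)] by simp
  qed
qed

lemma linear_curvature: "x \<in> points M \<Longrightarrow> linear (curvature M D x u v)"
proof -
  assume x: "x \<in> points M"
  have "curvature M D x u v = curv (pref M x) (snd (pref M x) x) u v"
    by (rule ext) (rule curvature_eq[OF x])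
  then show "linear (curvature M D x u v)" using linear_curv pref[OF x] by simp
qed

lemma gc_pref: "x \<in> points M \<Longrightarrow> gc (pref M x) (snd (pref M x) x) = g x"
  using pref gc_chart by (intro ext) simp

lemma curvature_skew: "x \<in> points M \<Longrightarrow> g x (curvature M D x u v w) w' = - g x w (curvature M D x u v w')"
  using curv_metric[of "pref M x" "snd (pref M x) x" u v w w'] pref[of x] by (simp add: curvature_eq gc_pref)

lemma curvature_pair_symmetry:
  "x \<in> points M \<Longrightarrow> g x (curvature M D x u v w) w' = g x (curvature M D x w w' u) v"
  using curv_pair_symmetry[of "pref M x" "snd (pref M x) x" u v w w'] pref[of x] by (simp add: curvature_eq gc_pref)

lemma curvature_antisym: "x \<in> points M \<Longrightarrow> curvature M D x u v w = - curvature M D x v u w"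
  by (simp add: curvature_eq) (rule curv_antisym)

section \<open>One-forms and their dual vector fields\<close>

lemma covec_to_chart_inner:
  assumes "c \<in> charts M" "x \<in> fst c"
  shows "covec_to_chart M c x \<omega> \<bullet> v = \<omega> \<bullet> from_chart M c x v"
  unfolding covec_to_chart_def
  by (rule covector_of_linear) (use linear_from_chart[OF assms] in \<open>auto simp: linear_iff inner_add_right\<close>)

lemma covec_to_chart_pref [simp]: "x \<in> points M \<Longrightarrow> covec_to_chart M (pref M x) x \<omega> = \<omega>"
  using pref by (intro covector_eqI) (simp add: covec_to_chart_inner)

lemma covec_to_chart_to_chart:
  "c \<in> charts M \<Longrightarrow> x \<in> fst c \<Longrightarrow> covec_to_chart M c x \<omega> \<bullet> to_chart M c x v = \<omega> \<bullet> v"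
  by (simp add: covec_to_chart_inner)

lemma to_chart_raise:
  assumes c: "c \<in> charts M" "x \<in> fst c"
  shows "to_chart M c x (raise (g x) \<omega>) = raise (gc c (snd c x)) (covec_to_chart M c x \<omega>)"
proof -
  have x: "x \<in> points M" using c chart_subset by blast
  have "gc c (snd c x) (to_chart M c x (raise (g x) \<omega>)) u = covec_to_chart M c x \<omega> \<bullet> u" for u
    using c by (simp add: gc_chart covec_to_chart_inner raise_works[OF inner_form_g[OF x]])
  then show ?thesis
    using raise_eqI[OF inner_form_gc[OF c(1)]] c by (metis imageI)
qed

text \<open>The one-form with its index raised. It lets derivatives of forms be computed as
  covariant derivatives of vector fields.\<close>

definition dual_field :: "('a \<Rightarrow> real^'n) \<Rightarrow> 'a \<Rightarrow> real^'n" where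
  "dual_field \<omega> x = raise (g x) (\<omega> x)"

definition form_rep :: "('a, real^'n) chart \<Rightarrow> ('a \<Rightarrow> real^'n) \<Rightarrow> real^'n \<Rightarrow> real^'n" where
  "form_rep c \<omega> z = covec_to_chart M c (inv_chart c z) (\<omega> (inv_chart c z))"

lemma smooth_on_form_rep:
  assumes "\<omega> \<in> one_forms M" "c \<in> charts M"
  shows "smooth_on (U c) (form_rep c \<omega>)"
  unfolding form_rep_def
  by (rule smooth_on_chart[of "fst c" "\<lambda>y. covec_to_chart M c y (\<omega> y)"]) (use assms in \<open>auto simp: one_forms_def\<close>)

lemma form_rep_chart [simp]: "c \<in> charts M \<Longrightarrow> x \<in> fst c \<Longrightarrow> form_rep c \<omega> (snd c x) = covec_to_chart M c x (\<omega> x)"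
  by (simp add: form_rep_def)

lemma rep_dual_field:
  assumes c: "c \<in> charts M" and z: "z \<in> U c"
  shows "rep M c (dual_field \<omega>) z = raise (gc c z) (form_rep c \<omega> z)"
proof -
  obtain x where "x \<in> fst c" "z = snd c x" using z by blast
  then show ?thesis using c by (simp add: dual_field_def to_chart_raise)
qed

lemma dual_field: assumes \<omega>: "\<omega> \<in> one_forms M" shows "dual_field \<omega> \<in> VF"
proof (rule vector_fields_pointsI)
  fix q assume "q \<in> points M"
  then obtain c where c: "c \<in> charts M" "q \<in> fst c" using pref by blast
  have "smooth_on (U c) (\<lambda>z. raise (gc c z) (form_rep c \<omega> z))"
    by (intro smooth_on_raise open_chart inner_form_gc smooth_on_gc smooth_on_form_rep c \<omega>)
  then have "smooth_on (U c) (rep M c (dual_field \<omega>))"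
    by (rule smooth_on_cong[OF open_chart[OF c(1)], rotated]) (simp add: rep_dual_field c)
  then show "\<exists>c\<in>charts M. q \<in> fst c \<and> smooth_on (U c) (rep M c (dual_field \<omega>))" using c by blast
qed

text \<open>The index of a vector field through the raised covector is lowered again, so no second
  bump construction is needed.\<close>

lemma one_form_through:
  assumes x: "x \<in> points M"
  obtains \<omega> where "\<omega> \<in> one_forms M" "\<omega> x = \<eta>"
proof -
  obtain Z where Z: "Z \<in> VF" "Z x = raise (g x) \<eta>" using vector_field_through[OF hausdorff x] by blast
  define \<omega> where "\<omega> y = (\<chi> i. g y (Z y) (axis i 1))" for y
  have \<omega>: "\<omega> y \<bullet> u = g y (Z y) u" if "y \<in> points M" for y u
    unfolding \<omega>_def by (rule covector_of_linear)
      (use inner_form_bilinear[OF inner_form_g[OF that]] in \<open>simp add: bilinear_def\<close>)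
  have "smooth_fun M (fst c) (\<lambda>y. covec_to_chart M c y (\<omega> y))" if c: "c \<in> charts M" for c
  proof (rule smooth_funI)
    fix q assume q: "q \<in> fst c"
    have "smooth_on (U c) (\<lambda>z. \<chi> i. gc c z (rep M c Z z) (axis i 1))"
      by (intro smooth_on_vec smooth_on_bilinear_family[OF open_chart[OF c] bilinear_gc[OF c] smooth_on_gc[OF c]]
          smooth_on_const open_chart field_smooth_on_rep c Z)
    moreover have "covec_to_chart M c y (\<omega> y) = (\<chi> i. gc c (snd c y) (rep M c Z (snd c y)) (axis i 1))"
      if y: "y \<in> fst c" for y
    proof -
      have "y \<in> points M" using y c chart_subset by blast
      then show ?thesis using y c by (simp add: covec_to_chart_def \<omega> gc_chart)
    qed
    ultimately have "extends_at (fst c) c q (\<lambda>y. covec_to_chart M c y (\<omega> y)) (\<lambda>z. \<chi> i. gc c z (rep M c Z z) (axis i 1))"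
      unfolding extends_at_def using q open_chart[OF c] by (intro exI[of _ "U c"]) auto
    then show "\<exists>d\<in>charts M. q \<in> fst d \<and> (\<exists>F. extends_at (fst c) d q (\<lambda>y. covec_to_chart M c y (\<omega> y)) F)"
      using c q by blast
  qed
  then have "\<omega> \<in> one_forms M" by (simp add: one_forms_def)
  moreover have "\<omega> x = \<eta>"
    by (rule covector_eqI) (simp add: \<omega>[OF x] Z raise_works[OF inner_form_g[OF x]])
  ultimately show thesis using that by blast
qed

text \<open>Metricity says that covariant differentiation commutes with raising the index; fields
  through arbitrary vectors make the covector of the definition unique.\<close>

lemma covd_form_eq:
  assumes x: "x \<in> points M" and X: "X \<in> VF" and \<theta>: "\<theta> \<in> one_forms M"
  shows "covd_form M D X \<theta> x \<bullet> u = g x (D X (dual_field \<theta>) x) u"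
proof -
  have fl: "(\<chi> i. g x w (axis i 1)) \<bullet> u = g x w u" for w u
    by (rule covector_of_linear) (use inner_form_bilinear[OF inner_form_g[OF x]] in \<open>simp add: bilinear_def\<close>)
  have e: "dir_deriv M (points M) x (X x) (\<lambda>y. \<theta> y \<bullet> Y y) - \<theta> x \<bullet> D X Y x = g x (D X (dual_field \<theta>) x) (Y x)"
    if Y: "Y \<in> VF" for Y
  proof -
    have "dir_deriv M (points M) x (X x) (\<lambda>y. \<theta> y \<bullet> Y y) =
        dir_deriv M (points M) x (X x) (\<lambda>y. g y (dual_field \<theta> y) (Y y))"
      by (rule dir_deriv_cong) (simp add: dual_field_def raise_works[OF inner_form_g])
    then show ?thesis
      using D_metric[OF X dual_field[OF \<theta>] Y x] by (simp add: dual_field_def raise_works[OF inner_form_g[OF x]])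
  qed
  have "covd_form M D X \<theta> x = (\<chi> i. g x (D X (dual_field \<theta>) x) (axis i 1))"
    unfolding covd_form_def
  proof (rule the_equality)
    show "\<forall>Y\<in>VF. (\<chi> i. g x (D X (dual_field \<theta>) x) (axis i 1)) \<bullet> Y x =
        dir_deriv M (points M) x (X x) (\<lambda>y. \<theta> y \<bullet> Y y) - \<theta> x \<bullet> D X Y x"
      using e by (simp add: fl)
    fix \<eta> assume \<eta>: "\<forall>Y\<in>VF. \<eta> \<bullet> Y x = dir_deriv M (points M) x (X x) (\<lambda>y. \<theta> y \<bullet> Y y) - \<theta> x \<bullet> D X Y x"
    show "\<eta> = (\<chi> i. g x (D X (dual_field \<theta>) x) (axis i 1))"
    proof (rule covector_eqI)
      fix u
      obtain Y where "Y \<in> VF" "Y x = u" using vector_field_through[OF hausdorff x] by blast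
      then show "\<eta> \<bullet> u = (\<chi> i. g x (D X (dual_field \<theta>) x) (axis i 1)) \<bullet> u"
        using \<eta> e by (metis fl)
    qed
  qed
  then show ?thesis by (simp add: fl)
qed

end

locale kaehler = levi_civita_manifold M g D for M :: "('a, real^'n) mfd" and g D +
  fixes J :: "'a \<Rightarrow> real^'n \<Rightarrow> real^'n"
  assumes J: "almost_complex_structure M J"
    and J_isometry: "x \<in> points M \<Longrightarrow> g x (J x u) (J x v) = g x u v"
    and J_parallel: "X \<in> vector_fields M (points M) \<Longrightarrow> Y \<in> vector_fields M (points M) \<Longrightarrow> x \<in> points M \<Longrightarrow>
      D X (\<lambda>y. J y (Y y)) x = J x (D X Y x)"
begin

section \<open>The complex structure as a skew endomorphism of the tangent spaces\<close>

lemma linear_J: "x \<in> points M \<Longrightarrow> linear (J x)"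
  and J_J [simp]: "x \<in> points M \<Longrightarrow> J x (J x u) = - u"
  using J by (auto simp: almost_complex_structure_def)

lemma J_skew: "x \<in> points M \<Longrightarrow> g x (J x u) v = - g x u (J x v)"
  using J_isometry[of x u "J x v"] by (simp add: bilinear_rneg[OF inner_form_bilinear[OF inner_form_g]])

lemma J_field:
  assumes Y: "Y \<in> VF"
  shows "(\<lambda>y. J y (Y y)) \<in> VF"
proof (rule vector_fields_pointsI)
  fix q assume "q \<in> points M"
  then obtain c where c: "c \<in> charts M" "q \<in> fst c" using pref by blast
  define j where "j z v = to_chart M c (inv_chart c z) (J (inv_chart c z) (from_chart M c (inv_chart c z) v))" for z v
  have lin: "linear (j z)" if z: "z \<in> U c" for z
  proof -
    obtain y where y: "y \<in> fst c" "z = snd c y" using z by blast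
    then have "y \<in> points M" using c chart_subset by blast
    then show ?thesis
      using y c linear_to_chart[OF c(1) y(1)] linear_from_chart[OF c(1) y(1)] linear_J
      by (simp add: j_def[abs_def] linear_iff)
  qed
  have "smooth_fun M (fst c) (\<lambda>y. to_chart M c y (J y (from_chart M c y v)))" for v
    using J c by (simp add: almost_complex_structure_def)
  from smooth_on_chart[OF this c(1)] have jv: "smooth_on (U c) (\<lambda>z. j z v)" for v by (simp add: j_def)
  have "smooth_on (U c) (\<lambda>z. j z (rep M c Y z))"
    by (rule smooth_on_linear_family[OF open_chart[OF c(1)] lin jv field_smooth_on_rep[OF Y c(1)]])
  then have "smooth_on (U c) (rep M c (\<lambda>y. J y (Y y)))"
    by (rule smooth_on_cong[OF open_chart[OF c(1)], rotated]) (use c in \<open>auto simp: j_def\<close>)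
  then show "\<exists>c\<in>charts M. q \<in> fst c \<and> smooth_on (U c) (rep M c (\<lambda>y. J y (Y y)))" using c by blast
qed

end

section \<open>The cotangent bundle\<close>

lemma smooth_on_fst_compose:
  fixes f :: "'e::euclidean_space \<Rightarrow> 'b::real_normed_vector"
  assumes "open A" "smooth_on A f"
  shows "smooth_on (A \<times> (UNIV :: 'd::euclidean_space set)) (\<lambda>q. f (fst q))"
proof (rule smooth_on_compose[OF _ assms(1) _ _ assms(2)])
  show o: "open (A \<times> (UNIV :: 'd set))" using assms(1) by (simp add: open_Times)
  show "smooth_on (A \<times> (UNIV :: 'd set)) fst"
    using smooth_on_fst[OF o smooth_on_ident[OF o]] by simp
qed auto

lemma smooth_on_snd_ident:
  assumes "open A"
  shows "smooth_on (A \<times> (UNIV :: 'd::euclidean_space set)) (\<lambda>q::'e::euclidean_space \<times> 'd. snd q)"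
proof -
  have o: "open (A \<times> (UNIV :: 'd set))" using assms by (simp add: open_Times)
  show ?thesis by (rule smooth_on_snd[OF o smooth_on_ident[OF o]])
qed

lemma has_derivative_fst_compose:
  assumes "(f has_derivative f') (at (fst q))"
  shows "((\<lambda>q. f (fst q)) has_derivative (\<lambda>h. f' (fst h))) (at q)"
  by (rule has_derivative_compose[OF has_derivative_fst[OF has_derivative_ident] assms])

lemma has_derivative_snd_ident: "(snd has_derivative snd) (at q)"
  by (rule has_derivative_snd[OF has_derivative_ident])

context levi_civita_manifold
begin

definition covec_from_chart :: "('a, real^'n) chart \<Rightarrow> 'a \<Rightarrow> real^'n \<Rightarrow> real^'n" where
  "covec_from_chart c x \<pi> = covec_comp \<pi> (to_chart M c x)"

abbreviation "CB \<equiv> cotangent_bundle M"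

abbreviation "cc \<equiv> cotangent_chart M"

section \<open>Induced charts on the cotangent bundle\<close>

lemma covec_from_chart_inner:
  "c \<in> charts M \<Longrightarrow> x \<in> fst c \<Longrightarrow> covec_from_chart c x \<pi> \<bullet> v = \<pi> \<bullet> to_chart M c x v"
  unfolding covec_from_chart_def by (rule covec_comp_inner[OF linear_to_chart])

lemma covec_to_from_chart [simp]:
  "c \<in> charts M \<Longrightarrow> x \<in> fst c \<Longrightarrow> covec_to_chart M c x (covec_from_chart c x \<pi>) = \<pi>"
  by (rule covector_eqI) (simp add: covec_to_chart_inner covec_from_chart_inner)

lemma covec_from_to_chart [simp]:
  "c \<in> charts M \<Longrightarrow> x \<in> fst c \<Longrightarrow> covec_from_chart c x (covec_to_chart M c x p) = p"
  by (rule covector_eqI) (simp add: covec_to_chart_inner covec_from_chart_inner)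

lemma fst_cc [simp]: "fst (cc c) = fst c \<times> UNIV"
  and snd_cc [simp]: "snd (cc c) (x, p) = (snd c x, covec_to_chart M c x p)"
  by (simp_all add: cotangent_chart_def)

lemma charts_CB: "charts CB = cc ` charts M"
  and pref_CB [simp]: "pref CB (x, p) = cc (pref M x)"
  by (simp_all add: cotangent_bundle_def)

lemma points_CB: "points CB = points M \<times> UNIV"
  by (auto simp: points_def charts_CB)

lemma inj_cc: "c \<in> charts M \<Longrightarrow> inj_on (snd (cc c)) (fst (cc c))"
proof (rule inj_onI)
  fix q q' assume c: "c \<in> charts M" and "q \<in> fst (cc c)" "q' \<in> fst (cc c)" "snd (cc c) q = snd (cc c) q'"
  moreover obtain x p x' p' where "q = (x, p)" "q' = (x', p')" by (cases q, cases q')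
  ultimately show "q = q'"
    using inj_onD[OF inj_chart[OF c], of x x'] covec_from_to_chart[OF c] by (metis fst_cc mem_Sigma_iff snd_cc prod.inject)
qed

lemma image_cc:
  assumes c: "c \<in> charts M" and A: "A \<subseteq> fst c"
  shows "snd (cc c) ` (A \<times> UNIV) = (snd c ` A) \<times> UNIV"
proof (intro equalityI subsetI)
  fix q assume "q \<in> (snd c ` A) \<times> (UNIV :: (real^'n) set)"
  then obtain x \<pi> where x: "x \<in> A" "q = (snd c x, \<pi>)" by auto
  then have "q = snd (cc c) (x, covec_from_chart c x \<pi>)" using c A by (simp add: subset_iff)
  then show "q \<in> snd (cc c) ` (A \<times> UNIV)" using x by blast
qed auto

lemma inv_cc:
  assumes c: "c \<in> charts M" "x \<in> fst c"
  shows "inv_chart (cc c) (snd c x, \<pi>) = (x, covec_from_chart c x \<pi>)"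
  unfolding inv_chart_def by (rule inv_into_f_eq[OF inj_cc[OF c(1)]]) (use c in auto)

lemma overlap_cc:
  "c \<in> charts M \<Longrightarrow> d \<in> charts M \<Longrightarrow>
    snd (cc c) ` (fst (cc c) \<inter> fst (cc d)) = (snd c ` (fst c \<inter> fst d)) \<times> UNIV"
  using image_cc[of c "fst c \<inter> fst d"] by (simp add: Times_Int_distrib1[symmetric] Sigma_Int_distrib1[symmetric])

text \<open>An explicit form of the induced transition. Covectors transform contragrediently, so the
  fibre coordinates are composed with the derivative of the opposite transition, taken at the image
  point.\<close>

definition cc_transition :: "('a, real^'n) chart \<Rightarrow> ('a, real^'n) chart \<Rightarrow> (real^'n) \<times> (real^'n) \<Rightarrow> (real^'n) \<times> (real^'n)" where
  "cc_transition c d q = (transition c d (fst q),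
     \<chi> i. snd q \<bullet> frechet_derivative (transition d c) (at (transition c d (fst q))) (axis i 1))"

lemma transition_cc:
  assumes c: "c \<in> charts M" "d \<in> charts M" and q: "q \<in> (snd c ` (fst c \<inter> fst d)) \<times> UNIV"
  shows "transition (cc c) (cc d) q = cc_transition c d q"
proof -
  obtain x \<pi> where x: "x \<in> fst c" "x \<in> fst d" "q = (snd c x, \<pi>)" using q by auto
  have "covec_to_chart M d x (covec_from_chart c x \<pi>) = (\<chi> i. \<pi> \<bullet> change d c x (axis i 1))"
    by (simp add: covec_to_chart_def covec_from_chart_inner[OF c(1) x(1)] to_chart_from_chart[OF c(2,1) x(2,1)])
  then show ?thesis
    using c x by (simp add: transition_def[of "cc c"] inv_cc cc_transition_def change_def)
qed

lemma smooth_on_transition_derivative: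
  assumes c: "c \<in> charts M" "d \<in> charts M"
  shows "smooth_on (snd c ` (fst c \<inter> fst d)) (\<lambda>z. frechet_derivative (transition d c) (at (transition c d z)) v)"
proof (rule smooth_on_compose[OF open_overlap[OF c] open_overlap[OF c(2,1)] _ smooth_transition[OF c]])
  show "transition c d ` snd c ` (fst c \<inter> fst d) \<subseteq> snd d ` (fst d \<inter> fst c)" using c by auto
  show "smooth_on (snd d ` (fst d \<inter> fst c)) (\<lambda>z. frechet_derivative (transition d c) (at z) v)"
    by (rule smooth_on_derivative[OF smooth_transition[OF c(2,1)]])
qed

lemma smooth_on_cc_transition:
  assumes c: "c \<in> charts M" "d \<in> charts M"
  shows "smooth_on ((snd c ` (fst c \<inter> fst d)) \<times> UNIV) (cc_transition c d)"
proof -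
  have o: "open ((snd c ` (fst c \<inter> fst d)) \<times> (UNIV :: (real^'n) set))"
    using open_overlap[OF c] by (simp add: open_Times)
  show ?thesis unfolding cc_transition_def[abs_def]
    by (intro smooth_on_Pair smooth_on_vec smooth_on_inner o smooth_on_snd_ident open_overlap c
        smooth_on_fst_compose[OF open_overlap[OF c] smooth_transition[OF c]]
        smooth_on_fst_compose[OF open_overlap[OF c] smooth_on_transition_derivative[OF c]])
qed

sublocale CB: atlas CB
proof
  fix C D' assume "C \<in> charts CB" "D' \<in> charts CB"
  then obtain c d where c: "C = cc c" "c \<in> charts M" and d: "D' = cc d" "d \<in> charts M"
    unfolding charts_CB by blast
  show "inj_on (snd C) (fst C)" using inj_cc c by blast
  show "open (snd C ` (fst C \<inter> fst D'))"
    unfolding c d overlap_cc[OF c(2) d(2)] by (rule open_Times[OF open_overlap[OF c(2) d(2)] open_UNIV])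
  show "smooth_on (snd C ` (fst C \<inter> fst D')) (transition C D')"
    unfolding c d overlap_cc[OF c(2) d(2)]
    by (rule smooth_on_cong[OF open_Times[OF open_overlap[OF c(2) d(2)] open_UNIV] _ smooth_on_cc_transition[OF c(2) d(2)]])
      (rule transition_cc[OF c(2) d(2), symmetric])
next
  fix q assume "q \<in> points CB"
  then show "pref CB q \<in> charts CB \<and> q \<in> fst (pref CB q)"
    using pref by (cases q) (auto simp: points_CB charts_CB)
qed

lemma cc_chart: "c \<in> charts M \<Longrightarrow> cc c \<in> charts CB"
  by (simp add: charts_CB)

text \<open>The Jacobian acting on the fibre coordinates moves with the base point; its derivative
  contributes the Hessian term, which makes the fibre components of a vector depend on its base
  component.\<close>

lemma change_cc:
  assumes c: "c \<in> charts M" "d \<in> charts M" and x: "x \<in> fst c" "x \<in> fst d"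
  defines "T2 \<equiv> \<lambda>a v. frechet_derivative (\<lambda>z. frechet_derivative (transition d c) (at z) v) (at (snd d x)) a"
  shows "fst (change (cc c) (cc d) (x, p) w) = change c d x (fst w)"
    and "snd (change (cc c) (cc d) (x, p) w) \<bullet> v =
      snd w \<bullet> change d c x v + covec_to_chart M c x p \<bullet> T2 (change c d x (fst w)) v"
proof -
  define \<pi> where "\<pi> = covec_to_chart M c x p"
  define \<sigma> where "\<sigma> z = frechet_derivative (transition d c) (at z)" for z
  define q where "q = (snd c x, \<pi>)"
  have q: "q \<in> (snd c ` (fst c \<inter> fst d)) \<times> UNIV" using x by (auto simp: q_def)
  have \<sigma>x: "\<sigma> (snd d x) = change d c x" by (simp add: \<sigma>_def change_def)
  have T2: "((\<lambda>z. \<sigma> z v) has_derivative (\<lambda>a. T2 a v)) (at (snd d x))" for v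
    unfolding \<sigma>_def T2_def by (rule transition_second_derivative(1)[OF c(2,1) x(2,1)])
  have t: "(transition c d has_derivative change c d x) (at (fst q))"
    unfolding q_def fst_conv by (rule transition_has_derivative[OF c x])
  have "((\<lambda>z. \<sigma> (transition c d z) v) has_derivative (\<lambda>a. T2 (change c d x a) v)) (at (fst q))" for v
    by (rule has_derivative_compose[OF t]) (use T2 c x in \<open>simp add: q_def\<close>)
  then have s: "((\<lambda>q. \<sigma> (transition c d (fst q)) v) has_derivative (\<lambda>h. T2 (change c d x (fst h)) v)) (at q)" for v
    by (rule has_derivative_fst_compose)
  have "(cc_transition c d has_derivative (\<lambda>h. (change c d x (fst h),
      \<chi> i. snd q \<bullet> T2 (change c d x (fst h)) (axis i 1) + snd h \<bullet> \<sigma> (transition c d (fst q)) (axis i 1)))) (at q)"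
    unfolding cc_transition_def[abs_def] \<sigma>_def[symmetric]
    by (intro has_derivative_Pair has_derivative_fst_compose[OF t] has_derivative_vec
        has_derivative_inner[OF has_derivative_snd_ident s])
  then have D1: "(cc_transition c d has_derivative (\<lambda>h. (change c d x (fst h),
      \<chi> i. \<pi> \<bullet> T2 (change c d x (fst h)) (axis i 1) + snd h \<bullet> change d c x (axis i 1)))) (at q)"
    using c x by (simp add: q_def \<sigma>x)
  have "(transition (cc c) (cc d) has_derivative (\<lambda>h. (change c d x (fst h),
      \<chi> i. \<pi> \<bullet> T2 (change c d x (fst h)) (axis i 1) + snd h \<bullet> change d c x (axis i 1)))) (at q)"
    by (rule has_derivative_transform_within_open[OF D1 open_Times[OF open_overlap[OF c] open_UNIV] q
          transition_cc[OF c, symmetric]])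
  from fun_cong[OF frechet_derivativeI[OF this], of w]
  have e: "change (cc c) (cc d) (x, p) w = (change c d x (fst w),
      \<chi> i. \<pi> \<bullet> T2 (change c d x (fst w)) (axis i 1) + snd w \<bullet> change d c x (axis i 1))"
    by (simp add: change_def[of "cc c"] q_def \<pi>_def)
  show "fst (change (cc c) (cc d) (x, p) w) = change c d x (fst w)" by (simp add: e)
  \<comment> \<open>A derivative is linear in its direction, the first argument of
    \<open>T2\<close>. Linearity in the second argument is obtained through symmetry.\<close>
  have sym: "T2 a b = T2 b a" for a b
    unfolding T2_def by (rule transition_second_derivative(2)[OF c(2,1) x(2,1)])
  have "linear (\<lambda>v. T2 a v)" for a
    unfolding sym[of a] using has_derivative_linear[OF T2] by blast
  then have "linear (\<lambda>v. \<pi> \<bullet> T2 (change c d x (fst w)) v + snd w \<bullet> change d c x v)"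
    using linear_change[OF c(2,1) x(2,1)] by (auto simp: linear_iff inner_add_right algebra_simps)
  from covector_of_linear[OF this]
  show "snd (change (cc c) (cc d) (x, p) w) \<bullet> v =
      snd w \<bullet> change d c x v + covec_to_chart M c x p \<bullet> T2 (change c d x (fst w)) v"
    by (simp add: e \<pi>_def)
qed

section \<open>Lifts in induced charts\<close>

lemma fst_hor_lift [simp]: "fst (hor_lift M g (x, p) u) = u"
  by (simp add: hor_lift_def)

lemma snd_hor_lift: "x \<in> points M \<Longrightarrow> snd (hor_lift M g (x, p) u) \<bullet> v = p \<bullet> gam (pref M x) (snd (pref M x) x) v u"
proof -
  assume x: "x \<in> points M"
  have "linear (\<lambda>v. p \<bullet> gam (pref M x) (snd (pref M x) x) v u)"
    using bilinear_gam[of "pref M x" "snd (pref M x) x"] pref[OF x]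
    by (auto simp: linear_iff bilinear_def inner_add_right)
  from covector_of_linear[OF this, of v] show ?thesis by (simp add: hor_lift_eq[OF x])
qed

text \<open>\<open>hor_rep\<close> and \<open>tan_rep\<close> give the components of lifted fields
  in an induced chart. They are defined for all fibre coordinates, not only unit ones, and thus
  provide the smooth extensions off the unit bundle that the calculus on it requires.\<close>

definition hor_rep :: "('a, real^'n) chart \<Rightarrow> ('a \<Rightarrow> real^'n) \<Rightarrow> (real^'n) \<times> (real^'n) \<Rightarrow> (real^'n) \<times> (real^'n)" where
  "hor_rep c X q = (rep M c X (fst q), \<chi> i. snd q \<bullet> gam c (fst q) (axis i 1) (rep M c X (fst q)))"

definition tan_rep :: "('a, real^'n) chart \<Rightarrow> ('a \<Rightarrow> real^'n) \<Rightarrow> (real^'n) \<times> (real^'n) \<Rightarrow> (real^'n) \<times> (real^'n)" where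
  "tan_rep c \<omega> q = (0, form_rep c \<omega> (fst q) - (snd q \<bullet> rep M c (dual_field \<omega>) (fst q)) *\<^sub>R snd q)"

text \<open>The Hessian term added by \<open>change_cc\<close> is exactly the inhomogeneous term of
  \<open>gam_change\<close>, so the same formula with Christoffel symbols holds in every induced
  chart.\<close>

lemma hor_lift_chart:
  assumes c: "c \<in> charts M" "x \<in> fst c"
  shows "to_chart CB (cc c) (x, p) (hor_lift M g (x, p) u) =
    (to_chart M c x u, \<chi> i. covec_to_chart M c x p \<bullet> gam c (snd c x) (axis i 1) (to_chart M c x u))"
proof -
  have x: "x \<in> points M" using c chart_subset by blast
  define d where "d = pref M x"
  have d: "d \<in> charts M" "x \<in> fst d" using pref[OF x] d_def by auto
  define T where "T = change d c x"
  define T2 where "T2 a v = frechet_derivative (\<lambda>z. frechet_derivative (transition c d) (at z) v) (at (snd c x)) a" for a v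
  have T: "to_chart M c x u = T u" by (simp add: T_def to_chart_def d_def)
  have \<pi>: "covec_to_chart M c x p \<bullet> w = p \<bullet> change c d x w" for w
    using covec_to_chart_inner[OF c] by (simp add: from_chart_def d_def)
  have tc: "to_chart CB (cc c) (x, p) w = change (cc d) (cc c) (x, p) w" for w by (simp add: to_chart_def d_def)
  have cd: "covec_to_chart M d x p = p" using x d_def by simp
  have inv: "change c d x (T u) = u" unfolding T_def by (rule change_inverse[OF d(1) c(1) d(2) c(2)])
  have sym: "T2 a b = T2 b a" for a b
    unfolding T2_def by (rule transition_second_derivative(2)[OF c(1) d(1) c(2) d(2)])
  have "snd (to_chart CB (cc c) (x, p) (hor_lift M g (x, p) u)) \<bullet> v = covec_to_chart M c x p \<bullet> gam c (snd c x) v (T u)" for v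
  proof -
    have "snd (to_chart CB (cc c) (x, p) (hor_lift M g (x, p) u)) \<bullet> v =
        p \<bullet> gam d (snd d x) (change c d x v) u + p \<bullet> T2 (T u) v"
      unfolding tc change_cc(2)[OF d(1) c(1) d(2) c(2)] snd_hor_lift[OF x] cd
      by (simp add: T_def T2_def d_def[symmetric])
    also have "\<dots> = p \<bullet> change c d x (gam c (snd c x) v (T u))"
      unfolding gam_change[OF c(1) d(1) c(2) d(2)] inv T2_def[symmetric] sym[of "T u"]
      by (simp add: inner_add_right)
    finally show ?thesis by (simp add: \<pi>)
  qed
  then have "snd (to_chart CB (cc c) (x, p) (hor_lift M g (x, p) u)) =
      (\<chi> i. covec_to_chart M c x p \<bullet> gam c (snd c x) (axis i 1) (T u))"
    by (simp add: vec_eq_iff) (metis cart_eq_inner_axis)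
  moreover have "fst (to_chart CB (cc c) (x, p) (hor_lift M g (x, p) u)) = T u"
    unfolding tc change_cc(1)[OF d(1) c(1) d(2) c(2)] by (simp add: T_def)
  ultimately show ?thesis unfolding T by (metis prod.collapse)
qed

text \<open>The Hessian term of \<open>change_cc\<close> vanishes because the base component is
  zero.\<close>

lemma ver_lift_chart:
  assumes c: "c \<in> charts M" "x \<in> fst c"
  shows "to_chart CB (cc c) (x, p) (ver_lift \<omega>) = (0, covec_to_chart M c x \<omega>)"
proof -
  have x: "x \<in> points M" using c chart_subset by blast
  define d where "d = pref M x"
  have d: "d \<in> charts M" "x \<in> fst d" using pref[OF x] d_def by auto
  have tc: "to_chart CB (cc c) (x, p) w = change (cc d) (cc c) (x, p) w" for w by (simp add: to_chart_def d_def)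
  have z: "change d c x 0 = 0" by (rule linear_0[OF linear_change[OF d(1) c(1) d(2) c(2)]])
  have "frechet_derivative (\<lambda>z. frechet_derivative (transition c d) (at z) v) (at (snd c x)) 0 = 0" for v
    by (rule linear_0[OF has_derivative_linear[OF transition_second_derivative(1)[OF c(1) d(1) c(2) d(2)]]])
  then have "snd (to_chart CB (cc c) (x, p) (ver_lift \<omega>)) \<bullet> v = covec_to_chart M c x \<omega> \<bullet> v" for v
    unfolding tc change_cc(2)[OF d(1) c(1) d(2) c(2)]
    using covec_to_chart_inner[OF c] by (simp add: ver_lift_def z from_chart_def d_def[symmetric])
  then have "snd (to_chart CB (cc c) (x, p) (ver_lift \<omega>)) = covec_to_chart M c x \<omega>" by (rule covector_eqI)
  moreover have "fst (to_chart CB (cc c) (x, p) (ver_lift \<omega>)) = 0"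
    unfolding tc change_cc(1)[OF d(1) c(1) d(2) c(2)] by (simp add: ver_lift_def z)
  ultimately show ?thesis by (metis prod.collapse)
qed

lemma ginv_eq: "x \<in> points M \<Longrightarrow> ginv g x \<omega> \<theta> = \<theta> \<bullet> raise (g x) \<omega>"
  by (simp add: ginv_def sharp_eq_raise raise_works'[OF inner_form_g])

lemma ginv_sym: "x \<in> points M \<Longrightarrow> ginv g x \<omega> \<theta> = ginv g x \<theta> \<omega>"
  by (simp add: ginv_def inner_form_sym[OF inner_form_g])

lemma tan_lift_eq: "x \<in> points M \<Longrightarrow> tan_lift g (x, p) \<omega> = ver_lift (\<omega> - (p \<bullet> raise (g x) \<omega>) *\<^sub>R p)"
  by (simp add: tan_lift_def ver_lift_def ginv_eq)

lemma hor_field_chart: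
  assumes c: "c \<in> charts M" "x \<in> fst c"
  shows "to_chart CB (cc c) (x, p) (hor_field M g X (x, p)) = hor_rep c X (snd (cc c) (x, p))"
  using c by (simp add: hor_field_def hor_lift_chart hor_rep_def)

lemma tan_field_chart:
  assumes c: "c \<in> charts M" "x \<in> fst c"
  shows "to_chart CB (cc c) (x, p) (tan_field g \<omega> (x, p)) = tan_rep c \<omega> (snd (cc c) (x, p))"
proof -
  have x: "x \<in> points M" using c chart_subset by blast
  have "covec_to_chart M c x (\<omega> x - r *\<^sub>R p) = covec_to_chart M c x (\<omega> x) - r *\<^sub>R covec_to_chart M c x p" for r
    by (rule covector_eqI) (simp add: covec_to_chart_inner[OF c] inner_diff_left)
  then show ?thesis
    using c by (simp add: tan_field_def tan_lift_eq[OF x] ver_lift_chart tan_rep_def covec_to_chart_to_chart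
        dual_field_def)
qed

lemma smooth_on_hor_rep:
  assumes c: "c \<in> charts M" and X: "X \<in> VF"
  shows "smooth_on (U c \<times> UNIV) (hor_rep c X)"
proof -
  note o = open_chart[OF c]
  have "smooth_on (U c) (\<lambda>z. gam c z (axis i 1) (rep M c X z))" for i
    by (rule smooth_on_bilinear_family[OF o bilinear_gam[OF c] smooth_on_gam[OF c] smooth_on_const field_smooth_on_rep[OF X c]])
  then show ?thesis unfolding hor_rep_def[abs_def]
    by (intro smooth_on_Pair smooth_on_vec smooth_on_inner open_Times o open_UNIV smooth_on_snd_ident
        smooth_on_fst_compose[OF o field_smooth_on_rep[OF X c]] smooth_on_fst_compose[OF o])
qed

lemma smooth_on_tan_rep:
  assumes c: "c \<in> charts M" and \<omega>: "\<omega> \<in> one_forms M"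
  shows "smooth_on (U c \<times> UNIV) (tan_rep c \<omega>)"
  unfolding tan_rep_def[abs_def]
  by (intro smooth_on_Pair smooth_on_const smooth_on_diff smooth_on_scaleR smooth_on_inner open_Times open_chart[OF c] open_UNIV
        smooth_on_snd_ident smooth_on_fst_compose[OF open_chart[OF c] smooth_on_form_rep[OF \<omega> c]]
        smooth_on_fst_compose[OF open_chart[OF c] field_smooth_on_rep[OF dual_field[OF \<omega>] c]])

lemma hor_rep_has_derivative:
  assumes c: "c \<in> charts M" and X: "X \<in> VF" and z: "z \<in> U c"
  shows "(hor_rep c X has_derivative (\<lambda>h. (drep c X z (fst h),
    \<chi> i. \<pi> \<bullet> (dgam c z (axis i 1) (rep M c X z) (fst h) + gam c z (axis i 1) (drep c X z (fst h)))
       + snd h \<bullet> gam c z (axis i 1) (rep M c X z)))) (at (z, \<pi>))"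
proof -
  note o = open_chart[OF c]
  have r: "(rep M c X has_derivative drep c X z) (at (fst (z, \<pi>)))"
    using rep_has_derivative[OF X c z] by simp
  have "((\<lambda>w. gam c w (axis i 1) (rep M c X w)) has_derivative
      (\<lambda>h. dgam c z (axis i 1) (rep M c X z) h + gam c z 0 (rep M c X z) + gam c z (axis i 1) (drep c X z h))) (at z)" for i
    by (rule has_derivative_bilinear_family[OF o z bilinear_gam[OF c] gam_has_derivative[OF c z]
          has_derivative_const rep_has_derivative[OF X c z]])
  then have g: "((\<lambda>w. gam c w (axis i 1) (rep M c X w)) has_derivative
      (\<lambda>h. dgam c z (axis i 1) (rep M c X z) h + gam c z (axis i 1) (drep c X z h))) (at (fst (z, \<pi>)))" for i
    by (simp add: bilinear_lzero[OF bilinear_gam[OF c z]])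
  show ?thesis unfolding hor_rep_def[abs_def]
    using has_derivative_Pair[OF has_derivative_fst_compose[OF r]
      has_derivative_vec[OF has_derivative_inner[OF has_derivative_snd_ident has_derivative_fst_compose[OF g]]]]
    by simp
qed

definition dform :: "('a, real^'n) chart \<Rightarrow> ('a \<Rightarrow> real^'n) \<Rightarrow> real^'n \<Rightarrow> real^'n \<Rightarrow> real^'n" where
  "dform c \<omega> z = frechet_derivative (form_rep c \<omega>) (at z)"

text \<open>Obtained by differentiating \<omega>(e) = g(V,e) with V the dual field, which brings in
  the derivative of V and the Christoffel terms needed to assemble its covariant derivative.\<close>

lemma dform_inner:
  assumes c: "c \<in> charts M" and \<omega>: "\<omega> \<in> one_forms M" and z: "z \<in> U c"
  defines "V \<equiv> rep M c (dual_field \<omega>)"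
  shows "dform c \<omega> z a \<bullet> e = gc c z (gam c z a (V z)) e + gc c z (V z) (gam c z a e)
    + gc c z (drep c (dual_field \<omega>) z a) e"
proof -
  note o = open_chart[OF c]
  have "((\<lambda>w. gc c w (V w) e) has_derivative
      (\<lambda>h. dgc c z (V z) e h + gc c z (drep c (dual_field \<omega>) z h) e + gc c z (V z) 0)) (at z)"
    unfolding V_def by (rule has_derivative_bilinear_family[OF o z bilinear_gc[OF c] gc_has_derivative[OF c z]
          rep_has_derivative[OF dual_field[OF \<omega>] c z] has_derivative_const])
  then have 1: "((\<lambda>w. form_rep c \<omega> w \<bullet> e) has_derivative
      (\<lambda>h. dgc c z (V z) e h + gc c z (drep c (dual_field \<omega>) z h) e + gc c z (V z) 0)) (at z)"
    by (rule has_derivative_transform_within_open[OF _ o z])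
      (simp add: V_def rep_dual_field[OF c] raise_works[OF inner_form_gc[OF c]])
  have "((\<lambda>w. form_rep c \<omega> w \<bullet> e) has_derivative (\<lambda>h. dform c \<omega> z h \<bullet> e)) (at z)"
    unfolding dform_def
    by (rule bounded_linear.has_derivative[OF bounded_linear_inner_left
        smooth_on_has_derivative[OF o smooth_on_form_rep[OF \<omega> c] z]])
  from fun_cong[OF has_derivative_unique[OF this 1], of a] show ?thesis
    by (simp add: dgc_eq[OF c z] bilinear_rzero[OF bilinear_gc[OF c z]])
qed

lemma tan_rep_has_derivative:
  assumes c: "c \<in> charts M" and \<omega>: "\<omega> \<in> one_forms M" and z: "z \<in> U c"
  defines "V \<equiv> dual_field \<omega>"
  shows "(tan_rep c \<omega> has_derivative (\<lambda>h. (0, dform c \<omega> z (fst h)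
     - ((\<pi> \<bullet> rep M c V z) *\<^sub>R snd h + (\<pi> \<bullet> drep c V z (fst h) + snd h \<bullet> rep M c V z) *\<^sub>R \<pi>)))) (at (z, \<pi>))"
proof -
  have r: "(rep M c V has_derivative drep c V z) (at (fst (z, \<pi>)))"
    unfolding V_def using rep_has_derivative[OF dual_field[OF \<omega>] c z] by simp
  have f: "(form_rep c \<omega> has_derivative dform c \<omega> z) (at (fst (z, \<pi>)))"
    unfolding dform_def using smooth_on_has_derivative[OF open_chart[OF c] smooth_on_form_rep[OF \<omega> c] z] by simp
  show ?thesis unfolding tan_rep_def[abs_def] V_def[symmetric]
    using has_derivative_Pair[OF has_derivative_const has_derivative_diff[OF has_derivative_fst_compose[OF f]
      has_derivative_scaleR[OF has_derivative_inner[OF has_derivative_snd_ident has_derivative_fst_compose[OF r]]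
        has_derivative_snd_ident]]]
    by simp
qed

section \<open>The unit cotangent bundle\<close>

abbreviation "UB \<equiv> unit_cotangent_bundle M g"

lemma UB_iff: "(x, p) \<in> UB \<longleftrightarrow> x \<in> points M \<and> p \<bullet> raise (g x) p = 1"
  by (auto simp: unit_cotangent_bundle_def ginv_eq)

definition sqnorm :: "('a, real^'n) chart \<Rightarrow> (real^'n) \<times> (real^'n) \<Rightarrow> real" where
  "sqnorm c q = snd q \<bullet> raise (gc c (fst q)) (snd q)"

lemma sqnorm_chart:
  "c \<in> charts M \<Longrightarrow> x \<in> fst c \<Longrightarrow> sqnorm c (snd (cc c) (x, p)) = p \<bullet> raise (g x) p"
  by (simp add: sqnorm_def to_chart_raise[symmetric] covec_to_chart_to_chart)

lemma smooth_on_raise_chart: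
  assumes c: "c \<in> charts M"
  shows "smooth_on (U c \<times> UNIV) (\<lambda>q. raise (gc c (fst q)) (snd q))"
  by (rule smooth_on_raise[OF open_Times[OF open_chart[OF c] open_UNIV] inner_form_gc[OF c]
        smooth_on_fst_compose[OF open_chart[OF c] smooth_on_gc[OF c]] smooth_on_snd_ident[OF open_chart[OF c]]]) auto

lemma smooth_on_sqnorm:
  assumes c: "c \<in> charts M"
  shows "smooth_on (U c \<times> UNIV) (sqnorm c)"
  unfolding sqnorm_def[abs_def]
  by (intro smooth_on_inner open_Times open_chart[OF c] open_UNIV smooth_on_snd_ident smooth_on_raise_chart[OF c])

text \<open>The minus sign is that of the derivative of an inverse: lengthening vectors shortens
  covectors.\<close>

lemma sqnorm_has_derivative:
  assumes c: "c \<in> charts M" and z: "z \<in> U c"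
  defines "s \<equiv> \<lambda>\<pi>. raise (gc c z) \<pi>"
  shows "(sqnorm c has_derivative (\<lambda>h. 2 * (snd h \<bullet> s \<pi>) - dgc c z (s \<pi>) (s \<pi>) (fst h))) (at (z, \<pi>))"
proof -
  define q where "q = (z, \<pi>)"
  have q: "q \<in> U c \<times> UNIV" using z by (simp add: q_def)
  note o = open_Times[OF open_chart[OF c] open_UNIV]
  define s' where "s' = frechet_derivative (\<lambda>q. raise (gc c (fst q)) (snd q)) (at q)"
  have s': "((\<lambda>q. raise (gc c (fst q)) (snd q)) has_derivative s') (at q)"
    unfolding s'_def by (rule smooth_on_has_derivative[OF o smooth_on_raise_chart[OF c] q])
  note i = inner_form_gc[OF c]
  \<comment> \<open>Implicit differentiation of g(s,e) = \<pi>(e), where s is the raised covector;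
    the matrix formula for \<open>raise\<close> is not differentiated.\<close>
  have k: "dgc c z (s \<pi>) e (fst h) + gc c z (s' h) e = snd h \<bullet> e" for h e
  proof -
    have g: "((\<lambda>q. gc c (fst q) a b) has_derivative (\<lambda>h. dgc c z a b (fst h))) (at q)" for a b
      by (rule has_derivative_fst_compose) (simp add: q_def gc_has_derivative[OF c z])
    have b: "bilinear (gc c (fst q))" if "q \<in> U c \<times> UNIV" for q :: "(real^'n) \<times> (real^'n)"
      using bilinear_gc[OF c] that by auto
    have 1: "((\<lambda>q. gc c (fst q) (raise (gc c (fst q)) (snd q)) e) has_derivative
        (\<lambda>h. dgc c z (s \<pi>) e (fst h) + gc c z (s' h) e + gc c z (s \<pi>) 0)) (at q)"
      using has_derivative_bilinear_family[where f = "\<lambda>q. gc c (fst q)" and Y = "\<lambda>_. e", OF o q b g s' has_derivative_const]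
      by (simp add: q_def s_def)
    have 2: "((\<lambda>q. snd q \<bullet> e) has_derivative (\<lambda>h. snd h \<bullet> e)) (at q)"
      by (rule bounded_linear.has_derivative[OF bounded_linear_inner_left has_derivative_snd_ident])
    have "((\<lambda>q. gc c (fst q) (raise (gc c (fst q)) (snd q)) e) has_derivative (\<lambda>h. snd h \<bullet> e)) (at q)"
      by (rule has_derivative_transform_within_open[OF 2 o q]) (auto simp: raise_works[OF i])
    from fun_cong[OF has_derivative_unique[OF 1 this], of h] show ?thesis
      by (simp add: bilinear_rzero[OF bilinear_gc[OF c z]])
  qed
  have "(sqnorm c has_derivative (\<lambda>h. snd q \<bullet> s' h + snd h \<bullet> raise (gc c (fst q)) (snd q))) (at q)"
    unfolding sqnorm_def[abs_def] by (rule has_derivative_inner[OF has_derivative_snd_ident s'])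
  moreover have "\<pi> \<bullet> s' h + snd h \<bullet> s \<pi> = 2 * (snd h \<bullet> s \<pi>) - dgc c z (s \<pi>) (s \<pi>) (fst h)" for h
    using k[of "s \<pi>" h] raise_works'[OF i[OF z], of "s' h" \<pi>] by (simp add: s_def inner_commute)
  ultimately show ?thesis by (simp add: q_def s_def)
qed

text \<open>Along the unit bundle the constant function 1 has two extensions, the constant and
  \<open>sqnorm c\<close>. As derivatives along tangent vectors do not depend on the extension, that
  of \<open>sqnorm c\<close> vanishes.\<close>

lemma UB_tangent_imp:
  assumes q: "(x, p) \<in> UB" and w: "w \<in> tangent_space CB UB (x, p)"
  defines "s \<equiv> raise (g x) p"
  shows "2 * (snd w \<bullet> s) = dgc (pref M x) (snd (pref M x) x) s s (fst w)"
proof -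
  define c where "c = pref M x"
  have x: "x \<in> points M" using q UB_iff by blast
  have c: "c \<in> charts M" "x \<in> fst c" using pref[OF x] c_def by auto
  have z: "snd c x \<in> U c" using c by blast
  have pr: "pref CB (x, p) = cc c" by (simp add: c_def)
  have sc: "snd (cc c) (x, p) = (snd c x, p)" using x by (simp add: c_def)
  have e: "1 = sqnorm c (snd (cc c) y)" if "y \<in> UB \<inter> fst (cc c)" for y
    using that by (cases y) (auto simp: sqnorm_chart[OF c(1)] UB_iff simp del: snd_cc)
  have "extends_at UB (pref CB (x, p)) (x, p) (\<lambda>y. 1) (sqnorm c)"
    unfolding extends_at_def pr
  proof (intro exI[of _ "U c \<times> UNIV"] conjI ballI impI)
    show "open (U c \<times> (UNIV :: (real^'n) set))" by (rule open_Times[OF open_chart[OF c(1)] open_UNIV])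
    show "snd (cc c) (x, p) \<in> U c \<times> UNIV" unfolding sc using z by simp
  qed (rule smooth_on_sqnorm[OF c(1)], rule e)
  from dir_deriv_eq[OF w this] has_dir_deriv_imp_dir_deriv[OF has_dir_deriv_const[of CB UB "(x, p)" w "1::real"] w]
  have "frechet_derivative (sqnorm c) (at (snd c x, p)) w = 0" unfolding pr sc by simp
  then show ?thesis
    using fun_cong[OF frechet_derivativeI[OF sqnorm_has_derivative[OF c(1) z, of p]], of w]
    by (simp add: s_def c_def gc_pref[OF x])
qed

text \<open>With \<open>UB_tangent_imp\<close> this identifies the tangent space with the kernel of
  the differential of the squared norm.\<close>

lemma UB_tangentI:
  assumes q: "(x, p) \<in> UB"
  defines "s \<equiv> raise (g x) p"
  assumes w: "2 * (snd w \<bullet> s) = dgc (pref M x) (snd (pref M x) x) s s (fst w)"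
  shows "w \<in> tangent_space CB UB (x, p)"
proof -
  define c where "c = pref M x"
  have x: "x \<in> points M" using q UB_iff by blast
  have c: "c \<in> charts M" "x \<in> fst c" using pref[OF x] c_def by auto
  define z where "z = snd c x"
  have z: "z \<in> U c" using c z_def by blast
  have pr: "pref CB (x, p) = cc c" by (simp add: c_def)
  have sc: "snd (cc c) (x, p) = (z, p)" using x by (simp add: c_def z_def)
  \<comment> \<open>The curve is a straight line in the chart, projected radially in each fibre.\<close>
  define l where "l t = (z, p) + t *\<^sub>R w" for t
  define N where "N t = sqnorm c (l t)" for t
  have sl: "smooth_on T l" if "open T" for T
    unfolding l_def[abs_def] by (intro smooth_on_add smooth_on_scaleR smooth_on_ident smooth_on_const that)
  have N0: "N 0 = 1" using sqnorm_chart[OF c, of p] q unfolding sc by (simp add: N_def l_def UB_iff)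
  define T1 where "T1 = l -` (U c \<times> UNIV)"
  have T1: "open T1" unfolding T1_def l_def[abs_def]
    by (intro open_vimage open_Times open_chart c open_UNIV continuous_intros)
  have sN: "smooth_on T1 N" unfolding N_def
    by (rule smooth_on_compose[OF T1 open_Times[OF open_chart[OF c(1)] open_UNIV] _ sl[OF T1] smooth_on_sqnorm[OF c(1)]])
      (auto simp: T1_def)
  \<comment> \<open>The parameters for which the line stays in the chart and away from the zero
    section, so that the rescaling by the norm is smooth.\<close>
  define T where "T = T1 \<inter> N -` {0<..}"
  have T: "open T" unfolding T_def
    by (rule continuous_open_preimage[OF smooth_on_continuous_on[OF sN] T1]) simp
  have T0: "0 \<in> T" using z N0 by (simp add: T_def T1_def l_def)
  have TN: "N t > 0" "l t \<in> U c \<times> UNIV" if "t \<in> T" for t using that by (auto simp: T_def T1_def)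
  have sqrtN: "sqrt (N t) \<noteq> 0" if "t \<in> T" for t using TN(1)[OF that] by simp
  define \<kappa> where "\<kappa> t = (fst (l t), inverse (sqrt (N t)) *\<^sub>R snd (l t))" for t
  have TT1: "T \<subseteq> T1" by (auto simp: T_def)
  have sNT: "smooth_on T N" by (rule smooth_on_subset[OF T1 T TT1 sN])
  show ?thesis
  proof (rule CB.tangent_spaceI[OF _ T T0, where \<kappa> = \<kappa>])
    show "(x, p) \<in> points CB" using x by (simp add: points_CB)
    show "smooth_on T \<kappa>" unfolding \<kappa>_def[abs_def]
      by (intro smooth_on_Pair T smooth_on_fst[OF T sl[OF T]] smooth_on_scaleR smooth_on_snd[OF T sl[OF T]]
          smooth_on_inverse smooth_on_sqrt sNT TN(1) sqrtN)
    have ld: "(l has_derivative (\<lambda>t. t *\<^sub>R w)) (at 0)" unfolding l_def[abs_def]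
      by (auto intro!: derivative_eq_intros)
    have l0: "l 0 = (z, p)" by (simp add: l_def)
    have "(N has_derivative (\<lambda>t. 2 * (snd (t *\<^sub>R w) \<bullet> raise (gc c z) p) - dgc c z (raise (gc c z) p) (raise (gc c z) p) (fst (t *\<^sub>R w)))) (at 0)"
      unfolding N_def by (rule has_derivative_compose[OF ld]) (unfold l0, rule sqnorm_has_derivative[OF c(1) z])
    moreover have "2 * (snd (t *\<^sub>R w) \<bullet> raise (gc c z) p) - dgc c z (raise (gc c z) p) (raise (gc c z) p) (fst (t *\<^sub>R w)) = 0" for t
    proof -
      have gz: "gc c z = g x" using gc_pref[OF x] by (simp add: c_def z_def)
      have "2 * (snd w \<bullet> s) = dgc c z s s (fst w)" using w by (simp add: c_def z_def)
      then show ?thesis unfolding gz s_def[symmetric]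
        by (simp add: linear_scale[OF linear_dgc[OF c(1) z]])
    qed
    \<comment> \<open>The assumption on \<open>w\<close> makes the squared norm stationary at 0, so
      the radial rescaling does not change the initial velocity.\<close>
    ultimately have "(N has_real_derivative 0) (at 0)"
      by (simp add: has_field_derivative_def lambda_zero)
    then have "((\<lambda>t. inverse (sqrt (N t))) has_real_derivative 0) (at 0)"
      using N0 by (auto intro!: derivative_eq_intros)
    then have i: "((\<lambda>t. inverse (sqrt (N t))) has_derivative (\<lambda>t. 0)) (at 0)"
      by (simp add: has_field_derivative_def lambda_zero)
    have "(\<kappa> has_derivative (\<lambda>t. (fst (t *\<^sub>R w), inverse (sqrt (N 0)) *\<^sub>R snd (t *\<^sub>R w) + 0 *\<^sub>R snd (l 0)))) (at 0)"
      unfolding \<kappa>_def[abs_def]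
      by (intro has_derivative_Pair has_derivative_scaleR i has_derivative_fst has_derivative_snd ld)
    then show "(\<kappa> has_vector_derivative w) (at 0)"
      by (simp add: has_vector_derivative_def N0 scaleR_prod_def)
    show "\<kappa> 0 = snd (pref CB (x, p)) (x, p)" unfolding pr sc by (simp add: \<kappa>_def l0 N0)
    show "\<kappa> ` T \<subseteq> snd (pref CB (x, p)) ` (UB \<inter> fst (pref CB (x, p)))"
    proof (rule image_subsetI)
      fix t assume t: "t \<in> T"
      obtain y where y: "y \<in> fst c" "fst (l t) = snd c y" using TN(2)[OF t] by auto
      define r where "r = covec_from_chart c y (snd (\<kappa> t))"
      have k: "\<kappa> t = snd (cc c) (y, r)" using y c by (simp add: r_def \<kappa>_def)
      have yp: "y \<in> points M" using y c chart_subset by blast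
      have zt: "fst (l t) \<in> U c" using y by blast
      have "sqnorm c (\<kappa> t) = inverse (sqrt (N t)) * inverse (sqrt (N t)) * N t"
        by (simp add: sqnorm_def \<kappa>_def N_def linear_scale[OF linear_raise[OF inner_form_gc[OF c(1) zt]]])
      also have "\<dots> = 1" using TN(1)[OF t] by (simp add: field_simps)
      finally have "(y, r) \<in> UB" using sqnorm_chart[OF c(1) y(1), of r] k yp by (simp add: UB_iff)
      then show "\<kappa> t \<in> snd (pref CB (x, p)) ` (UB \<inter> fst (pref CB (x, p)))"
        unfolding pr k using y by (intro imageI) simp
    qed
  qed
qed

text \<open>Horizontal curves are parallel covectors, whose length is constant; infinitesimally this
  is \<open>dgc_eq\<close> on the diagonal.\<close>

lemma hor_lift_tangent:
  assumes q: "(x, p) \<in> UB"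
  shows "hor_lift M g (x, p) u \<in> tangent_space CB UB (x, p)"
proof (rule UB_tangentI[OF q])
  have x: "x \<in> points M" using q UB_iff by blast
  define c where "c = pref M x"
  define z where "z = snd c x"
  have c: "c \<in> charts M" "z \<in> U c" using pref[OF x] c_def z_def by auto
  have "gc c z v (raise (g x) p) = p \<bullet> v" "gc c z (raise (g x) p) v = p \<bullet> v" for v
    using raise_works[OF inner_form_g[OF x]] raise_works'[OF inner_form_g[OF x]] gc_pref[OF x]
    by (simp_all add: c_def z_def)
  then show "2 * (snd (hor_lift M g (x, p) u) \<bullet> raise (g x) p) =
      dgc (pref M x) (snd (pref M x) x) (raise (g x) p) (raise (g x) p) (fst (hor_lift M g (x, p) u))"
    by (simp add: snd_hor_lift[OF x] c_def[symmetric] z_def[symmetric] dgc_eq[OF c] gam_sym[OF c, of u])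
qed

lemma ver_lift_tangent:
  assumes q: "(x, p) \<in> UB" and \<beta>: "\<beta> \<bullet> raise (g x) p = 0"
  shows "ver_lift \<beta> \<in> tangent_space CB UB (x, p)"
proof (rule UB_tangentI[OF q])
  have x: "x \<in> points M" using q UB_iff by blast
  have "linear (dgc (pref M x) (snd (pref M x) x) a b)" for a b
    by (rule linear_dgc) (use pref[OF x] in auto)
  from linear_0[OF this] show "2 * (snd (ver_lift \<beta>) \<bullet> raise (g x) p) =
      dgc (pref M x) (snd (pref M x) x) (raise (g x) p) (raise (g x) p) (fst (ver_lift \<beta>))"
    by (simp add: ver_lift_def \<beta>)
qed

lemma raise_inner_sym: "x \<in> points M \<Longrightarrow> \<omega> \<bullet> raise (g x) \<theta> = \<theta> \<bullet> raise (g x) \<omega>"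
  using ginv_sym[of x \<omega> \<theta>] by (simp add: ginv_eq)

lemma tan_lift_tangent:
  assumes q: "(x, p) \<in> UB"
  shows "tan_lift g (x, p) \<omega> \<in> tangent_space CB UB (x, p)"
proof -
  have x: "x \<in> points M" "p \<bullet> raise (g x) p = 1" using q UB_iff by blast+
  show ?thesis unfolding tan_lift_eq[OF x(1)]
    by (rule ver_lift_tangent[OF q]) (simp add: inner_diff_left x raise_inner_sym[OF x(1), of \<omega>])
qed

text \<open>Subtracting the horizontal part leaves a vertical tangent vector. Its covector is
  orthogonal to \<open>p\<close>, so its vertical lift is already its tangential lift.\<close>

lemma tangent_decomposition:
  assumes q: "(x, p) \<in> UB" and w: "w \<in> tangent_space CB UB (x, p)"
  obtains \<beta> where "w = hor_lift M g (x, p) (fst w) + tan_lift g (x, p) \<beta>"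
proof -
  have x: "x \<in> points M" using q UB_iff by blast
  define \<beta> where "\<beta> = snd w - snd (hor_lift M g (x, p) (fst w))"
  have "\<beta> \<bullet> raise (g x) p = 0"
    using UB_tangent_imp[OF q w] UB_tangent_imp[OF q hor_lift_tangent[OF q, of "fst w"]]
    by (simp add: \<beta>_def inner_diff_left)
  then have "p \<bullet> raise (g x) \<beta> = 0" using raise_inner_sym[OF x] by simp
  then have "tan_lift g (x, p) \<beta> = ver_lift \<beta>" by (simp add: tan_lift_eq[OF x])
  then have "w = hor_lift M g (x, p) (fst w) + tan_lift g (x, p) \<beta>"
    by (simp add: prod_eq_iff ver_lift_def \<beta>_def)
  then show thesis by (rule that)
qed

text \<open>Velocities of curves in the bundle do not visibly add up; the linear equation that
  characterises them does the work.\<close>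

lemma subspace_tangent:
  assumes q: "(x, p) \<in> UB"
  shows "subspace (tangent_space CB UB (x, p))"
proof -
  have x: "x \<in> points M" using q UB_iff by blast
  have l: "linear (dgc (pref M x) (snd (pref M x) x) a b)" for a b
    by (rule linear_dgc) (use pref[OF x] in auto)
  have "tangent_space CB UB (x, p) = {w. 2 * (snd w \<bullet> raise (g x) p) =
      dgc (pref M x) (snd (pref M x) x) (raise (g x) p) (raise (g x) p) (fst w)}"
    using UB_tangent_imp[OF q] UB_tangentI[OF q] by blast
  then show ?thesis
    by (auto simp: subspace_def linear_0[OF l] linear_add[OF l] linear_scale[OF l] inner_add_left)
qed

lemma hor_field_extends:
  assumes c: "c \<in> charts M" "x \<in> fst c" and X: "X \<in> VF"
  shows "extends_at UB (cc c) (x, p) (\<lambda>y. to_chart CB (cc c) y (hor_field M g X y)) (hor_rep c X)"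
  unfolding extends_at_def
  using smooth_on_hor_rep[OF c(1) X] open_Times[OF open_chart[OF c(1)] open_UNIV] c
  by (intro exI[of _ "U c \<times> UNIV"]) (auto simp: hor_field_chart[OF c(1), simplified])

lemma tan_field_extends:
  assumes c: "c \<in> charts M" "x \<in> fst c" and \<omega>: "\<omega> \<in> one_forms M"
  shows "extends_at UB (cc c) (x, p) (\<lambda>y. to_chart CB (cc c) y (tan_field g \<omega> y)) (tan_rep c \<omega>)"
  unfolding extends_at_def
  using smooth_on_tan_rep[OF c(1) \<omega>] open_Times[OF open_chart[OF c(1)] open_UNIV] c
  by (intro exI[of _ "U c \<times> UNIV"]) (auto simp: tan_field_chart[OF c(1), simplified])

lemma hor_field:
  assumes X: "X \<in> VF"
  shows "hor_field M g X \<in> vector_fields CB UB"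
proof (rule CB.vector_fieldsI)
  fix q assume q: "q \<in> UB"
  obtain x p where xp: "q = (x, p)" by (cases q)
  have x: "x \<in> points M" using q UB_iff xp by blast
  show "hor_field M g X q \<in> tangent_space CB UB q"
    using hor_lift_tangent q by (simp add: hor_field_def xp)
  define c where "c = pref M x"
  have c: "c \<in> charts M" "x \<in> fst c" using pref[OF x] c_def by auto
  have "extends_at UB (cc c) q (\<lambda>y. to_chart CB (cc c) y (hor_field M g X y)) (hor_rep c X)"
    unfolding xp by (rule hor_field_extends[OF c X])
  then show "\<exists>C\<in>charts CB. q \<in> fst C \<and> (\<exists>F. extends_at UB C q (\<lambda>y. to_chart CB C y (hor_field M g X y)) F)"
    using cc_chart[OF c(1)] c(2) xp by (intro bexI[of _ "cc c"]) auto
qed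

lemma tan_field:
  assumes \<omega>: "\<omega> \<in> one_forms M"
  shows "tan_field g \<omega> \<in> vector_fields CB UB"
proof (rule CB.vector_fieldsI)
  fix q assume q: "q \<in> UB"
  obtain x p where xp: "q = (x, p)" by (cases q)
  have x: "x \<in> points M" using q UB_iff xp by blast
  show "tan_field g \<omega> q \<in> tangent_space CB UB q"
    using tan_lift_tangent q by (simp add: tan_field_def xp)
  define c where "c = pref M x"
  have c: "c \<in> charts M" "x \<in> fst c" using pref[OF x] c_def by auto
  have "extends_at UB (cc c) q (\<lambda>y. to_chart CB (cc c) y (tan_field g \<omega> y)) (tan_rep c \<omega>)"
    unfolding xp by (rule tan_field_extends[OF c \<omega>])
  then show "\<exists>C\<in>charts CB. q \<in> fst C \<and> (\<exists>F. extends_at UB C q (\<lambda>y. to_chart CB C y (tan_field g \<omega> y)) F)"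
    using cc_chart[OF c(1)] c(2) xp by (intro bexI[of _ "cc c"]) auto
qed

end

section \<open>Lie brackets of lifted fields\<close>

locale unit_cotangent_point = kaehler M g D J for M :: "('a, real^'n) mfd" and g D J +
  fixes x :: 'a and p :: "real^'n"
  assumes q: "(x, p) \<in> unit_cotangent_bundle M g"
begin

definition "c = pref M x"

definition "z = snd c x"

abbreviation "sh \<equiv> raise (g x)"

abbreviation "TS \<equiv> tangent_space CB UB (x, p)"

abbreviation "horl \<equiv> hor_lift M g (x, p)"

abbreviation "tanl \<equiv> tan_lift g (x, p)"

lemma x_point: "x \<in> points M" and p_unit: "p \<bullet> sh p = 1"
  using q UB_iff by blast+

lemma c_chart: "c \<in> charts M" "x \<in> fst c" and z_chart: "z \<in> U c"
  using pref[OF x_point] by (auto simp: c_def z_def)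

lemma pref_q: "pref CB (x, p) = cc c" and cc_q: "snd (cc c) (x, p) = (z, p)"
  using x_point by (simp_all add: c_def z_def)

lemma rep_x [simp]: "rep M c X z = X x"
  using c_chart x_point by (simp add: z_def) (simp add: c_def)

lemma D_x: "X \<in> VF \<Longrightarrow> Y \<in> VF \<Longrightarrow> D X Y x = drep c Y z (X x) + gam c z (X x) (Y x)"
  using D_pref[OF x_point] by (simp add: c_def z_def)

lemma gc_x: "gc c z = g x"
  using gc_pref[OF x_point] by (simp add: c_def z_def)

lemma snd_hl: "snd (horl u) \<bullet> v = p \<bullet> gam c z v u"
  using snd_hor_lift[OF x_point] by (simp add: c_def z_def)

lemma linear_hl: "linear horl"
  by (rule linearI; rule prod_eqI)
    (auto intro!: covector_eqI simp: snd_hl inner_add_left inner_add_right bilinear_radd[OF bilinear_gam[OF c_chart(1) z_chart]]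
      bilinear_rmul[OF bilinear_gam[OF c_chart(1) z_chart]])

lemma bilinear_g: "bilinear (g x)"
  by (rule inner_form_bilinear[OF inner_form_g[OF x_point]])

lemma g_sh: "g x (sh \<omega>) u = \<omega> \<bullet> u" and g_sh': "g x u (sh \<omega>) = \<omega> \<bullet> u"
  by (rule raise_works[OF inner_form_g[OF x_point]], rule raise_works'[OF inner_form_g[OF x_point]])

lemma linear_sh: "linear sh"
  by (rule linear_raise[OF inner_form_g[OF x_point]])

lemma sh_sym: "\<omega> \<bullet> sh \<theta> = \<theta> \<bullet> sh \<omega>"
  by (rule raise_inner_sym[OF x_point])

lemma tl_eq: "tanl \<omega> = ver_lift (\<omega> - (p \<bullet> sh \<omega>) *\<^sub>R p)"
  by (rule tan_lift_eq[OF x_point])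

lemma fst_tl [simp]: "fst (tanl \<omega>) = 0" and snd_tl: "snd (tanl \<omega>) = \<omega> - (p \<bullet> sh \<omega>) *\<^sub>R p"
  by (simp_all add: tl_eq ver_lift_def)

lemma hor_field_q [simp]: "hor_field M g X (x, p) = horl (X x)"
  and tan_field_q [simp]: "tan_field g \<omega> (x, p) = tanl (\<omega> x)"
  by (simp_all add: hor_field_def tan_field_def)

lemma hl_tangent: "horl u \<in> TS" and tl_tangent: "tanl \<omega> \<in> TS"
  by (rule hor_lift_tangent[OF q], rule tan_lift_tangent[OF q])

lemma hor_field_deriv:
  assumes X: "X \<in> VF" and v: "v \<in> TS"
  defines "d \<equiv> dir_deriv CB UB (x, p) v (\<lambda>y. to_chart CB (pref CB (x, p)) y (hor_field M g X y))"
  shows "fst d = drep c X z (fst v)"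
    and "snd d \<bullet> e = p \<bullet> (dgam c z e (X x) (fst v) + gam c z e (drep c X z (fst v))) + snd v \<bullet> gam c z e (X x)"
proof -
  have "d = frechet_derivative (hor_rep c X) (at (z, p)) v"
    using dir_deriv_eq[OF v, unfolded pref_q, OF hor_field_extends[OF c_chart X]] by (simp only: d_def pref_q cc_q)
  then have d: "d = (drep c X z (fst v), \<chi> i. p \<bullet> (dgam c z (axis i 1) (X x) (fst v) + gam c z (axis i 1) (drep c X z (fst v)))
       + snd v \<bullet> gam c z (axis i 1) (X x))"
    using fun_cong[OF frechet_derivativeI[OF hor_rep_has_derivative[OF c_chart(1) X z_chart, of p]], of v] by simp
  show "fst d = drep c X z (fst v)" by (simp add: d)
  have "linear (\<lambda>e. p \<bullet> (dgam c z e (X x) (fst v) + gam c z e (drep c X z (fst v))) + snd v \<bullet> gam c z e (X x))"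
    by (rule linearI) (simp_all add: bilinear_ladd[OF bilinear_gam[OF c_chart(1) z_chart]] bilinear_lmul[OF bilinear_gam[OF c_chart(1) z_chart]]
        bilinear_ladd[OF bilinear_dgam[OF c_chart(1) z_chart]] bilinear_lmul[OF bilinear_dgam[OF c_chart(1) z_chart]] inner_add_right algebra_simps)
  from covector_of_linear[OF this]
  show "snd d \<bullet> e = p \<bullet> (dgam c z e (X x) (fst v) + gam c z e (drep c X z (fst v))) + snd v \<bullet> gam c z e (X x)"
    by (simp add: d)
qed

lemma tan_field_deriv:
  assumes \<omega>: "\<omega> \<in> one_forms M" and v: "v \<in> TS"
  shows "dir_deriv CB UB (x, p) v (\<lambda>y. to_chart CB (pref CB (x, p)) y (tan_field g \<omega> y)) =
    (0, dform c \<omega> z (fst v) - ((p \<bullet> sh (\<omega> x)) *\<^sub>R snd v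
        + (p \<bullet> drep c (dual_field \<omega>) z (fst v) + snd v \<bullet> sh (\<omega> x)) *\<^sub>R p))"
proof -
  have "dir_deriv CB UB (x, p) v (\<lambda>y. to_chart CB (pref CB (x, p)) y (tan_field g \<omega> y)) =
      frechet_derivative (tan_rep c \<omega>) (at (z, p)) v"
    using dir_deriv_eq[OF v, unfolded pref_q, OF tan_field_extends[OF c_chart \<omega>]] by (simp only: pref_q cc_q)
  then show ?thesis
    using fun_cong[OF frechet_derivativeI[OF tan_rep_has_derivative[OF c_chart(1) \<omega> z_chart, of p]], of v]
    by (simp add: dual_field_def)
qed

text \<open>The fibre component of a horizontal lift is p paired with \<open>gam\<close>.
  Differentiated along another horizontal lift, it gives a derivative of \<open>gam\<close> from the
  moving base point and a nested \<open>gam\<close> from the moving covector; antisymmetrised, these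
  form the curvature.\<close>

lemma bracket_hor_hor:
  assumes X: "X \<in> VF" and Y: "Y \<in> VF"
  shows "lie_bracket CB UB (hor_field M g X) (hor_field M g Y) (x, p) =
    horl (lie_bracket M (points M) X Y x) + ver_lift (covec_comp p (curvature M D x (X x) (Y x)))"
proof (rule prod_eqI)
  have L: "lie_bracket M (points M) X Y x = drep c Y z (X x) - drep c X z (Y x)"
    using lie_bracket_points[OF x_point X Y] by (simp add: c_def z_def)
  show "fst (lie_bracket CB UB (hor_field M g X) (hor_field M g Y) (x, p)) =
    fst (horl (lie_bracket M (points M) X Y x) + ver_lift (covec_comp p (curvature M D x (X x) (Y x))))"
    by (simp add: lie_bracket_def[of CB] hor_field_deriv(1)[OF X hl_tangent] hor_field_deriv(1)[OF Y hl_tangent] L ver_lift_def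
        del: pref_CB)
  note bg = bilinear_gam[OF c_chart(1) z_chart]
  have "snd (lie_bracket CB UB (hor_field M g X) (hor_field M g Y) (x, p)) \<bullet> e =
    snd (horl (lie_bracket M (points M) X Y x) + ver_lift (covec_comp p (curvature M D x (X x) (Y x)))) \<bullet> e" for e
  proof -
    have "snd (lie_bracket CB UB (hor_field M g X) (hor_field M g Y) (x, p)) \<bullet> e =
      p \<bullet> (dgam c z e (Y x) (X x) + gam c z e (drep c Y z (X x))) + p \<bullet> gam c z (gam c z e (Y x)) (X x)
      - (p \<bullet> (dgam c z e (X x) (Y x) + gam c z e (drep c X z (Y x))) + p \<bullet> gam c z (gam c z e (X x)) (Y x))"
      by (simp add: lie_bracket_def[of CB] inner_diff_left hor_field_deriv(2)[OF X hl_tangent]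
          hor_field_deriv(2)[OF Y hl_tangent] snd_hl del: pref_CB)
    also have "\<dots> = p \<bullet> (gam c z e (drep c Y z (X x) - drep c X z (Y x)) + curv c z (X x) (Y x) e)"
      by (simp add: curv_def bilinear_rsub[OF bg] inner_add_right inner_diff_right
          dgam_sym[OF c_chart(1) z_chart, of e] gam_sym[OF c_chart(1) z_chart, of e] gam_sym[OF c_chart(1) z_chart, of _ "X x"] gam_sym[OF c_chart(1) z_chart, of _ "Y x"])
    finally show ?thesis
      by (simp add: L inner_add_left inner_add_right snd_hl ver_lift_def covec_comp_inner[OF linear_curvature[OF x_point]]
          curvature_eq[OF x_point] c_def[symmetric] z_def[symmetric])
  qed
  then show "snd (lie_bracket CB UB (hor_field M g X) (hor_field M g Y) (x, p)) =
    snd (horl (lie_bracket M (points M) X Y x) + ver_lift (covec_comp p (curvature M D x (X x) (Y x))))"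
    by (rule covector_eqI)
qed

lemma sh_covd_form:
  assumes X: "X \<in> VF" and \<omega>: "\<omega> \<in> one_forms M"
  shows "sh (covd_form M D X \<omega> x) = D X (dual_field \<omega>) x"
  by (rule raise_eqI[OF inner_form_g[OF x_point]]) (simp add: covd_form_eq[OF x_point X \<omega>])

text \<open>The Christoffel term in the derivative of \<open>\<omega>\<close> cancels the derivative
  of the horizontal lift along the fibre. In the normal correction the Christoffel term completes
  the derivative of the dual field to its covariant derivative.\<close>

lemma bracket_hor_tan:
  assumes X: "X \<in> VF" and \<omega>: "\<omega> \<in> one_forms M"
  shows "lie_bracket CB UB (hor_field M g X) (tan_field g \<omega>) (x, p) = tanl (covd_form M D X \<omega> x)"
proof (rule prod_eqI)
  note bg = bilinear_gam[OF c_chart(1) z_chart]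
  have zd: "drep c X z 0 = 0"
    by (rule linear_0[OF has_derivative_linear[OF rep_has_derivative[OF X c_chart(1) z_chart]]])
  have zg: "dgam c z e (X x) 0 = 0" for e
    by (rule linear_0[OF has_derivative_linear[OF gam_has_derivative[OF c_chart(1) z_chart]]])
  show "fst (lie_bracket CB UB (hor_field M g X) (tan_field g \<omega>) (x, p)) = fst (tanl (covd_form M D X \<omega> x))"
    by (simp add: lie_bracket_def[of CB] hor_field_deriv(1)[OF X tl_tangent] tan_field_deriv[OF \<omega> hl_tangent] zd del: pref_CB)
  define V where "V = dual_field \<omega>"
  have V: "V x = sh (\<omega> x)" by (simp add: V_def dual_field_def)
  have DV: "D X V x = drep c V z (X x) + gam c z (X x) (V x)"
    unfolding V_def by (rule D_x[OF X dual_field[OF \<omega>]])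
  have "snd (lie_bracket CB UB (hor_field M g X) (tan_field g \<omega>) (x, p)) \<bullet> e = snd (tanl (covd_form M D X \<omega> x)) \<bullet> e" for e
  proof -
    have df: "dform c \<omega> z (X x) \<bullet> e = g x (D X V x) e + \<omega> x \<bullet> gam c z (X x) e"
      unfolding dform_inner[OF c_chart(1) \<omega> z_chart] gc_x DV V_def[symmetric]
      by (simp add: bilinear_ladd[OF bilinear_g] V g_sh)
    have "snd (lie_bracket CB UB (hor_field M g X) (tan_field g \<omega>) (x, p)) \<bullet> e =
      dform c \<omega> z (X x) \<bullet> e - (p \<bullet> sh (\<omega> x)) * (p \<bullet> gam c z e (X x))
        - (p \<bullet> drep c V z (X x) + p \<bullet> gam c z (sh (\<omega> x)) (X x)) * (p \<bullet> e)
        - (\<omega> x - (p \<bullet> sh (\<omega> x)) *\<^sub>R p) \<bullet> gam c z e (X x)"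
      by (simp add: lie_bracket_def[of CB] inner_diff_left inner_add_left hor_field_deriv(2)[OF X tl_tangent]
          tan_field_deriv[OF \<omega> hl_tangent] snd_hl snd_tl zd zg bilinear_rzero[OF bg] V_def[symmetric] del: pref_CB)
    also have "\<dots> = g x (D X V x) e - (p \<bullet> D X V x) * (p \<bullet> e)"
      unfolding df by (simp add: DV V inner_add_right inner_diff_left gam_sym[OF c_chart(1) z_chart, of _ "X x"] algebra_simps)
    finally show ?thesis
      by (simp add: snd_tl sh_covd_form[OF X \<omega>] covd_form_eq[OF x_point X \<omega>] V_def inner_diff_left)
  qed
  then show "snd (lie_bracket CB UB (hor_field M g X) (tan_field g \<omega>) (x, p)) = snd (tanl (covd_form M D X \<omega> x))"
    by (rule covector_eqI)
qed

text \<open>Both fields are vertical, so only the quadratic dependence of the normal correction on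
  the fibre coordinates contributes; the multiples of \<open>p\<close> cancel by symmetry.\<close>

lemma bracket_tan_tan:
  assumes \<omega>: "\<omega> \<in> one_forms M" and \<theta>: "\<theta> \<in> one_forms M"
  shows "lie_bracket CB UB (tan_field g \<omega>) (tan_field g \<theta>) (x, p) =
    (p \<bullet> sh (\<omega> x)) *\<^sub>R tanl (\<theta> x) - (p \<bullet> sh (\<theta> x)) *\<^sub>R tanl (\<omega> x)"
proof -
  have zf: "dform c \<eta> z 0 = 0" if "\<eta> \<in> one_forms M" for \<eta>
    unfolding dform_def by (rule linear_0[OF smooth_on_linear_derivative[OF open_chart[OF c_chart(1)] smooth_on_form_rep[OF that c_chart(1)] z_chart]])
  have zd: "drep c (dual_field \<eta>) z 0 = 0" if "\<eta> \<in> one_forms M" for \<eta>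
    by (rule linear_0[OF has_derivative_linear[OF rep_has_derivative[OF dual_field[OF that] c_chart(1) z_chart]]])
  have "lie_bracket CB UB (tan_field g \<omega>) (tan_field g \<theta>) (x, p) =
     (0, - ((p \<bullet> sh (\<theta> x)) *\<^sub>R snd (tanl (\<omega> x)) + (snd (tanl (\<omega> x)) \<bullet> sh (\<theta> x)) *\<^sub>R p)
         + ((p \<bullet> sh (\<omega> x)) *\<^sub>R snd (tanl (\<theta> x)) + (snd (tanl (\<theta> x)) \<bullet> sh (\<omega> x)) *\<^sub>R p))"
    by (simp add: lie_bracket_def[of CB] tan_field_deriv[OF \<omega> tl_tangent] tan_field_deriv[OF \<theta> tl_tangent]
        zf[OF \<omega>] zf[OF \<theta>] zd[OF \<omega>] zd[OF \<theta>] del: pref_CB)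
  moreover have "snd (tanl (\<omega> x)) \<bullet> sh (\<theta> x) = snd (tanl (\<theta> x)) \<bullet> sh (\<omega> x)"
    by (simp add: snd_tl inner_diff_left sh_sym[of "\<omega> x"])
  ultimately show ?thesis by (simp add: prod_eq_iff)
qed

section \<open>The Berger-type metric on lifted fields\<close>

text \<open>By \<open>ginv_pJ\<close> this is the inner product of \<omega> with pJ. Written as p
  applied to a vector it becomes, for a form on \<open>M\<close>, a function of the type p(W) with W
  a vector field.\<close>

definition "jj \<omega> = p \<bullet> J x (sh \<omega>)"

lemma linear_jj: "linear jj"
  unfolding jj_def[abs_def]
  by (rule linearI) (simp_all add: linear_add[OF linear_sh] linear_scale[OF linear_sh] linear_add[OF linear_J[OF x_point]]
      linear_scale[OF linear_J[OF x_point]] inner_add_right)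

text \<open>Skewness of \<open>J\<close>. Consequently the deformation term does not see the normal
  correction of a tangential lift.\<close>

lemma jj_p [simp]: "jj p = 0"
proof -
  have "jj p = g x (sh p) (J x (sh p))" by (simp add: jj_def g_sh)
  also have "\<dots> = - jj p"
    using J_skew[OF x_point, of "sh p" "sh p"] inner_form_sym[OF inner_form_g[OF x_point], of "sh p"] by (simp add: jj_def g_sh)
  finally show ?thesis by simp
qed

lemma ginv_pJ: "ginv g x \<omega> (covec_comp p (J x)) = jj \<omega>"
  by (simp add: ginv_eq[OF x_point] covec_comp_inner[OF linear_J[OF x_point]] jj_def)

lemma ginv_p: "ginv g x \<omega> p = p \<bullet> sh \<omega>"
  by (simp add: ginv_eq[OF x_point])

end

locale berger_metric = unit_cotangent_point M g D J x p for M :: "('a, real^'n) mfd" and g D J x p +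
  fixes \<delta> :: real
begin

abbreviation "h \<equiv> berger_sasaki M J g \<delta>"

lemma h_eq: "h (x, p) w w' = g x (fst w) (fst w') +
    (let \<omega> = snd w - snd (horl (fst w)); \<theta> = snd w' - snd (horl (fst w')) in \<theta> \<bullet> sh \<omega> + \<delta>\<^sup>2 * jj \<omega> * jj \<theta>)"
  by (simp add: berger_sasaki_def Let_def ver_part_def ginv_pJ ginv_eq[OF x_point, of _ "_ - _"])

lemma bilinear_h: "bilinear (h (x, p))"
  unfolding bilinear_def
  by (intro conjI allI linearI)
    (simp_all add: h_eq Let_def bilinear_ladd[OF bilinear_g] bilinear_lmul[OF bilinear_g]
      bilinear_radd[OF bilinear_g] bilinear_rmul[OF bilinear_g]
      linear_add[OF linear_hl] linear_scale[OF linear_hl] linear_add[OF linear_sh] linear_scale[OF linear_sh]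
      linear_diff[OF linear_sh] linear_diff[OF linear_jj]
      linear_add[OF linear_jj] linear_scale[OF linear_jj] inner_add_left inner_add_right inner_diff_left inner_diff_right algebra_simps)

lemma h_sym: "h (x, p) w w' = h (x, p) w' w"
  unfolding h_eq Let_def using inner_form_sym[OF inner_form_g[OF x_point], of "fst w"]
    sh_sym[of "snd w - snd (horl (fst w))"] by simp

lemma h_hl_hl [simp]: "h (x, p) (horl u) (horl v) = g x u v"
  and h_hl_ver [simp]: "h (x, p) (horl u) (ver_lift \<theta>) = 0"
  and h_ver_hl [simp]: "h (x, p) (ver_lift \<theta>) (horl u) = 0"
  and h_ver_ver: "h (x, p) (ver_lift \<omega>) (ver_lift \<theta>) = \<theta> \<bullet> sh \<omega> + \<delta>\<^sup>2 * jj \<omega> * jj \<theta>"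
  using linear_0[OF linear_hl] by (simp_all add: h_eq Let_def ver_lift_def linear_0[OF linear_sh] linear_0[OF linear_jj]
      bilinear_lzero[OF bilinear_g] bilinear_rzero[OF bilinear_g])

lemma h_hl_tl [simp]: "h (x, p) (horl u) (tanl \<theta>) = 0" and h_tl_hl [simp]: "h (x, p) (tanl \<theta>) (horl u) = 0"
  by (simp_all add: tl_eq)

lemma h_ver_tl: "h (x, p) (ver_lift \<omega>) (tanl \<theta>) = \<theta> \<bullet> sh \<omega> - (p \<bullet> sh \<theta>) * (p \<bullet> sh \<omega>) + \<delta>\<^sup>2 * jj \<omega> * jj \<theta>"
  by (simp add: tl_eq h_ver_ver inner_diff_left linear_diff[OF linear_jj] linear_scale[OF linear_jj])

lemma h_tl_tl: "h (x, p) (tanl \<omega>) (tanl \<theta>) = \<theta> \<bullet> sh \<omega> - (p \<bullet> sh \<omega>) * (p \<bullet> sh \<theta>) + \<delta>\<^sup>2 * jj \<omega> * jj \<theta>"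
  unfolding tl_eq[of \<omega>] h_ver_tl
  by (simp add: linear_diff[OF linear_sh] linear_scale[OF linear_sh] inner_diff_right p_unit sh_sym[of \<omega> p] sh_sym[of \<theta> p]
      linear_diff[OF linear_jj] linear_scale[OF linear_jj] algebra_simps)

text \<open>The difference of the two vectors is itself a sum of a horizontal and a tangential lift,
  so it is orthogonal to itself. Its squared length is a sum of three nonnegative terms, the first
  two of which detect its horizontal and vertical part.\<close>

lemma h_eqI:
  assumes w: "w \<in> TS" "w' \<in> TS"
    and hor: "\<And>u. h (x, p) w (horl u) = h (x, p) w' (horl u)"
    and tan: "\<And>\<zeta>. h (x, p) w (tanl \<zeta>) = h (x, p) w' (tanl \<zeta>)"
  shows "w = w'"
proof -
  have d: "w - w' \<in> TS" by (rule subspace_diff[OF subspace_tangent[OF q] w])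
  obtain \<beta> where \<beta>: "w - w' = horl (fst (w - w')) + tanl \<beta>" using tangent_decomposition[OF q d] by blast
  define u where "u = fst (w - w')"
  define b where "b = \<beta> - (p \<bullet> sh \<beta>) *\<^sub>R p"
  have wu: "w - w' = horl u + ver_lift b" unfolding u_def b_def tl_eq[symmetric] by (rule \<beta>)
  have "h (x, p) (w - w') (horl u + tanl \<beta>) = 0"
    by (simp add: bilinear_lsub[OF bilinear_h] bilinear_radd[OF bilinear_h] hor tan)
  then have "h (x, p) (horl u + ver_lift b) (horl u + ver_lift b) = 0"
    unfolding wu by (simp only: b_def tl_eq)
  then have 0: "g x u u + (g x (sh b) (sh b) + \<delta>\<^sup>2 * jj b * jj b) = 0"
    by (simp add: bilinear_ladd[OF bilinear_h] bilinear_radd[OF bilinear_h] h_ver_ver g_sh)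
  have nn: "g x v v \<ge> 0" for v
    using inner_form_g[OF x_point] bilinear_lzero[OF bilinear_g] unfolding inner_form_def
    by (metis less_eq_real_def)
  have "\<delta>\<^sup>2 * jj b * jj b \<ge> 0" by (simp add: mult.assoc)
  then have "g x u u = 0" "g x (sh b) (sh b) = 0" using 0 nn[of u] nn[of "sh b"] by linarith+
  then have "u = 0" "sh b = 0" using inner_form_g[OF x_point] unfolding inner_form_def by (metis less_irrefl)+
  moreover have "b \<bullet> v = 0 \<bullet> v" for v using g_sh[of b v] \<open>sh b = 0\<close> by (simp add: bilinear_lzero[OF bilinear_g])
  then have "b = 0" by (rule covector_eqI)
  ultimately show ?thesis using wu linear_0[OF linear_hl] by (simp add: ver_lift_def zero_prod_def[symmetric])
qed

end

section \<open>The Levi-Civita connection of the unit cotangent bundle\<close>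

locale berger_levi_civita = berger_metric M g D J x p \<delta>
  for M :: "('a, real^'n) mfd" and g D J x p \<delta> +
  fixes D' :: "('a \<times> (real^'n) \<Rightarrow> (real^'n) \<times> (real^'n)) \<Rightarrow> ('a \<times> (real^'n) \<Rightarrow> (real^'n) \<times> (real^'n)) \<Rightarrow>
    'a \<times> (real^'n) \<Rightarrow> (real^'n) \<times> (real^'n)"
  assumes D': "levi_civita (cotangent_bundle M) (unit_cotangent_bundle M g) (berger_sasaki M J g \<delta>) D'"
begin

abbreviation "H \<equiv> hor_field M g"

abbreviation "T \<equiv> tan_field g"

abbreviation "VB \<equiv> vector_fields CB UB"

abbreviation "dd v f \<equiv> dir_deriv CB UB (x, p) v f"

section \<open>Derivatives of the metric on lifted fields\<close>

lemma q_chart: "(x, p) \<in> fst (pref CB (x, p))"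
  using pref[OF x_point] by simp

lemma has_dir_deriv_eqI: "has_dir_deriv M' S y v f d \<Longrightarrow> d = d' \<Longrightarrow> has_dir_deriv M' S y v f d'"
  by simp

lemma linear_deriv_pairing:
  assumes W: "W \<in> VF"
  shows "has_dir_deriv CB UB (x, p) v (\<lambda>y. snd y \<bullet> W (fst y)) (p \<bullet> drep c W z (fst v) + snd v \<bullet> W x)"
proof -
  have o: "open (U c \<times> (UNIV :: (real^'n) set))" by (rule open_Times[OF open_chart[OF c_chart(1)] open_UNIV])
  define F where "F q = snd q \<bullet> rep M c W (fst q)" for q :: "(real^'n) \<times> (real^'n)"
  have s: "smooth_on (U c \<times> UNIV) F" unfolding F_def
    by (intro smooth_on_inner o smooth_on_snd_ident open_chart[OF c_chart(1)]
        smooth_on_fst_compose[OF open_chart[OF c_chart(1)] field_smooth_on_rep[OF W c_chart(1)]])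
  have e: "snd y \<bullet> W (fst y) = F (snd (cc c) y)" if "y \<in> UB \<inter> fst (cc c)" for y
    using that c_chart by (cases y) (simp add: F_def covec_to_chart_to_chart)
  have "extends_at UB (pref CB (x, p)) (x, p) (\<lambda>y. snd y \<bullet> W (fst y)) F"
    unfolding extends_at_def pref_q
  proof (intro exI[of _ "U c \<times> UNIV"] conjI ballI impI)
    show "snd (cc c) (x, p) \<in> U c \<times> UNIV" unfolding cc_q using z_chart by simp
  qed (rule o, rule s, rule e)
  moreover have "(F has_derivative (\<lambda>h. snd (z, p) \<bullet> drep c W z (fst h) + snd h \<bullet> rep M c W (fst (z, p)))) (at (z, p))"
    unfolding F_def
    by (rule has_derivative_inner[OF has_derivative_snd_ident has_derivative_fst_compose])
      (simp add: rep_has_derivative[OF W c_chart(1) z_chart])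
  from fun_cong[OF frechet_derivativeI[OF this], of v]
  have "frechet_derivative F (at (snd (pref CB (x, p)) (x, p))) v = p \<bullet> drep c W z (fst v) + snd v \<bullet> W x"
    unfolding pref_q cc_q by simp
  ultimately show ?thesis unfolding has_dir_deriv_def by blast
qed

text \<open>The vertical component of the horizontal lift contributes the Christoffel term that
  turns the derivative of \<open>W\<close> into its covariant derivative.\<close>

lemma pairing_deriv_hor:
  assumes X: "X \<in> VF" and W: "W \<in> VF"
  shows "has_dir_deriv CB UB (x, p) (horl (X x)) (\<lambda>y. snd y \<bullet> W (fst y)) (p \<bullet> D X W x)"
  using linear_deriv_pairing[OF W, of "horl (X x)"]
  by (simp add: D_x[OF X W] snd_hl inner_add_right gam_sym[OF c_chart(1) z_chart, of "X x"])

lemma pairing_deriv_tan: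
  assumes W: "W \<in> VF"
  shows "has_dir_deriv CB UB (x, p) (tanl \<zeta>) (\<lambda>y. snd y \<bullet> W (fst y)) (\<zeta> \<bullet> W x - (p \<bullet> sh \<zeta>) * (p \<bullet> W x))"
  using linear_deriv_pairing[OF W, of "tanl \<zeta>"] linear_0[OF has_derivative_linear[OF rep_has_derivative[OF W c_chart(1) z_chart]]]
  by (simp add: snd_tl inner_diff_left)

lemma pullback_deriv:
  assumes Y: "Y \<in> VF" and Z: "Z \<in> VF"
  shows "has_dir_deriv CB UB (x, p) v (\<lambda>y. g (fst y) (Y (fst y)) (Z (fst y)))
    (dir_deriv M (points M) x (fst v) (\<lambda>y. g y (Y y) (Z y)))"
proof -
  have o: "open (U c \<times> (UNIV :: (real^'n) set))" by (rule open_Times[OF open_chart[OF c_chart(1)] open_UNIV])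
  define f where "f w = g (inv_chart c w) (Y (inv_chart c w)) (Z (inv_chart c w))" for w
  have f: "smooth_on (U c) f" unfolding f_def by (rule smooth_on_metric_fields[OF c_chart(1) Y Z])
  have e: "g (fst y) (Y (fst y)) (Z (fst y)) = f (fst (snd (cc c) y))" if "y \<in> UB \<inter> fst (cc c)" for y
    using that c_chart by (cases y) (simp add: f_def)
  have "extends_at UB (pref CB (x, p)) (x, p) (\<lambda>y. g (fst y) (Y (fst y)) (Z (fst y))) (\<lambda>q. f (fst q))"
    unfolding extends_at_def pref_q
  proof (intro exI[of _ "U c \<times> UNIV"] conjI ballI impI)
    show "snd (cc c) (x, p) \<in> U c \<times> UNIV" unfolding cc_q using z_chart by simp
  qed (rule o, rule smooth_on_fst_compose[OF open_chart[OF c_chart(1)] f], rule e)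
  moreover have "(f has_derivative frechet_derivative f (at z)) (at (fst (z, p)))"
    using smooth_on_has_derivative[OF open_chart[OF c_chart(1)] f z_chart] by simp
  from fun_cong[OF frechet_derivativeI[OF has_derivative_fst_compose[OF this]], of v]
  have "frechet_derivative (\<lambda>q. f (fst q)) (at (snd (pref CB (x, p)) (x, p))) v =
      dir_deriv M (points M) x (fst v) (\<lambda>y. g y (Y y) (Z y))"
    unfolding pref_q cc_q
    using dir_deriv_points[OF x_point, of "\<lambda>y. g y (Y y) (Z y)", folded c_def, folded z_def, folded f_def, OF f] by simp
  ultimately show ?thesis unfolding has_dir_deriv_def by blast
qed

lemma dir_deriv_zero:
  assumes Y: "Y \<in> VF" and Z: "Z \<in> VF"
  shows "dir_deriv M (points M) x 0 (\<lambda>y. g y (Y y) (Z y)) = 0"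
proof -
  have f: "smooth_on (U c) (\<lambda>w. g (inv_chart c w) (Y (inv_chart c w)) (Z (inv_chart c w)))"
    by (rule smooth_on_metric_fields[OF c_chart(1) Y Z])
  show ?thesis
    using dir_deriv_points[OF x_point, of "\<lambda>y. g y (Y y) (Z y)", folded c_def, folded z_def, OF f]
      linear_0[OF smooth_on_linear_derivative[OF open_chart[OF c_chart(1)] f z_chart]] by simp
qed

text \<open>To be differentiated at the fixed point, the metric on lifts must be known at all points
  of the unit bundle; the pointwise formulas are obtained there by instantiating the locale
  anew.\<close>

lemma berger_metric_at: "y \<in> UB \<Longrightarrow> berger_metric M g D J (fst y) (snd y)"
  by unfold_locales simp

text \<open>The last formula is arranged as sums and products with constant factors, the form to
  which \<open>has_dir_deriv_add\<close> and \<open>has_dir_deriv_mult\<close> apply.\<close>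

lemma h_fields:
  assumes y: "y \<in> UB"
  shows "h y (H Y y) (H Z y) = g (fst y) (Y (fst y)) (Z (fst y))"
    and "h y (H Y y) (T \<theta> y) = 0"
    and "h y (T \<theta> y) (H Y y) = 0"
    and "h y (T \<omega> y) (T \<theta> y) = g (fst y) (dual_field \<omega> (fst y)) (dual_field \<theta> (fst y))
      + (-1) * ((snd y \<bullet> dual_field \<omega> (fst y)) * (snd y \<bullet> dual_field \<theta> (fst y)))
      + \<delta>\<^sup>2 * ((snd y \<bullet> J (fst y) (dual_field \<omega> (fst y))) * (snd y \<bullet> J (fst y) (dual_field \<theta> (fst y))))"
proof -
  interpret y: berger_metric M g D J "fst y" "snd y" \<delta> by (rule berger_metric_at[OF y])
  note [simp del] = y.c_def
  show "h y (H Y y) (H Z y) = g (fst y) (Y (fst y)) (Z (fst y))"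
    using y.h_hl_hl[of "Y (fst y)" "Z (fst y)"] by (simp add: hor_field_def)
  show "h y (H Y y) (T \<theta> y) = 0"
    using y.h_hl_tl[of "Y (fst y)" "\<theta> (fst y)"] by (simp add: hor_field_def tan_field_def)
  show "h y (T \<theta> y) (H Y y) = 0"
    using y.h_tl_hl[of "\<theta> (fst y)" "Y (fst y)"] by (simp add: hor_field_def tan_field_def)
  show "h y (T \<omega> y) (T \<theta> y) = g (fst y) (dual_field \<omega> (fst y)) (dual_field \<theta> (fst y))
      + (-1) * ((snd y \<bullet> dual_field \<omega> (fst y)) * (snd y \<bullet> dual_field \<theta> (fst y)))
      + \<delta>\<^sup>2 * ((snd y \<bullet> J (fst y) (dual_field \<omega> (fst y))) * (snd y \<bullet> J (fst y) (dual_field \<theta> (fst y))))"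
    using y.h_tl_tl[of "\<omega> (fst y)" "\<theta> (fst y)"]
    by (simp add: tan_field_def y.jj_def dual_field_def y.g_sh y.sh_sym[of "\<theta> (fst y)"])
qed

lemma deriv_hor_hor:
  assumes v: "v \<in> TS" and Y: "Y \<in> VF" and Z: "Z \<in> VF"
  shows "dd v (\<lambda>y. h y (H Y y) (H Z y)) = dir_deriv M (points M) x (fst v) (\<lambda>y. g y (Y y) (Z y))"
  by (rule has_dir_deriv_imp_dir_deriv[OF _ v])
    (simp only: has_dir_deriv_cong[OF h_fields(1)] pullback_deriv[OF Y Z])

lemma deriv_hor_tan:
  assumes v: "v \<in> TS"
  shows "dd v (\<lambda>y. h y (H Y y) (T \<theta> y)) = 0" and "dd v (\<lambda>y. h y (T \<theta> y) (H Y y)) = 0"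
  by (rule has_dir_deriv_imp_dir_deriv[OF _ v], simp only: has_dir_deriv_cong[OF h_fields(2)] has_dir_deriv_const)
    (rule has_dir_deriv_imp_dir_deriv[OF _ v], simp only: has_dir_deriv_cong[OF h_fields(3)] has_dir_deriv_const)

lemma dual_field_x: "dual_field \<omega> x = sh (\<omega> x)"
  by (simp add: dual_field_def)

text \<open>The derivative \<open>d\<close> of the functions p(W) is left abstract so that the
  horizontal and the tangential direction share one computation.\<close>

lemma deriv_tan_tan:
  assumes v: "v \<in> TS" and \<omega>: "\<omega> \<in> one_forms M" and \<theta>: "\<theta> \<in> one_forms M"
    and d: "\<forall>W\<in>VF. has_dir_deriv CB UB (x, p) v (\<lambda>y. snd y \<bullet> W (fst y)) (d W)"
  defines "J' \<equiv> \<lambda>\<omega> y. J y (dual_field \<omega> y)"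
  shows "dd v (\<lambda>y. h y (T \<omega> y) (T \<theta> y)) =
    dir_deriv M (points M) x (fst v) (\<lambda>y. g y (dual_field \<omega> y) (dual_field \<theta> y))
    - ((p \<bullet> sh (\<omega> x)) * d (dual_field \<theta>) + d (dual_field \<omega>) * (p \<bullet> sh (\<theta> x)))
    + \<delta>\<^sup>2 * (jj (\<omega> x) * d (J' \<theta>) + d (J' \<omega>) * jj (\<theta> x))"
proof (rule has_dir_deriv_imp_dir_deriv[OF _ v])
  note F = dual_field[OF \<omega>] dual_field[OF \<theta>]
  have JF: "J' \<omega> \<in> VF" "J' \<theta> \<in> VF" unfolding J'_def by (rule J_field[OF F(1)], rule J_field[OF F(2)])
  note m = has_dir_deriv_mult[OF _ _ q q_chart]
  note E = has_dir_deriv_add[OF has_dir_deriv_add[OF pullback_deriv[OF F, of v]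
        m[OF has_dir_deriv_const[of _ _ _ _ "-1"] m[OF d[rule_format, OF F(1)] d[rule_format, OF F(2)]]]]
        m[OF has_dir_deriv_const[of _ _ _ _ "\<delta>\<^sup>2"] m[OF d[rule_format, OF JF(1), unfolded J'_def] d[rule_format, OF JF(2), unfolded J'_def]]]]
  show "has_dir_deriv CB UB (x, p) v (\<lambda>y. h y (T \<omega> y) (T \<theta> y))
    (dir_deriv M (points M) x (fst v) (\<lambda>y. g y (dual_field \<omega> y) (dual_field \<theta> y))
    - ((p \<bullet> sh (\<omega> x)) * d (dual_field \<theta>) + d (dual_field \<omega>) * (p \<bullet> sh (\<theta> x)))
    + \<delta>\<^sup>2 * (jj (\<omega> x) * d (J' \<theta>) + d (J' \<omega>) * jj (\<theta> x)))"
    by (simp only: has_dir_deriv_cong[OF h_fields(4)], rule has_dir_deriv_eqI[OF E])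
      (simp add: J'_def dual_field_x jj_def algebra_simps)
qed

text \<open>Here \<open>J_parallel\<close> is decisive: the derivative of p(JV) is p applied to J of
  the covariant derivative of V. Hence the deformation term obeys the same product rule as the
  others.\<close>

lemma deriv_tan_tan_hor:
  assumes X: "X \<in> VF" and \<omega>: "\<omega> \<in> one_forms M" and \<theta>: "\<theta> \<in> one_forms M"
  shows "dd (horl (X x)) (\<lambda>y. h y (T \<omega> y) (T \<theta> y)) =
    h (x, p) (tanl (covd_form M D X \<omega> x)) (tanl (\<theta> x)) + h (x, p) (tanl (\<omega> x)) (tanl (covd_form M D X \<theta> x))"
proof -
  note F = dual_field[OF \<omega>] dual_field[OF \<theta>]
  have g1: "covd_form M D X \<theta> x \<bullet> sh (\<omega> x) = g x (sh (\<omega> x)) (D X (dual_field \<theta>) x)"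
    using inner_form_sym[OF inner_form_g[OF x_point]] by (simp add: covd_form_eq[OF x_point X \<theta>])
  have g2: "\<theta> x \<bullet> D X (dual_field \<omega>) x = g x (D X (dual_field \<omega>) x) (sh (\<theta> x))" by (simp add: g_sh')
  have d: "\<forall>W\<in>VF. has_dir_deriv CB UB (x, p) (horl (X x)) (\<lambda>y. snd y \<bullet> W (fst y)) (p \<bullet> D X W x)"
    using pairing_deriv_hor[OF X] by blast
  show ?thesis
    unfolding deriv_tan_tan[OF hl_tangent \<omega> \<theta> d] h_tl_tl
    by (simp add: D_metric[OF X F x_point] jj_def sh_covd_form[OF X \<omega>] sh_covd_form[OF X \<theta>] J_parallel[OF X F(1) x_point]
        J_parallel[OF X F(2) x_point] g1 g2)
      (simp add: dual_field_x algebra_simps)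
qed

lemma deriv_tan_tan_tan:
  assumes \<omega>: "\<omega> \<in> one_forms M" and \<theta>: "\<theta> \<in> one_forms M"
  shows "dd (tanl \<zeta>) (\<lambda>y. h y (T \<omega> y) (T \<theta> y)) =
    - ((p \<bullet> sh (\<omega> x)) * (\<zeta> \<bullet> sh (\<theta> x) - (p \<bullet> sh \<zeta>) * (p \<bullet> sh (\<theta> x)))
       + (\<zeta> \<bullet> sh (\<omega> x) - (p \<bullet> sh \<zeta>) * (p \<bullet> sh (\<omega> x))) * (p \<bullet> sh (\<theta> x)))
    + \<delta>\<^sup>2 * (jj (\<omega> x) * (\<zeta> \<bullet> J x (sh (\<theta> x)) - (p \<bullet> sh \<zeta>) * jj (\<theta> x))
       + (\<zeta> \<bullet> J x (sh (\<omega> x)) - (p \<bullet> sh \<zeta>) * jj (\<omega> x)) * jj (\<theta> x))"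
proof -
  have d: "\<forall>W\<in>VF. has_dir_deriv CB UB (x, p) (tanl \<zeta>) (\<lambda>y. snd y \<bullet> W (fst y)) (\<zeta> \<bullet> W x - (p \<bullet> sh \<zeta>) * (p \<bullet> W x))"
    using pairing_deriv_tan by blast
  show ?thesis
    unfolding deriv_tan_tan[OF tl_tangent \<omega> \<theta> d] fst_tl dir_deriv_zero[OF dual_field[OF \<omega>] dual_field[OF \<theta>]]
    by (simp add: dual_field_x jj_def)
qed

section \<open>The Koszul formula on lifted fields\<close>

lemma connection_tangent: "A \<in> VB \<Longrightarrow> B \<in> VB \<Longrightarrow> D' A B (x, p) \<in> TS"
  by (rule vector_fields_tangent[OF levi_civita_field[OF D'] q])

lemma connection_torsion:
  assumes "A \<in> VB" "B \<in> VB"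
  shows "D' A B (x, p) = D' B A (x, p) + lie_bracket CB UB A B (x, p)"
  using levi_civita_torsion[OF D' assms q] by (simp add: algebra_simps)

lemma connection_metric:
  "A \<in> VB \<Longrightarrow> B \<in> VB \<Longrightarrow> C \<in> VB \<Longrightarrow>
    dd (A (x, p)) (\<lambda>y. h y (B y) (C y)) = h (x, p) (D' A B (x, p)) (C (x, p)) + h (x, p) (B (x, p)) (D' A C (x, p))"
  by (rule levi_civita_metric[OF D' _ _ _ q])

lemmas koszul = levi_civita_koszul[OF D' q bilinear_h h_sym]

lemma lie_bracket_swap: "lie_bracket CB UB A B y = - lie_bracket CB UB B A y"
  by (simp add: lie_bracket_def)

lemma h_uminus: "h (x, p) (- w) w' = - h (x, p) w w'"
  by (rule bilinear_lneg[OF bilinear_h])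

text \<open>The Koszul formulas on the bundle and on \<open>M\<close> agree term by term: products
  of horizontal lifts are pulled back from \<open>M\<close>, and the vertical parts of the brackets
  are orthogonal to horizontal lifts.\<close>

lemma connection_hor_hor_hor:
  assumes X: "X \<in> VF" and Y: "Y \<in> VF"
  shows "h (x, p) (D' (H X) (H Y) (x, p)) (horl u) = g x (D X Y x) u"
proof -
  obtain Z where Z: "Z \<in> VF" "Z x = u" using vector_field_through[OF hausdorff x_point] by blast
  note F = hor_field[OF X] hor_field[OF Y] hor_field[OF Z(1)]
  have "2 * h (x, p) (D' (H X) (H Y) (x, p)) (horl (Z x)) = 2 * g x (D X Y x) (Z x)"
    using koszul[OF F]
    unfolding levi_civita_koszul[OF D x_point bilinear_g inner_form_sym[OF inner_form_g[OF x_point]] X Y Z(1)]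
      hor_field_q deriv_hor_hor[OF hl_tangent Y Z(1)] deriv_hor_hor[OF hl_tangent X Z(1)] deriv_hor_hor[OF hl_tangent X Y]
      bracket_hor_hor[OF X Y] bracket_hor_hor[OF X Z(1)] bracket_hor_hor[OF Y Z(1)]
    by (simp add: bilinear_ladd[OF bilinear_h])
  then show ?thesis by (simp add: Z)
qed

text \<open>All derivatives vanish, and of the brackets only the vertical part of the one between
  the horizontal lifts survives. Since \<delta> enters only through the metric on both sides, it is
  absent from the resulting connection term.\<close>

lemma connection_hor_hor_tan:
  assumes X: "X \<in> VF" and Y: "Y \<in> VF"
  shows "2 * h (x, p) (D' (H X) (H Y) (x, p)) (tanl \<zeta>) =
    h (x, p) (ver_lift (covec_comp p (curvature M D x (X x) (Y x)))) (tanl \<zeta>)"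
proof -
  obtain \<eta> where \<eta>: "\<eta> \<in> one_forms M" "\<eta> x = \<zeta>" using one_form_through[OF x_point] by blast
  note F = hor_field[OF X] hor_field[OF Y] tan_field[OF \<eta>(1)]
  have "2 * h (x, p) (D' (H X) (H Y) (x, p)) (tanl (\<eta> x)) =
      h (x, p) (ver_lift (covec_comp p (curvature M D x (X x) (Y x)))) (tanl (\<eta> x))"
    using koszul[OF F]
    unfolding hor_field_q tan_field_q deriv_hor_tan[OF hl_tangent] deriv_hor_hor[OF tl_tangent X Y]
      bracket_hor_hor[OF X Y] bracket_hor_tan[OF X \<eta>(1)] bracket_hor_tan[OF Y \<eta>(1)] fst_tl dir_deriv_zero[OF X Y]
    by (simp add: bilinear_ladd[OF bilinear_h])
  then show ?thesis by (simp add: \<eta>)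
qed

text \<open>The fibres are totally geodesic: the derivative of the fibre metric along a horizontal
  lift is cancelled by the brackets of that lift with the tangential ones.\<close>

lemma connection_tan_tan_hor:
  assumes \<omega>: "\<omega> \<in> one_forms M" and \<theta>: "\<theta> \<in> one_forms M"
  shows "h (x, p) (D' (T \<omega>) (T \<theta>) (x, p)) (horl u) = 0"
proof -
  obtain Y where Y: "Y \<in> VF" "Y x = u" using vector_field_through[OF hausdorff x_point] by blast
  note F = tan_field[OF \<omega>] tan_field[OF \<theta>] hor_field[OF Y(1)]
  have "2 * h (x, p) (D' (T \<omega>) (T \<theta>) (x, p)) (horl (Y x)) = 0"
    using koszul[OF F]
    unfolding hor_field_q tan_field_q deriv_hor_tan[OF tl_tangent] deriv_tan_tan_hor[OF Y(1) \<omega> \<theta>]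
      bracket_tan_tan[OF \<omega> \<theta>] lie_bracket_swap[of "T \<omega>" "H Y"] lie_bracket_swap[of "T \<theta>" "H Y"]
      bracket_hor_tan[OF Y(1) \<omega>] bracket_hor_tan[OF Y(1) \<theta>] h_uminus
    by (simp add: bilinear_lsub[OF bilinear_h] bilinear_lmul[OF bilinear_h] h_sym[of "tanl (\<omega> x)"])
  then show ?thesis by (simp add: Y)
qed

lemma sh_covec_J: "sh (covec_comp \<omega> (J x)) = - J x (sh \<omega>)"
  by (rule raise_eqI[OF inner_form_g[OF x_point]])
    (simp add: bilinear_lneg[OF bilinear_g] J_skew[OF x_point] covec_comp_inner[OF linear_J[OF x_point]] g_sh)

lemma J_pair_skew: "\<omega> \<bullet> J x (sh \<theta>) = - (\<theta> \<bullet> J x (sh \<omega>))"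
  using J_skew[OF x_point, of "sh \<theta>" "sh \<omega>"] inner_form_sym[OF inner_form_g[OF x_point]] by (metis g_sh g_sh')

lemma jj_covec_J: "jj (covec_comp \<omega> (J x)) = p \<bullet> sh \<omega>"
  using x_point by (simp add: jj_def sh_covec_J linear_neg[OF linear_J[OF x_point]])

lemma h_tl_J: "h (x, p) (tanl (covec_comp \<theta> (J x))) (tanl \<zeta>) =
    - (\<zeta> \<bullet> J x (sh \<theta>)) + jj \<theta> * (p \<bullet> sh \<zeta>) + \<delta>\<^sup>2 * (p \<bullet> sh \<theta>) * jj \<zeta>"
  unfolding h_tl_tl jj_covec_J sh_covec_J by (simp add: jj_def)

text \<open>The Koszul formula is at most quadratic in \<delta>, whereas the pairings of the lifts
  of \<theta>J and \<omega>J carry a further \<delta>^2 by \<open>h_tl_J\<close>. The lift of pJ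
  comes with the coefficient that removes these fourth-order terms.\<close>

lemma connection_tan_tan:
  assumes \<omega>: "\<omega> \<in> one_forms M" and \<theta>: "\<theta> \<in> one_forms M"
  shows "D' (T \<omega>) (T \<theta>) (x, p) =
    - ((p \<bullet> sh (\<theta> x)) *\<^sub>R tanl (\<omega> x))
    + \<delta>\<^sup>2 *\<^sub>R (jj (\<omega> x) *\<^sub>R tanl (covec_comp (\<theta> x) (J x)) + jj (\<theta> x) *\<^sub>R tanl (covec_comp (\<omega> x) (J x)))
    - (\<delta>\<^sup>2 * (jj (\<omega> x) * (p \<bullet> sh (\<theta> x)) + (p \<bullet> sh (\<omega> x)) * jj (\<theta> x))) *\<^sub>R tanl (covec_comp p (J x))"
    (is "?l = ?r")
proof (rule h_eqI)
  note st = subspace_tangent[OF q]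
  show "?l \<in> TS" by (rule connection_tangent[OF tan_field[OF \<omega>] tan_field[OF \<theta>]])
  show "?r \<in> TS"
    by (intro subspace_diff subspace_add subspace_scale subspace_neg st tl_tangent)
  note bh = bilinear_ladd[OF bilinear_h] bilinear_lsub[OF bilinear_h] bilinear_lmul[OF bilinear_h] h_uminus
  show "h (x, p) ?l (horl u) = h (x, p) ?r (horl u)" for u
    by (simp add: connection_tan_tan_hor[OF \<omega> \<theta>] bh)
  fix \<zeta>
  obtain \<eta> where \<eta>: "\<eta> \<in> one_forms M" "\<eta> x = \<zeta>" using one_form_through[OF x_point] by blast
  define w t where "w = \<omega> x" and "t = \<theta> x"
  \<comment> \<open>With \<open>jj_p\<close> and \<open>p_unit\<close> this makes the pairing of the
    lift of pJ with that of \<zeta> equal to (1 + \<delta>^2) times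
    \<open>jj \<zeta>\<close>.\<close>
  have jz: "\<zeta> \<bullet> J x (sh p) = - jj \<zeta>" using J_pair_skew[of \<zeta> p] by (simp add: jj_def)
  note F = tan_field[OF \<omega>] tan_field[OF \<theta>] tan_field[OF \<eta>(1)]
  have "2 * h (x, p) ?l (tanl \<zeta>) = 2 * h (x, p) ?r (tanl \<zeta>)"
    using koszul[OF F]
    unfolding tan_field_q deriv_tan_tan_tan[OF \<theta> \<eta>(1)] deriv_tan_tan_tan[OF \<omega> \<eta>(1)] deriv_tan_tan_tan[OF \<omega> \<theta>]
      bracket_tan_tan[OF \<omega> \<theta>] bracket_tan_tan[OF \<omega> \<eta>(1)] bracket_tan_tan[OF \<theta> \<eta>(1)] \<eta>(2) bh
      w_def[symmetric] t_def[symmetric]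
    \<comment> \<open>The special rule comes before the general \<open>h_tl_tl\<close>, which also
      matches pairings with lifts of \<theta>J and would leave their raised covectors
      unevaluated.\<close>
    unfolding h_tl_J
    unfolding h_tl_tl jz jj_p p_unit
    using J_pair_skew[of w \<zeta>] J_pair_skew[of t \<zeta>] J_pair_skew[of w t] sh_sym[of w \<zeta>] sh_sym[of t \<zeta>] sh_sym[of w t]
    by (simp add: algebra_simps)
  then show "h (x, p) ?l (tanl \<zeta>) = h (x, p) ?r (tanl \<zeta>)" by simp
qed

lemma curvature_comp_inner: "covec_comp p (curvature M D x u v) \<bullet> w = g x (curvature M D x u v w) (sh p)"
  by (simp add: covec_comp_inner[OF linear_curvature[OF x_point]] g_sh')

text \<open>Curvature is skew, so pR(u,v) vanishes on the raised \<open>p\<close> and its normal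
  correction is zero.\<close>

lemma tl_curvature: "tanl (covec_comp p (curvature M D x u v)) = ver_lift (covec_comp p (curvature M D x u v))"
proof -
  have "g x (curvature M D x u v (sh p)) (sh p) = 0"
    using curvature_skew[OF x_point, of u v "sh p" "sh p"] inner_form_sym[OF inner_form_g[OF x_point], of "sh p"] by simp
  then have "p \<bullet> sh (covec_comp p (curvature M D x u v)) = 0"
    using sh_sym[of p] by (simp add: curvature_comp_inner)
  then show ?thesis by (simp add: tl_eq)
qed

lemma connection_hor_hor:
  assumes X: "X \<in> VF" and Y: "Y \<in> VF"
  shows "D' (H X) (H Y) (x, p) = horl (D X Y x) + (1/2) *\<^sub>R tanl (covec_comp p (curvature M D x (X x) (Y x)))"
    (is "?l = ?r")
proof (rule h_eqI)
  show "?l \<in> TS" by (rule connection_tangent[OF hor_field[OF X] hor_field[OF Y]])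
  show "?r \<in> TS" by (intro subspace_add subspace_scale subspace_tangent[OF q] hl_tangent tl_tangent)
  show "h (x, p) ?l (horl u) = h (x, p) ?r (horl u)" for u
    by (simp add: connection_hor_hor_hor[OF X Y] bilinear_ladd[OF bilinear_h] bilinear_lmul[OF bilinear_h])
  show "h (x, p) ?l (tanl \<zeta>) = h (x, p) ?r (tanl \<zeta>)" for \<zeta>
    using connection_hor_hor_tan[OF X Y, of \<zeta>]
    by (simp add: bilinear_ladd[OF bilinear_h] bilinear_lmul[OF bilinear_h] tl_curvature)
qed

text \<open>Pair symmetry moves \<open>p\<close> from the last slot of the curvature into the first
  pair. The inner product with \<theta> then yields R(p,\<theta>), and the deformation term, which
  evaluates at J of the raised \<open>p\<close>, yields R(p,Jp).\<close>

lemma h_tl_curvature: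
  "h (x, p) (tanl \<theta>) (tanl (covec_comp p (curvature M D x u v))) =
    - (g x (curvature M D x (sh p) (sh \<theta>) u) v - \<delta>\<^sup>2 * jj \<theta> * g x (curvature M D x (sh p) (J x (sh p)) u) v)"
proof -
  define R where "R = covec_comp p (curvature M D x u v)"
  have R: "R \<bullet> w = - g x (curvature M D x (sh p) w u) v" for w
    unfolding R_def curvature_comp_inner curvature_pair_symmetry[OF x_point, of u v w]
    by (subst curvature_antisym[OF x_point]) (rule bilinear_lneg[OF bilinear_g])
  have "p \<bullet> J x (sh R) = - (R \<bullet> J x (sh p))" by (rule J_pair_skew)
  then have j: "jj R = g x (curvature M D x (sh p) (J x (sh p)) u) v" by (simp add: jj_def R)
  have "h (x, p) (tanl \<theta>) (tanl R) = h (x, p) (ver_lift R) (tanl \<theta>)"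
    using h_sym tl_curvature by (metis R_def)
  also have "\<dots> = R \<bullet> sh \<theta> - (p \<bullet> sh \<theta>) * (R \<bullet> sh p) + \<delta>\<^sup>2 * jj R * jj \<theta>"
    unfolding h_ver_tl by (simp add: sh_sym[of R])
  also have "R \<bullet> sh p = 0"
    using curvature_skew[OF x_point, of u v "sh p" "sh p"] inner_form_sym[OF inner_form_g[OF x_point], of "sh p"]
    by (simp add: R_def curvature_comp_inner)
  finally show ?thesis by (simp add: R j R_def[symmetric])
qed

text \<open>Horizontal component: tangential and horizontal lifts are orthogonal, so metricity
  transfers it to \<open>connection_hor_hor\<close>. Tangential component: it is that of the bracket
  alone, because the derivative of the horizontal lift along the fibre has none.\<close>

lemma connection_hor_tan:
  assumes X: "X \<in> VF" and \<theta>: "\<theta> \<in> one_forms M"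
  shows "D' (H X) (T \<theta>) (x, p) = tanl (covd_form M D X \<theta> x)
    + (1/2) *\<^sub>R (horl (curvature M D x (sh p) (sh (\<theta> x)) (X x))
      - (\<delta>\<^sup>2 * jj (\<theta> x)) *\<^sub>R horl (curvature M D x (sh p) (J x (sh p)) (X x)))"
    (is "?l = ?r")
proof (rule h_eqI)
  note bh = bilinear_ladd[OF bilinear_h] bilinear_lsub[OF bilinear_h] bilinear_lmul[OF bilinear_h]
    bilinear_radd[OF bilinear_h] bilinear_rmul[OF bilinear_h]
  show "?l \<in> TS" by (rule connection_tangent[OF hor_field[OF X] tan_field[OF \<theta>]])
  show "?r \<in> TS" by (intro subspace_add subspace_diff subspace_scale subspace_tangent[OF q] hl_tangent tl_tangent)
  show "h (x, p) ?l (horl u) = h (x, p) ?r (horl u)" for u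
  proof -
    obtain Z where Z: "Z \<in> VF" "Z x = u" using vector_field_through[OF hausdorff x_point] by blast
    have "h (x, p) ?l (horl u) = - h (x, p) (tanl (\<theta> x)) (D' (H X) (H Z) (x, p))"
      using connection_metric[OF hor_field[OF X] tan_field[OF \<theta>] hor_field[OF Z(1)]]
      unfolding hor_field_q tan_field_q deriv_hor_tan[OF hl_tangent] Z(2) by simp
    also have "\<dots> = h (x, p) ?r (horl u)"
      unfolding connection_hor_hor[OF X Z(1)] bh h_tl_curvature by (simp add: bh Z field_simps)
    finally show ?thesis .
  qed
  show "h (x, p) ?l (tanl \<zeta>) = h (x, p) ?r (tanl \<zeta>)" for \<zeta>
  proof -
    obtain \<eta> where \<eta>: "\<eta> \<in> one_forms M" "\<eta> x = \<zeta>" using one_form_through[OF x_point] by blast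
    \<comment> \<open>Total geodesy of the fibres, read through metricity: the derivative of
      \<open>H X\<close> along \<open>T \<theta>\<close> is orthogonal to all tangential
      lifts.\<close>
    have "h (x, p) (horl (X x)) (D' (T \<theta>) (T \<eta>) (x, p)) = 0"
      using connection_tan_tan_hor[OF \<theta> \<eta>(1)] h_sym by metis
    then have "h (x, p) (D' (T \<theta>) (H X) (x, p)) (tanl \<zeta>) = 0"
      using connection_metric[OF tan_field[OF \<theta>] hor_field[OF X] tan_field[OF \<eta>(1)]]
      unfolding hor_field_q tan_field_q deriv_hor_tan[OF tl_tangent] \<eta>(2) by simp
    then show ?thesis
      unfolding connection_torsion[OF hor_field[OF X] tan_field[OF \<theta>]] bracket_hor_tan[OF X \<theta>] by (simp add: bh)
  qed
qed

text \<open>Torsion-freeness subtracts the bracket, which is precisely the tangential term of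
  \<open>connection_hor_tan\<close>.\<close>

lemma connection_tan_hor:
  assumes Y: "Y \<in> VF" and \<omega>: "\<omega> \<in> one_forms M"
  shows "D' (T \<omega>) (H Y) (x, p) =
    (1/2) *\<^sub>R (horl (curvature M D x (sh p) (sh (\<omega> x)) (Y x))
      - (\<delta>\<^sup>2 * jj (\<omega> x)) *\<^sub>R horl (curvature M D x (sh p) (J x (sh p)) (Y x)))"
  using connection_torsion[OF hor_field[OF Y] tan_field[OF \<omega>]]
  unfolding connection_hor_tan[OF Y \<omega>] bracket_hor_tan[OF Y \<omega>] by simp

end

lemma kaehler_manifold_imp_locale:
  assumes "kaehler_manifold M J g D"
  shows "kaehler M g D J"
proof
  have sm: "smooth_manifold M" using assms by (simp add: kaehler_manifold_def)
  show "inj_on (snd c) (fst c)" if "c \<in> charts M" for c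
    using sm that by (simp add: smooth_manifold_def)
  show "open (snd c ` (fst c \<inter> fst d))" "smooth_on (snd c ` (fst c \<inter> fst d)) (transition c d)"
    if "c \<in> charts M" "d \<in> charts M" for c d
    using sm that unfolding smooth_manifold_def by blast+
  show "pref M x \<in> charts M \<and> x \<in> fst (pref M x)" if "x \<in> points M" for x
    using sm that by (simp add: smooth_manifold_def)
  show "Hausdorff_space (mfd_topology M)" using sm by (simp add: smooth_manifold_def)
qed (use assms in \<open>auto simp: kaehler_manifold_def\<close>)

theorem theorem4p1:
  fixes M :: "('a, real^'n) mfd"
    and m :: nat
    and J :: "'a \<Rightarrow> real^'n \<Rightarrow> real^'n"
    and g :: "'a \<Rightarrow> real^'n \<Rightarrow> real^'n \<Rightarrow> real"
    and D :: "('a \<Rightarrow> real^'n) \<Rightarrow> ('a \<Rightarrow> real^'n) \<Rightarrow> 'a \<Rightarrow> real^'n"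
    and D' :: "('a \<times> (real^'n) \<Rightarrow> (real^'n) \<times> (real^'n)) \<Rightarrow> ('a \<times> (real^'n) \<Rightarrow> (real^'n) \<times> (real^'n)) \<Rightarrow>
               'a \<times> (real^'n) \<Rightarrow> (real^'n) \<times> (real^'n)"
    and \<delta> :: real
    and X Y \<omega> \<theta> :: "'a \<Rightarrow> real^'n"
    and x :: 'a and p :: "real^'n"
  assumes "CARD('n) = 2 * m"
    and "kaehler_manifold M J g D"
    and "levi_civita (cotangent_bundle M) (unit_cotangent_bundle M g) (berger_sasaki M J g \<delta>) D'"
    and "X \<in> vector_fields M (points M)" and "Y \<in> vector_fields M (points M)"
    and "\<omega> \<in> one_forms M" and "\<theta> \<in> one_forms M"
    and "(x, p) \<in> unit_cotangent_bundle M g"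
  shows
    "(D' (hor_field M g X) (hor_field M g Y) (x, p) =
       hor_lift M g (x, p) (D X Y x)
       + (1/2) *\<^sub>R tan_lift g (x, p) (covec_comp p (curvature M D x (X x) (Y x))))
     \<and>
     (D' (hor_field M g X) (tan_field g \<theta>) (x, p) =
       tan_lift g (x, p) (covd_form M D X \<theta> x)
       + (1/2) *\<^sub>R
         (hor_lift M g (x, p) (curvature M D x (sharp g x p) (sharp g x (\<theta> x)) (X x))
          - (\<delta>\<^sup>2 * ginv g x (\<theta> x) (covec_comp p (J x))) *\<^sub>R
            hor_lift M g (x, p) (curvature M D x (sharp g x p) (J x (sharp g x p)) (X x))))
     \<and>
     (D' (tan_field g \<omega>) (hor_field M g Y) (x, p) =
       (1/2) *\<^sub>R
         (hor_lift M g (x, p) (curvature M D x (sharp g x p) (sharp g x (\<omega> x)) (Y x))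
          - (\<delta>\<^sup>2 * ginv g x (\<omega> x) (covec_comp p (J x))) *\<^sub>R
            hor_lift M g (x, p) (curvature M D x (sharp g x p) (J x (sharp g x p)) (Y x))))
     \<and>
     (D' (tan_field g \<omega>) (tan_field g \<theta>) (x, p) =
       - (ginv g x (\<theta> x) p *\<^sub>R tan_lift g (x, p) (\<omega> x))
       + \<delta>\<^sup>2 *\<^sub>R
         (ginv g x (\<omega> x) (covec_comp p (J x)) *\<^sub>R tan_lift g (x, p) (covec_comp (\<theta> x) (J x))
          + ginv g x (\<theta> x) (covec_comp p (J x)) *\<^sub>R tan_lift g (x, p) (covec_comp (\<omega> x) (J x)))
       - (\<delta>\<^sup>2 * (ginv g x (\<omega> x) (covec_comp p (J x)) * ginv g x (\<theta> x) p
               + ginv g x (\<omega> x) p * ginv g x (\<theta> x) (covec_comp p (J x)))) *\<^sub>R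
         tan_lift g (x, p) (covec_comp p (J x)))"
proof -
  interpret K: kaehler M g D J by (rule kaehler_manifold_imp_locale[OF assms(2)])
  interpret B: berger_levi_civita M g D J x p \<delta> D'
    by unfold_locales (use assms in auto)
  show ?thesis
    unfolding sharp_eq_raise B.ginv_pJ B.ginv_p
    using B.connection_hor_hor[OF assms(4,5)] B.connection_hor_tan[OF assms(4,7)]
      B.connection_tan_hor[OF assms(5,6)] B.connection_tan_tan[OF assms(6,7)]
    by (intro conjI) assumption+
qed

end
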